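(* Assume that there is a number $\gamma$ with $0<\gamma<1$ and a constant $C>0$ such that for all $\{\alpha,\beta\}\subseteq\{1,\dots,s\}$ the scattering cross sections satisfy $$0\le \sigma_{\alpha\beta}\left(|\mathbf g|,\cos\theta,I,I_*,I',I'_*\right)\le C\,\frac{\Psi_{\alpha\beta}+\left(\Psi_{\alpha\beta}\right)^{\gamma/2}}{|\mathbf g|^2}\,\Upsilon_{\alpha\beta}\qquad\text{for }\mu_{\alpha\beta}|\mathbf g|^2>2\Delta I,$$ where $$\Upsilon_{\alpha\beta}=\frac{(I')^{\delta^{(\alpha)}/2-1}(I'_* )^{\delta^{(\beta)}/2-1}}{\mathcal E_{\alpha\beta}^{\delta^{(\alpha)}/2}(\mathcal E^*_{\alpha\beta})^{\delta^{(\beta)}/2}},\qquad \Psi_{\alpha\beta}=|\mathbf g|\sqrt{|\mathbf g|^2-\frac{2\Delta I}{\mu_{\alpha\beta}}}.$$ Then the linearized collision operator $\mathcal L$ is a closed, densely defined, self-adjoint operator on $\mathfrak h$.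
   Context: **Species.** Fix $s=s_0+s_1$ species with masses $m_1,\dots,m_s>0$; species $\alpha\in\{1,\dots,s_0\}$ are monatomic, species $\alpha\in\{s_0+1,\dots,s\}$ are polyatomic. Let $\delta^{(1)}=\dots=\delta^{(s_0)}=2$ and let $\delta^{(\alpha)}\ge 2$ be given real numbers for $\alpha\in\{s_0+1,\dots,s\}$ (internal degrees of freedom). A particle is described by $\mathbf Z=\boldsymbol\xi\in\mathbb R^3$ (monatomic) or $\mathbf Z=(\boldsymbol\xi,I)\in\mathbb R^3\times\mathbb R_+$ (polyatomic). Convention: formulas are written uniformly with an internal energy variable; for a monatomic species the internal energy is the constant $1$, and any integration with respect to an internal energy variable of a monatomic species is understood to include a Dirac delta $\delta_1(I-1)$ (i.e. the variable is set to $1$). In a collision of species $\alpha$ and $\beta$, the variables $\boldsymbol\xi,\boldsymbol\xi',I,I'$ belong to species $\alpha$ and $\boldsymbol\xi_*,\boldsymbol\xi'_*,I_*,I'_*$ to species $\beta$. For a vector function $h=(h_1,\dots,h_s)$: $h_\alpha=h_\alpha(\boldsymbol\xi,I)$, $h_{\beta*}=h_\beta(\boldsymbol\xi_*,I_* )$, $h'_\alpha=h_\alpha(\boldsymbol\xi',I')$, $h'_{\beta*}=h_\beta(\boldsymbol\xi'_*,I'_* )$. **Hilbert space.** $\mathfrak h=(L^2(d\boldsymbol\xi))^{s_0}\times(L^2(d\boldsymbol\xi\,dI))^{s_1}$ (real) with inner product $(f,g)=\sum_{\alpha=1}^{s_0}\int_{\mathbb R^3}f_\alpha g_\alpha\,d\boldsymbol\xi+\sum_{\alpha=s_0+1}^{s}\int_{\mathbb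 R^3\times\mathbb R_+}f_\alpha g_\alpha\,d\boldsymbol\xi\,dI$. **Kinematics.** $\mathbf g=\boldsymbol\xi-\boldsymbol\xi_*$, $\mathbf g'=\boldsymbol\xi'-\boldsymbol\xi'_*$, $\cos\theta=\frac{\mathbf g\cdot\mathbf g'}{|\mathbf g||\mathbf g'|}$, $\mu_{\alpha\beta}=\frac{m_\alpha m_\beta}{m_\alpha+m_\beta}$, $\Delta I=I'+I'_*-I-I_*$, $\mathbf G_{\alpha\beta}=\frac{m_\alpha\boldsymbol\xi+m_\beta\boldsymbol\xi_*}{m_\alpha+m_\beta}$, $E_{\alpha\beta}=\frac{\mu_{\alpha\beta}}2|\mathbf g|^2+I+I_*$. $\mathcal E_{\alpha\beta}=1$ if $\alpha$ is monatomic; $\mathcal E_{\alpha\beta}=\frac{\mu_{\alpha\beta}}2|\mathbf g|^2+I$ if $\alpha$ is polyatomic and $\beta$ monatomic; $\mathcal E_{\alpha\beta}=\frac{\mu_{\alpha\beta}}2|\mathbf g|^2+I+I_*$ if both are polyatomic. $\mathcal E^*_{\alpha\beta}=1$ if $\beta$ is monatomic; $\mathcal E^*_{\alpha\beta}=\frac{\mu_{\alpha\beta}}2|\mathbf g|^2+I_*$ if $\beta$ is polyatomic and $\alpha$ monatomic; $\mathcal E^*_{\alpha\beta}=\frac{\mu_{\alpha\beta}}2|\mathbf g|^2+I+I_*$ if both are polyatomic. **Scattering cross sections and transition probabilities.** $\sigma_{\alpha\beta}=\sigma_{\alpha\beta}(|\mathbf g|,\cos\theta,I,I_*,I',I'_*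 )>0$ a.e. (independent of $I,I'$ if $\alpha$ is monatomic, and of $I_*,I'_*$ if $\beta$ is monatomic). The transition probabilities are $$W_{\alpha\beta}(\boldsymbol\xi,\boldsymbol\xi_*,I,I_*|\boldsymbol\xi',\boldsymbol\xi'_*,I',I'_* )=(m_\alpha+m_\beta)^2m_\alpha m_\beta I^{\delta^{(\alpha)}/2-1}I_*^{\delta^{(\beta)}/2-1}\sigma_{\alpha\beta}\frac{|\mathbf g|}{|\mathbf g'|}\,\widehat\delta_1\widehat\delta_3,$$ with $\widehat\delta_1=\delta_1\big(\frac12(m_\alpha|\boldsymbol\xi|^2+m_\beta|\boldsymbol\xi_*|^2-m_\alpha|\boldsymbol\xi'|^2-m_\beta|\boldsymbol\xi'_*|^2)-\Delta I\big)$, $\widehat\delta_3=\delta_3(m_\alpha\boldsymbol\xi+m_\beta\boldsymbol\xi_*-m_\alpha\boldsymbol\xi'-m_\beta\boldsymbol\xi'_* )$ (Dirac deltas in $\mathbb R$, $\mathbb R^3$). Equivalently, for a function $F$, $$\int_{\mathbb R^3\times\mathbb R^3}F\,W_{\alpha\beta}\,d\boldsymbol\xi'd\boldsymbol\xi'_*=I^{\delta^{(\alpha)}/2-1}I_*^{\delta^{(\beta)}/2-1}|\mathbf g|\,\mathbf 1_{\mu_{\alpha\beta}|\mathbf g|^2>2\Delta I}\int_{\mathbb S^2}F\,\sigma_{\alpha\beta}\,d\boldsymbol\omega,$$ where on the right $\boldsymbol\xi'=\mathbf G_{\alpha\beta}+\frac{m_\beta}{m_\alpha+m_\beta}\sqrt{|\mathbf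 g|^2-\frac{2\Delta I}{\mu_{\alpha\beta}}}\,\boldsymbol\omega$, $\boldsymbol\xi'_*=\mathbf G_{\alpha\beta}-\frac{m_\alpha}{m_\alpha+m_\beta}\sqrt{|\mathbf g|^2-\frac{2\Delta I}{\mu_{\alpha\beta}}}\,\boldsymbol\omega$. Standing assumptions: microreversibility $I^{\delta^{(\alpha)}/2-1}I_*^{\delta^{(\beta)}/2-1}|\mathbf g|^2\sigma_{\alpha\beta}(|\mathbf g|,\cos\theta,I,I_*,I',I'_* )=(I')^{\delta^{(\alpha)}/2-1}(I'_* )^{\delta^{(\beta)}/2-1}|\mathbf g'|^2\sigma_{\alpha\beta}(|\mathbf g'|,\cos\theta,I',I'_*,I,I_* )$; symmetry $\sigma_{\alpha\beta}(|\mathbf g|,\cos\theta,I,I_*,I',I'_* )=\sigma_{\beta\alpha}(|\mathbf g|,\cos\theta,I_*,I,I'_*,I')$; and $\sigma_{\alpha\alpha}$ depends on $\cos\theta$ only through $|\cos\theta|$, with $\sigma_{\alpha\alpha}(|\mathbf g|,|\cos\theta|,I,I_*,I',I'_* )=\sigma_{\alpha\alpha}(|\mathbf g|,|\cos\theta|,I_*,I,I',I'_* )=\sigma_{\alpha\alpha}(|\mathbf g|,|\cos\theta|,I_*,I,I'_*,I')$. **Maxwellian.** For constants $n_\alpha>0$: $M_\alpha=\frac{n_\alpha m_\alpha^{3/2}}{(2\pi)^{3/2}}e^{-m_\alpha|\boldsymbol\xi|^2/2}$ for $\alpha\le s_0$, and $M_\alpha=\frac{n_\alpha I^{\delta^{(\alpha)}/2-1}m_\alpha^{3/2}}{(2\pi)^{3/2}\Gamma(\delta^{(\alpha)}/2)}e^{-m_\alpha|\boldsymbol\xi|^2/2}e^{-I}$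 for $\alpha>s_0$ ($\Gamma$ the Gamma function). **Linearized collision operator.** $\mathcal L=(\mathcal L_1,\dots,\mathcal L_s)$, $\mathcal L=\Lambda-K$, $\mathcal L_\alpha h=\nu_\alpha h_\alpha-K_\alpha(h)$, where $$\nu_\alpha=\sum_{\beta=1}^s\int_{(\mathbb R^3\times\mathbb R_+)^3}\frac{M_{\beta*}}{I^{\delta^{(\alpha)}/2-1}I_*^{\delta^{(\beta)}/2-1}}W_{\alpha\beta}\,d\boldsymbol\xi_*d\boldsymbol\xi'd\boldsymbol\xi'_*dI_*dI'dI'_*,$$ $$K_\alpha(h)=\sum_{\beta=1}^s\int_{(\mathbb R^3\times\mathbb R_+)^3}\left(\frac{h'_\alpha}{(M'_\alpha)^{1/2}}+\frac{h'_{\beta*}}{(M'_{\beta*})^{1/2}}-\frac{h_{\beta*}}{M_{\beta*}^{1/2}}\right)\frac{(M_{\beta*}M'_\alpha M'_{\beta*})^{1/2}\,W_{\alpha\beta}}{(II')^{\delta^{(\alpha)}/4-1/2}(I_*I'_* )^{\delta^{(\beta)}/4-1/2}}\,d\boldsymbol\xi_*d\boldsymbol\xi'd\boldsymbol\xi'_*dI_*dI'dI'_*,$$ and $\Lambda f=\nu f$ with $\nu=\mathrm{diag}(\nu_1,\dots,\nu_s)$. The domain of $\mathcal L$ is $D(\mathcal L)=D(\Lambda)=\{h\in\mathfrak h:\nu h\in\mathfrak h\}$. *)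

theory Defs
  imports "HOL-Probability.Probability"
begin

subsection \<open>Mixtures\<close>

text \<open>
  Species are numbered from 1; the first \<open>n_mono\<close> of them are monatomic, the following \<open>n_poly\<close>
  polyatomic. \<open>xsec\<close> takes the arguments
  \<open>|g|\<close>, \<open>cos \<theta>\<close>, \<open>I\<close>, \<open>I\<^sub>*\<close>, \<open>I'\<close>, \<open>I'\<^sub>*\<close> in this order.
\<close>

record mixture =
  n_mono :: nat
  n_poly :: nat
  mass :: "nat \<Rightarrow> real"
  dof :: "nat \<Rightarrow> real"
  dens :: "nat \<Rightarrow> real"
  xsec :: "nat \<Rightarrow> nat \<Rightarrow> real \<Rightarrow> real \<Rightarrow> real \<Rightarrow> real \<Rightarrow> real \<Rightarrow> real \<Rightarrow> real"

definition species :: "mixture \<Rightarrow> nat set" where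
  "species X = {1..n_mono X + n_poly X}"

definition monatomic :: "mixture \<Rightarrow> nat \<Rightarrow> bool" where
  "monatomic X \<alpha> \<longleftrightarrow> \<alpha> \<le> n_mono X"

definition internal_energy :: "mixture \<Rightarrow> nat \<Rightarrow> real \<Rightarrow> bool" where
  "internal_energy X \<alpha> I \<longleftrightarrow> (if monatomic X \<alpha> then I = 1 else 0 < I)"

text \<open>
  The internal energy of a monatomic species is the constant 1, so that integration with respect
  to it is against the Dirac measure at 1. Consequently every component of a vector function has
  two arguments, and \<open>L\<^sup>2(phase X \<alpha>)\<close> is \<open>L\<^sup>2(d\<xi>)\<close> for a monatomic species.
\<close>

definition internal_measure :: "mixture \<Rightarrow> nat \<Rightarrow> real measure" where
  "internal_measure X \<alpha> =
     (if monatomic X \<alpha> then return borel 1 else density lborel (indicator {0<..}))"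

definition phase :: "mixture \<Rightarrow> nat \<Rightarrow> ((real^3) \<times> real) measure" where
  "phase X \<alpha> = lborel \<Otimes>\<^sub>M internal_measure X \<alpha>"


subsection \<open>Kinematics\<close>

definition red_mass :: "mixture \<Rightarrow> nat \<Rightarrow> nat \<Rightarrow> real" where
  "red_mass X \<alpha> \<beta> = mass X \<alpha> * mass X \<beta> / (mass X \<alpha> + mass X \<beta>)"

definition energy_gap :: "real \<Rightarrow> real \<Rightarrow> real \<Rightarrow> real \<Rightarrow> real" where
  "energy_gap I Is I' Is' = I' + Is' - I - Is"

text \<open>The relative speed \<open>|g'|\<close> after a collision, as determined by energy conservation from
  the relative speed \<open>r = |g|\<close> before it.\<close>

definition post_speed ::
    "mixture \<Rightarrow> nat \<Rightarrow> nat \<Rightarrow> real \<Rightarrow> real \<Rightarrow> real \<Rightarrow> real \<Rightarrow> real \<Rightarrow> real" where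
  "post_speed X \<alpha> \<beta> r I Is I' Is' = sqrt (r\<^sup>2 - 2 * energy_gap I Is I' Is' / red_mass X \<alpha> \<beta>)"

definition center_vel :: "mixture \<Rightarrow> nat \<Rightarrow> nat \<Rightarrow> real^3 \<Rightarrow> real^3 \<Rightarrow> real^3" where
  "center_vel X \<alpha> \<beta> \<xi> \<xi>s =
     (1 / (mass X \<alpha> + mass X \<beta>)) *\<^sub>R (mass X \<alpha> *\<^sub>R \<xi> + mass X \<beta> *\<^sub>R \<xi>s)"

definition post_vel ::
    "mixture \<Rightarrow> nat \<Rightarrow> nat \<Rightarrow> real^3 \<Rightarrow> real^3 \<Rightarrow> real \<Rightarrow> real \<Rightarrow> real \<Rightarrow> real \<Rightarrow> real^3 \<Rightarrow> real^3" where
  "post_vel X \<alpha> \<beta> \<xi> \<xi>s I Is I' Is' \<omega> = center_vel X \<alpha> \<beta> \<xi> \<xi>s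
     + (mass X \<beta> / (mass X \<alpha> + mass X \<beta>) * post_speed X \<alpha> \<beta> (norm (\<xi> - \<xi>s)) I Is I' Is') *\<^sub>R \<omega>"

definition post_vel_s ::
    "mixture \<Rightarrow> nat \<Rightarrow> nat \<Rightarrow> real^3 \<Rightarrow> real^3 \<Rightarrow> real \<Rightarrow> real \<Rightarrow> real \<Rightarrow> real \<Rightarrow> real^3 \<Rightarrow> real^3" where
  "post_vel_s X \<alpha> \<beta> \<xi> \<xi>s I Is I' Is' \<omega> = center_vel X \<alpha> \<beta> \<xi> \<xi>s
     - (mass X \<alpha> / (mass X \<alpha> + mass X \<beta>) * post_speed X \<alpha> \<beta> (norm (\<xi> - \<xi>s)) I Is I' Is') *\<^sub>R \<omega>"

definition cos_angle :: "real^3 \<Rightarrow> real^3 \<Rightarrow> real" where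
  "cos_angle g g' = (g \<bullet> g') / (norm g * norm g')"

definition energy_fac :: "mixture \<Rightarrow> nat \<Rightarrow> nat \<Rightarrow> real \<Rightarrow> real \<Rightarrow> real \<Rightarrow> real" where
  "energy_fac X \<alpha> \<beta> r I Is =
     (if monatomic X \<alpha> then 1
      else if monatomic X \<beta> then red_mass X \<alpha> \<beta> / 2 * r\<^sup>2 + I
      else red_mass X \<alpha> \<beta> / 2 * r\<^sup>2 + I + Is)"

definition energy_fac_s :: "mixture \<Rightarrow> nat \<Rightarrow> nat \<Rightarrow> real \<Rightarrow> real \<Rightarrow> real \<Rightarrow> real" where
  "energy_fac_s X \<alpha> \<beta> r I Is =
     (if monatomic X \<beta> then 1
      else if monatomic X \<alpha> then red_mass X \<alpha> \<beta> / 2 * r\<^sup>2 + Is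
      else red_mass X \<alpha> \<beta> / 2 * r\<^sup>2 + I + Is)"

definition Psi ::
    "mixture \<Rightarrow> nat \<Rightarrow> nat \<Rightarrow> real \<Rightarrow> real \<Rightarrow> real \<Rightarrow> real \<Rightarrow> real \<Rightarrow> real" where
  "Psi X \<alpha> \<beta> r I Is I' Is' =
     r * sqrt (r\<^sup>2 - 2 * energy_gap I Is I' Is' / red_mass X \<alpha> \<beta>)"

definition Upsilon ::
    "mixture \<Rightarrow> nat \<Rightarrow> nat \<Rightarrow> real \<Rightarrow> real \<Rightarrow> real \<Rightarrow> real \<Rightarrow> real \<Rightarrow> real" where
  "Upsilon X \<alpha> \<beta> r I Is I' Is' =
     (I' powr (dof X \<alpha> / 2 - 1) * Is' powr (dof X \<beta> / 2 - 1))
     / (energy_fac X \<alpha> \<beta> r I Is powr (dof X \<alpha> / 2) * energy_fac_s X \<alpha> \<beta> r I Is powr (dof X \<beta> / 2))"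


subsection \<open>Standing assumptions\<close>

definition collision_args ::
    "mixture \<Rightarrow> nat \<Rightarrow> nat \<Rightarrow> real \<Rightarrow> real \<Rightarrow> real \<Rightarrow> real \<Rightarrow> real \<Rightarrow> real \<Rightarrow> bool" where
  "collision_args X \<alpha> \<beta> r c I Is I' Is' \<longleftrightarrow>
     0 < r \<and> - 1 \<le> c \<and> c \<le> 1 \<and>
     internal_energy X \<alpha> I \<and> internal_energy X \<beta> Is \<and>
     internal_energy X \<alpha> I' \<and> internal_energy X \<beta> Is' \<and>
     2 * energy_gap I Is I' Is' < red_mass X \<alpha> \<beta> * r\<^sup>2"

locale gas_mixture =
  fixes X :: mixture
  assumes mass_pos: "\<alpha> \<in> species X \<Longrightarrow> 0 < mass X \<alpha>"
    and dens_pos: "\<alpha> \<in> species X \<Longrightarrow> 0 < dens X \<alpha>"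
    and dof_mono: "\<alpha> \<in> species X \<Longrightarrow> monatomic X \<alpha> \<Longrightarrow> dof X \<alpha> = 2"
    and dof_poly: "\<alpha> \<in> species X \<Longrightarrow> \<not> monatomic X \<alpha> \<Longrightarrow> 2 \<le> dof X \<alpha>"
    and xsec_measurable: "\<alpha> \<in> species X \<Longrightarrow> \<beta> \<in> species X \<Longrightarrow>
      (\<lambda>(r, c, I, Is, I', Is'). xsec X \<alpha> \<beta> r c I Is I' Is') \<in> borel_measurable borel"
    and xsec_pos: "\<alpha> \<in> species X \<Longrightarrow> \<beta> \<in> species X \<Longrightarrow>
      AE (r, c, I, Is, I', Is') in lborel \<Otimes>\<^sub>M (lborel \<Otimes>\<^sub>M (internal_measure X \<alpha> \<Otimes>\<^sub>M
          (internal_measure X \<beta> \<Otimes>\<^sub>M (internal_measure X \<alpha> \<Otimes>\<^sub>M internal_measure X \<beta>)))).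
        collision_args X \<alpha> \<beta> r c I Is I' Is' \<longrightarrow> 0 < xsec X \<alpha> \<beta> r c I Is I' Is'"
    and xsec_indep: "\<alpha> \<in> species X \<Longrightarrow> \<beta> \<in> species X \<Longrightarrow> monatomic X \<alpha> \<Longrightarrow>
      xsec X \<alpha> \<beta> r c I Is I' Is' = xsec X \<alpha> \<beta> r c J Is J' Is'"
    and xsec_indep_s: "\<alpha> \<in> species X \<Longrightarrow> \<beta> \<in> species X \<Longrightarrow> monatomic X \<beta> \<Longrightarrow>
      xsec X \<alpha> \<beta> r c I Is I' Is' = xsec X \<alpha> \<beta> r c I Js I' Js'"
    and microreversibility: "\<alpha> \<in> species X \<Longrightarrow> \<beta> \<in> species X \<Longrightarrow>
      collision_args X \<alpha> \<beta> r c I Is I' Is' \<Longrightarrow> r' = post_speed X \<alpha> \<beta> r I Is I' Is' \<Longrightarrow>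
      I powr (dof X \<alpha> / 2 - 1) * Is powr (dof X \<beta> / 2 - 1) * r\<^sup>2 * xsec X \<alpha> \<beta> r c I Is I' Is' =
      I' powr (dof X \<alpha> / 2 - 1) * Is' powr (dof X \<beta> / 2 - 1) * r'\<^sup>2 * xsec X \<alpha> \<beta> r' c I' Is' I Is"
    and xsec_sym: "\<alpha> \<in> species X \<Longrightarrow> \<beta> \<in> species X \<Longrightarrow>
      collision_args X \<alpha> \<beta> r c I Is I' Is' \<Longrightarrow>
      xsec X \<alpha> \<beta> r c I Is I' Is' = xsec X \<beta> \<alpha> r c Is I Is' I'"
    and xsec_abs_cos: "\<alpha> \<in> species X \<Longrightarrow> collision_args X \<alpha> \<alpha> r c I Is I' Is' \<Longrightarrow>
      xsec X \<alpha> \<alpha> r c I Is I' Is' = xsec X \<alpha> \<alpha> r \<bar>c\<bar> I Is I' Is'"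
    and xsec_swap: "\<alpha> \<in> species X \<Longrightarrow> collision_args X \<alpha> \<alpha> r c I Is I' Is' \<Longrightarrow>
      xsec X \<alpha> \<alpha> r \<bar>c\<bar> I Is I' Is' = xsec X \<alpha> \<alpha> r \<bar>c\<bar> Is I I' Is'"
    and xsec_swap_both: "\<alpha> \<in> species X \<Longrightarrow> collision_args X \<alpha> \<alpha> r c I Is I' Is' \<Longrightarrow>
      xsec X \<alpha> \<alpha> r \<bar>c\<bar> Is I I' Is' = xsec X \<alpha> \<alpha> r \<bar>c\<bar> Is I Is' I'"


subsection \<open>Collision integrals\<close>

text \<open>The surface measure \<open>d\<omega>\<close> on the unit sphere:
  \<open>\<omega>(A) = 3 \<lambda>{x. |x| < 1 \<and> x / |x| \<in> A}\<close>, of total mass \<open>4 \<pi>\<close>.\<close>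

definition sphere_measure :: "(real^3) measure" where
  "sphere_measure = distr (density lborel (\<lambda>x. 3 * indicator (ball 0 1) x)) borel (\<lambda>x. x /\<^sub>R norm x)"

text \<open>
  For fixed \<open>\<xi>, \<xi>\<^sub>*, I, I\<^sub>*, I', I'\<^sub>*\<close> the transition probability \<open>W\<close> contains the Dirac factors of
  momentum and energy conservation, so \<open>W d\<xi>' d\<xi>'\<^sub>*\<close> is a measure carried by the sphere of
  post-collisional velocities \<open>post_vel\<close>, \<open>post_vel_s\<close>, parametrized by \<open>\<omega>\<close>.
  \<open>trans_weight\<close> is its density with respect to \<open>d\<omega>\<close>:
  \<open>\<integral> F W d\<xi>' d\<xi>'\<^sub>* = \<integral> F(post_vel, post_vel_s) trans_weight d\<omega>\<close>.
  (With \<open>M = m\<^sub>\<alpha> + m\<^sub>\<beta>\<close>, integrating out the deltas gives the factor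
  \<open>M\<^sup>2 m\<^sub>\<alpha> m\<^sub>\<beta> (|g| / |g'|) (|g'| / \<mu>) / M\<^sup>3 = |g|\<close>.)
\<close>

definition trans_weight ::
    "mixture \<Rightarrow> nat \<Rightarrow> nat \<Rightarrow> real^3 \<Rightarrow> real^3 \<Rightarrow> real \<Rightarrow> real \<Rightarrow> real \<Rightarrow> real \<Rightarrow> real^3 \<Rightarrow> real" where
  "trans_weight X \<alpha> \<beta> \<xi> \<xi>s I Is I' Is' \<omega> =
     (let g = \<xi> - \<xi>s;
          g' = post_vel X \<alpha> \<beta> \<xi> \<xi>s I Is I' Is' \<omega> - post_vel_s X \<alpha> \<beta> \<xi> \<xi>s I Is I' Is' \<omega>
      in if red_mass X \<alpha> \<beta> * (norm g)\<^sup>2 > 2 * energy_gap I Is I' Is'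
         then I powr (dof X \<alpha> / 2 - 1) * Is powr (dof X \<beta> / 2 - 1) * norm g
              * xsec X \<alpha> \<beta> (norm g) (cos_angle g g') I Is I' Is'
         else 0)"

text \<open>
  For a function \<open>F\<close> of \<open>\<xi>\<^sub>*, \<xi>', \<xi>'\<^sub>*, I\<^sub>*, I', I'\<^sub>*\<close>, the integral of
  \<open>F W d\<xi>\<^sub>* d\<xi>' d\<xi>'\<^sub>* dI\<^sub>* dI' dI'\<^sub>*\<close> at a fixed \<open>(\<xi>, I)\<close>.
\<close>

definition coll_measure ::
    "mixture \<Rightarrow> nat \<Rightarrow> nat \<Rightarrow> ((real^3) \<times> real \<times> real \<times> real \<times> (real^3)) measure" where
  "coll_measure X \<alpha> \<beta> = lborel \<Otimes>\<^sub>M (internal_measure X \<beta> \<Otimes>\<^sub>M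
     (internal_measure X \<alpha> \<Otimes>\<^sub>M (internal_measure X \<beta> \<Otimes>\<^sub>M sphere_measure)))"

definition coll_integrand ::
    "mixture \<Rightarrow> nat \<Rightarrow> nat \<Rightarrow> real^3 \<Rightarrow> real
     \<Rightarrow> (real^3 \<Rightarrow> real^3 \<Rightarrow> real^3 \<Rightarrow> real \<Rightarrow> real \<Rightarrow> real \<Rightarrow> real)
     \<Rightarrow> (real^3) \<times> real \<times> real \<times> real \<times> (real^3) \<Rightarrow> real" where
  "coll_integrand X \<alpha> \<beta> \<xi> I F = (\<lambda>(\<xi>s, Is, I', Is', \<omega>).
     F \<xi>s (post_vel X \<alpha> \<beta> \<xi> \<xi>s I Is I' Is' \<omega>) (post_vel_s X \<alpha> \<beta> \<xi> \<xi>s I Is I' Is' \<omega>) Is I' Is'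
     * trans_weight X \<alpha> \<beta> \<xi> \<xi>s I Is I' Is' \<omega>)"

definition coll_integrable ::
    "mixture \<Rightarrow> nat \<Rightarrow> nat \<Rightarrow> real^3 \<Rightarrow> real
     \<Rightarrow> (real^3 \<Rightarrow> real^3 \<Rightarrow> real^3 \<Rightarrow> real \<Rightarrow> real \<Rightarrow> real \<Rightarrow> real) \<Rightarrow> bool" where
  "coll_integrable X \<alpha> \<beta> \<xi> I F \<longleftrightarrow> integrable (coll_measure X \<alpha> \<beta>) (coll_integrand X \<alpha> \<beta> \<xi> I F)"

definition coll_integral ::
    "mixture \<Rightarrow> nat \<Rightarrow> nat \<Rightarrow> real^3 \<Rightarrow> real
     \<Rightarrow> (real^3 \<Rightarrow> real^3 \<Rightarrow> real^3 \<Rightarrow> real \<Rightarrow> real \<Rightarrow> real \<Rightarrow> real) \<Rightarrow> real" where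
  "coll_integral X \<alpha> \<beta> \<xi> I F = integral\<^sup>L (coll_measure X \<alpha> \<beta>) (coll_integrand X \<alpha> \<beta> \<xi> I F)"


subsection \<open>The linearized collision operator\<close>

type_synonym vfun = "nat \<Rightarrow> (real^3) \<times> real \<Rightarrow> real"

definition maxwellian :: "mixture \<Rightarrow> nat \<Rightarrow> real^3 \<Rightarrow> real \<Rightarrow> real" where
  "maxwellian X \<alpha> \<xi> I =
     (if monatomic X \<alpha>
      then dens X \<alpha> * mass X \<alpha> powr (3/2) / (2 * pi) powr (3/2)
           * exp (- mass X \<alpha> * (norm \<xi>)\<^sup>2 / 2)
      else dens X \<alpha> * I powr (dof X \<alpha> / 2 - 1) * mass X \<alpha> powr (3/2)
           / ((2 * pi) powr (3/2) * Gamma (dof X \<alpha> / 2))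
           * exp (- mass X \<alpha> * (norm \<xi>)\<^sup>2 / 2) * exp (- I))"

definition nu_fun ::
    "mixture \<Rightarrow> nat \<Rightarrow> nat \<Rightarrow> real
     \<Rightarrow> real^3 \<Rightarrow> real^3 \<Rightarrow> real^3 \<Rightarrow> real \<Rightarrow> real \<Rightarrow> real \<Rightarrow> real" where
  "nu_fun X \<alpha> \<beta> I = (\<lambda>\<xi>s \<xi>' \<xi>s' Is I' Is'.
     maxwellian X \<beta> \<xi>s Is / (I powr (dof X \<alpha> / 2 - 1) * Is powr (dof X \<beta> / 2 - 1)))"

definition K_fun ::
    "mixture \<Rightarrow> nat \<Rightarrow> nat \<Rightarrow> vfun \<Rightarrow> real
     \<Rightarrow> real^3 \<Rightarrow> real^3 \<Rightarrow> real^3 \<Rightarrow> real \<Rightarrow> real \<Rightarrow> real \<Rightarrow> real" where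
  "K_fun X \<alpha> \<beta> h I = (\<lambda>\<xi>s \<xi>' \<xi>s' Is I' Is'.
     (h \<alpha> (\<xi>', I') / sqrt (maxwellian X \<alpha> \<xi>' I')
      + h \<beta> (\<xi>s', Is') / sqrt (maxwellian X \<beta> \<xi>s' Is')
      - h \<beta> (\<xi>s, Is) / sqrt (maxwellian X \<beta> \<xi>s Is))
     * sqrt (maxwellian X \<beta> \<xi>s Is * maxwellian X \<alpha> \<xi>' I' * maxwellian X \<beta> \<xi>s' Is')
     / ((I * I') powr (dof X \<alpha> / 4 - 1/2) * (Is * Is') powr (dof X \<beta> / 4 - 1/2)))"

definition nu :: "mixture \<Rightarrow> vfun" where
  "nu X \<alpha> = (\<lambda>(\<xi>, I). \<Sum>\<beta>\<in>species X. coll_integral X \<alpha> \<beta> \<xi> I (nu_fun X \<alpha> \<beta> I))"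

definition op_K :: "mixture \<Rightarrow> vfun \<Rightarrow> vfun" where
  "op_K X h \<alpha> = (\<lambda>(\<xi>, I). \<Sum>\<beta>\<in>species X. coll_integral X \<alpha> \<beta> \<xi> I (K_fun X \<alpha> \<beta> h I))"

definition op_Lambda :: "mixture \<Rightarrow> vfun \<Rightarrow> vfun" where
  "op_Lambda X h = (\<lambda>\<alpha> z. nu X \<alpha> z * h \<alpha> z)"

definition op_L :: "mixture \<Rightarrow> vfun \<Rightarrow> vfun" where
  "op_L X h = (\<lambda>\<alpha> z. op_Lambda X h \<alpha> z - op_K X h \<alpha> z)"

text \<open>Bochner integrals of non-integrable functions are 0 by convention; this predicate says that
  none of the integrals that define \<open>op_L X h\<close> is of that kind, outside a null set.\<close>

definition op_L_converges :: "mixture \<Rightarrow> vfun \<Rightarrow> bool" where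
  "op_L_converges X h \<longleftrightarrow> (\<forall>\<alpha>\<in>species X. AE (\<xi>, I) in phase X \<alpha>. \<forall>\<beta>\<in>species X.
     coll_integrable X \<alpha> \<beta> \<xi> I (nu_fun X \<alpha> \<beta> I) \<and> coll_integrable X \<alpha> \<beta> \<xi> I (K_fun X \<alpha> \<beta> h I))"


subsection \<open>The Hilbert space and its operators\<close>

text \<open>
  The elements of the Hilbert space are represented by functions, and equality in the Hilbert space
  is \<open>h_eq\<close>, equality almost everywhere. Components with an index outside \<open>species X\<close> are irrelevant.
\<close>

definition h_space :: "mixture \<Rightarrow> vfun set" where
  "h_space X = {f. \<forall>\<alpha>\<in>species X. f \<alpha> \<in> borel_measurable (phase X \<alpha>) \<and>
     integrable (phase X \<alpha>) (\<lambda>z. (f \<alpha> z)\<^sup>2)}"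

definition h_eq :: "mixture \<Rightarrow> vfun \<Rightarrow> vfun \<Rightarrow> bool" where
  "h_eq X f g \<longleftrightarrow> (\<forall>\<alpha>\<in>species X. AE z in phase X \<alpha>. f \<alpha> z = g \<alpha> z)"

definition h_inner :: "mixture \<Rightarrow> vfun \<Rightarrow> vfun \<Rightarrow> real" where
  "h_inner X f g = (\<Sum>\<alpha>\<in>species X. LINT z|phase X \<alpha>. f \<alpha> z * g \<alpha> z)"

definition h_dist :: "mixture \<Rightarrow> vfun \<Rightarrow> vfun \<Rightarrow> real" where
  "h_dist X f g = sqrt (h_inner X (\<lambda>\<alpha> z. f \<alpha> z - g \<alpha> z) (\<lambda>\<alpha> z. f \<alpha> z - g \<alpha> z))"

text \<open>
  An operator is given by its domain \<open>D\<close> and a map \<open>T\<close> on functions. Compatibility with \<open>h_eq\<close>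
  makes it well defined on classes of almost everywhere equal functions.
\<close>

definition linear_operator :: "mixture \<Rightarrow> vfun set \<Rightarrow> (vfun \<Rightarrow> vfun) \<Rightarrow> bool" where
  "linear_operator X D T \<longleftrightarrow>
     D \<subseteq> h_space X \<and> T ` D \<subseteq> h_space X \<and>
     (\<forall>f\<in>D. \<forall>g\<in>h_space X. h_eq X f g \<longrightarrow> g \<in> D \<and> h_eq X (T f) (T g)) \<and>
     (\<lambda>\<alpha> z. 0) \<in> D \<and>
     (\<forall>f\<in>D. \<forall>g\<in>D. \<forall>a b. (\<lambda>\<alpha> z. a * f \<alpha> z + b * g \<alpha> z) \<in> D \<and>
        h_eq X (T (\<lambda>\<alpha> z. a * f \<alpha> z + b * g \<alpha> z)) (\<lambda>\<alpha> z. a * T f \<alpha> z + b * T g \<alpha> z))"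

definition densely_defined :: "mixture \<Rightarrow> vfun set \<Rightarrow> bool" where
  "densely_defined X D \<longleftrightarrow> (\<forall>f\<in>h_space X. \<forall>e>0. \<exists>h\<in>D. h_dist X h f < e)"

definition op_graph :: "mixture \<Rightarrow> vfun set \<Rightarrow> (vfun \<Rightarrow> vfun) \<Rightarrow> (vfun \<times> vfun) set" where
  "op_graph X D T = {(f, g). f \<in> D \<and> g \<in> h_space X \<and> h_eq X (T f) g}"

definition closed_operator :: "mixture \<Rightarrow> vfun set \<Rightarrow> (vfun \<Rightarrow> vfun) \<Rightarrow> bool" where
  "closed_operator X D T \<longleftrightarrow>
     (\<forall>u f g. (\<forall>n. u n \<in> D) \<and> f \<in> h_space X \<and> g \<in> h_space X \<and>
        (\<lambda>n::nat. h_dist X (u n) f) \<longlonglongrightarrow> 0 \<and> (\<lambda>n. h_dist X (T (u n)) g) \<longlonglongrightarrow> 0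
        \<longrightarrow> (f, g) \<in> op_graph X D T)"

text \<open>The graph of the adjoint; it is the graph of an operator if \<open>D\<close> is dense.\<close>

definition adjoint_graph :: "mixture \<Rightarrow> vfun set \<Rightarrow> (vfun \<Rightarrow> vfun) \<Rightarrow> (vfun \<times> vfun) set" where
  "adjoint_graph X D T = {(f, g). f \<in> h_space X \<and> g \<in> h_space X \<and>
     (\<forall>h\<in>D. h_inner X (T h) f = h_inner X h g)}"

definition self_adjoint_operator :: "mixture \<Rightarrow> vfun set \<Rightarrow> (vfun \<Rightarrow> vfun) \<Rightarrow> bool" where
  "self_adjoint_operator X D T \<longleftrightarrow> adjoint_graph X D T = op_graph X D T"

definition dom_L :: "mixture \<Rightarrow> vfun set" where
  "dom_L X = {h \<in> h_space X. op_Lambda X h \<in> h_space X}"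

end

theory Submission
  imports Defs
begin

text \<open>
  The linearized operator is the difference of multiplication by the collision frequency \<open>\<nu>\<close> and the operator
  \<open>K\<close>. Multiplication by a finite measurable function, on its maximal domain, is self-adjoint, and it remains so
  when a symmetric operator that is defined on the whole Hilbert space is subtracted; closedness follows
  because adjoints are closed (locale \<open>multiplication_perturbation\<close>). It therefore suffices that \<open>\<nu>\<close> is finite
  and that \<open>K\<close> maps the Hilbert space to itself and is symmetric.

  Symmetry comes from the symmetries of collisions. On quadruples \<open>(z, z\<^sub>*, z', z'\<^sub>*)\<close> of states, the measure
  \<open>W d\<xi> d\<xi>\<^sub>* d\<xi>' d\<xi>'\<^sub>* dI dI\<^sub>* dI' dI'\<^sub>*\<close> (\<open>collision_law\<close>) is invariant under the exchange of the states before and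
  after the collision (\<open>collision_law_reverse\<close>) and, up to a change of species, of the two particles
  (\<open>collision_law_swap\<close>). The first invariance is microreversibility, combined with polar coordinates for the
  relative velocity (\<open>nn_integral_polar\<close>) and with \<open>r dr = r' dr'\<close> for the relative speeds. The operator \<open>K\<close> is a sum
  of parts that evaluate \<open>h\<close> at \<open>z'\<close>, \<open>z'\<^sub>*\<close> or \<open>z\<^sub>*\<close>, each with a density that these exchanges preserve
  (\<open>K_integrand_split\<close>).

  Each part is bounded in \<open>L\<^sup>2\<close> by a Schur test on the space of collisions
  (\<open>schur_test\<close>), without computing its integral kernel; the test also yields the absolute
  convergence of the collision integrals. The same symmetries turn column bounds into row bounds. With the
  square root of the ratio of the Gibbs factors of the two states involved as Schur weight, the row integrand is
  a product of the square roots of the other two Gibbs factors, which is dominated, in one case through energy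
  conservation, by a Gaussian in \<open>\<xi>\<^sub>*\<close> times a Gaussian in \<open>\<xi>'\<close>
  or \<open>\<xi>'\<^sub>*\<close> (\<open>row_kernel_bound\<close>). The cross section contributes a
  factor \<open>(1 + 1 / |g|) (1 + |g'|)\<close> and densities of mass at most 1 for \<open>I'\<close> and
  \<open>I'\<^sub>*\<close> (\<open>scat_bound\<close>). The growth in \<open>|g'|\<close> is harmless
  because \<open>\<xi>'\<close> and \<open>\<xi>'\<^sub>*\<close> run over spheres of radius proportional
  to \<open>|g'|\<close>, on which the average of a Gaussian is \<open>O(|g'|\<^sup>-\<^sup>2)\<close>
  uniformly in its center (\<open>sphere_gaussian_bound\<close>); the singularity \<open>1 / |g|\<close> is
  integrable in \<open>\<xi>\<^sub>*\<close>. The finiteness of \<open>\<nu>\<close> follows from the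
  same estimate.
\<close>

section \<open>Polar coordinates\<close>

lemma ball_in_sets_borel [measurable]: "ball c r \<in> sets (borel :: 'a::metric_space measure)"
  by (rule borel_open) simp

lemma sets_sphere_measure [simp, measurable_cong]: "sets sphere_measure = sets borel"
  by (simp add: sphere_measure_def)

lemma space_sphere_measure [simp]: "space sphere_measure = UNIV"
  by (simp add: sphere_measure_def)

lemma nn_integral_sphere_measure:
  assumes [measurable]: "f \<in> borel_measurable borel"
  shows "(\<integral>\<^sup>+\<omega>. f \<omega> \<partial>sphere_measure) =
    (\<integral>\<^sup>+x. 3 * indicator (ball 0 1) x * f (x /\<^sub>R norm x) \<partial>lborel)"
proof -
  have "(\<integral>\<^sup>+\<omega>. f \<omega> \<partial>sphere_measure) =
    (\<integral>\<^sup>+x. f (x /\<^sub>R norm x) \<partial>density lborel (\<lambda>x. 3 * indicator (ball 0 1) x))"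
    unfolding sphere_measure_def by (rule nn_integral_distr) measurable
  also have "\<dots> = (\<integral>\<^sup>+x. 3 * indicator (ball 0 1) x * f (x /\<^sub>R norm x) \<partial>lborel)"
    by (rule nn_integral_density) measurable
  finally show ?thesis .
qed

lemma nn_integral_scaleR_vec3:
  fixes f :: "real^3 \<Rightarrow> ennreal"
  assumes [measurable]: "f \<in> borel_measurable borel" and s: "s > 0"
  shows "(\<integral>\<^sup>+x. f (s *\<^sub>R x) \<partial>lborel) = ennreal (1 / s^3) * (\<integral>\<^sup>+x. f x \<partial>lborel)"
proof -
  have "(\<integral>\<^sup>+x. f x \<partial>lborel) = ennreal (s^3) * (\<integral>\<^sup>+x. f (s *\<^sub>R x) \<partial>lborel)"
    using s by (subst lborel_affine[of s 0])
      (auto simp: nn_integral_density nn_integral_distr nn_integral_cmult)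
  then show ?thesis
    using s by (simp add: mult.assoc[symmetric] ennreal_mult[symmetric])
qed

lemma nn_integral_scale_real:
  fixes f :: "real \<Rightarrow> ennreal"
  assumes [measurable]: "f \<in> borel_measurable borel" and s: "s > 0"
  shows "(\<integral>\<^sup>+x. f x \<partial>lborel) = ennreal s * (\<integral>\<^sup>+x. f (s * x) \<partial>lborel)"
  using nn_integral_real_affine[of f s 0] s by simp

lemma nn_integral_translate:
  fixes f :: "'a::euclidean_space \<Rightarrow> ennreal"
  assumes [measurable]: "f \<in> borel_measurable borel"
  shows "(\<integral>\<^sup>+x. f (t + x) \<partial>lborel) = (\<integral>\<^sup>+x. f x \<partial>lborel)"
  by (subst (2) lborel_distr_plus[of t, symmetric]) (simp add: nn_integral_distr)

lemma nn_integral_lborel_uminus: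
  fixes f :: "'a::euclidean_space \<Rightarrow> ennreal"
  assumes [measurable]: "f \<in> borel_measurable borel"
  shows "(\<integral>\<^sup>+x. f (- x) \<partial>lborel) = (\<integral>\<^sup>+x. f x \<partial>lborel)"
proof -
  have "density (distr lborel borel uminus) (\<lambda>_. 1) = (lborel :: 'a measure)"
    by (subst (2) lborel_affine[of "-1" 0]) simp_all
  then have "distr lborel borel uminus = (lborel :: 'a measure)"
    unfolding density_1 .
  then have "(\<integral>\<^sup>+x. f x \<partial>lborel) = (\<integral>\<^sup>+x. f x \<partial>distr lborel borel uminus)"
    by (rule arg_cong[where f="\<lambda>M. nn_integral M f", symmetric])
  then show ?thesis by (simp add: nn_integral_distr)
qed

lemma AE_lborel_neq: "AE x in lborel. x \<noteq> (c::'a::euclidean_space)"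
  using AE_lborel_singleton[of c] by simp

lemma nn_integral_inverse_fourth_power:
  assumes "t > (0::real)"
  shows "(\<integral>\<^sup>+s. ennreal (3 / s^4) * indicator {t<..} s \<partial>lborel) = ennreal (1 / t^3)"
proof -
  have "(\<integral>\<^sup>+s. ennreal (3 / s^4) * indicator {t<..} s \<partial>lborel)
      = (\<integral>\<^sup>+s. ennreal (3 / s^4) * indicator {t..} s \<partial>lborel)"
    by (intro nn_integral_cong_AE, use AE_lborel_neq[of t] in eventually_elim)
      (auto split: split_indicator)
  also have "\<dots> = ennreal (0 - (- (1 / t^3)))"
  proof (rule nn_integral_FTC_atLeast)
    show "(\<lambda>s. 3 / s^4 :: real) \<in> borel_measurable borel" by measurable
    show "DERIV (\<lambda>s::real. - (1 / s^3)) x :> 3 / x^4" if "t \<le> x" for x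
      using that assms by (auto intro!: derivative_eq_intros simp: field_simps eval_nat_numeral)
    show "((\<lambda>s::real. - (1 / s^3)) \<longlongrightarrow> 0) at_top"
    proof -
      have "filterlim (\<lambda>s::real. s^3) at_top at_top"
        by (rule filterlim_pow_at_top) (auto simp: filterlim_ident)
      from tendsto_minus[OF tendsto_divide_0[OF tendsto_const[of 1] filterlim_at_top_imp_at_infinity[OF this]]]
      show ?thesis by simp
    qed
  qed (use assms in auto)
  finally show ?thesis by simp
qed

text \<open>
  Polar coordinates for the sphere measure defined as a cone measure. Unfolding that definition on the
  right gives an integral over \<open>r > 0\<close> and \<open>x\<close> in the unit ball. Substituting \<open>r = s |x|\<close> removes the
  normalization \<open>x / |x|\<close>, substituting \<open>y = s x\<close> leaves a weight \<open>3 |y|\<^sup>3 s\<^sup>-\<^sup>4\<close> on \<open>s > |y|\<close>, whose integral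
  over \<open>s\<close> is 1. Only Tonelli and scaling are used, no rotation invariance.
\<close>

lemma nn_integral_polar:
  fixes f :: "real^3 \<Rightarrow> ennreal"
  assumes [measurable]: "f \<in> borel_measurable borel"
  shows "(\<integral>\<^sup>+x. f x \<partial>lborel) =
    (\<integral>\<^sup>+r. indicator {0<..} r * ennreal (r\<^sup>2) * (\<integral>\<^sup>+\<omega>. f (r *\<^sub>R \<omega>) \<partial>sphere_measure) \<partial>lborel)"
proof -
  let ?i = "\<lambda>r. indicator {0<..} (r :: real) :: ennreal" and ?b = "\<lambda>x. 3 * indicator (ball 0 1) (x :: real^3) :: ennreal"
  define A where "A r x = ?i r * ennreal (r\<^sup>2) * (?b x * f (r *\<^sub>R (x /\<^sub>R norm x)))" for r x
  define B where "B s x = ?i s * ennreal (s\<^sup>2) * (?b x * ennreal (norm x ^ 3) * f (s *\<^sub>R x))" for s x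
  define D where "D s y = ennreal (3 / s^4) * indicator {norm y<..} s * (ennreal (norm y ^ 3) * f y)" for s y
  have Am: "case_prod A \<in> borel_measurable (lborel \<Otimes>\<^sub>M lborel)" and Bm: "case_prod B \<in> borel_measurable (lborel \<Otimes>\<^sub>M lborel)"
    unfolding A_def B_def by measurable
  have Dm: "(\<lambda>(y, s). D s y) \<in> borel_measurable (lborel \<Otimes>\<^sub>M lborel)"
  proof -
    have [measurable]: "Measurable.pred (lborel \<Otimes>\<^sub>M lborel) (\<lambda>x. norm (fst x :: real^3) < (snd x :: real))"
      by measurable
    have eq: "indicator {norm (y::real^3)<..} s = (if norm y < s then 1 else 0 :: ennreal)" for y and s :: real
      by (auto split: split_indicator)
    show ?thesis unfolding D_def eq case_prod_beta by measurable
  qed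
  have "(\<integral>\<^sup>+r. indicator {0<..} r * ennreal (r\<^sup>2) * (\<integral>\<^sup>+\<omega>. f (r *\<^sub>R \<omega>) \<partial>sphere_measure) \<partial>lborel)
    = (\<integral>\<^sup>+r. (\<integral>\<^sup>+x. A r x \<partial>lborel) \<partial>lborel)"
    unfolding A_def by (subst nn_integral_sphere_measure, measurable) (subst nn_integral_cmult, measurable)
  also have "\<dots> = (\<integral>\<^sup>+x. (\<integral>\<^sup>+r. A r x \<partial>lborel) \<partial>lborel)"
    by (rule lborel_pair.Fubini'[OF Am, symmetric])
  also have "\<dots> = (\<integral>\<^sup>+x. (\<integral>\<^sup>+s. B s x \<partial>lborel) \<partial>lborel)"
  proof (intro nn_integral_cong_AE, use AE_lborel_neq[of "0::real^3"] in eventually_elim)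
    fix x :: "real^3" assume x: "x \<noteq> 0"
    have [measurable]: "(\<lambda>r. A r x) \<in> borel_measurable borel" unfolding A_def by measurable
    have "(\<integral>\<^sup>+r. A r x \<partial>lborel) = ennreal (norm x) * (\<integral>\<^sup>+s. A (norm x * s) x \<partial>lborel)"
      using x by (intro nn_integral_scale_real) auto
    also have "\<dots> = (\<integral>\<^sup>+s. ennreal (norm x) * A (norm x * s) x \<partial>lborel)"
      by (rule nn_integral_cmult[symmetric]) measurable
    also have "\<dots> = (\<integral>\<^sup>+s. B s x \<partial>lborel)"
    proof (rule nn_integral_cong)
      fix s :: real
      have "norm x * (norm x * s)\<^sup>2 = s\<^sup>2 * norm x ^ 3"
        by (simp add: power2_eq_square power3_eq_cube)
      then have 1: "ennreal (norm x) * ennreal ((norm x * s)\<^sup>2) = ennreal (s\<^sup>2) * ennreal (norm x ^ 3)"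
        using ennreal_mult[of "norm x" "(norm x * s)\<^sup>2"] ennreal_mult[of "s\<^sup>2" "norm x ^ 3"] by simp
      have 2: "(norm x * s) *\<^sub>R (x /\<^sub>R norm x) = s *\<^sub>R x" using x by simp
      have 3: "?i (norm x * s) = ?i s"
        using x by (auto simp: zero_less_mult_iff split: split_indicator)
      have "ennreal (norm x) * A (norm x * s) x = (ennreal (norm x) * ennreal ((norm x * s)\<^sup>2)) * (?i s * (?b x * f (s *\<^sub>R x)))"
        unfolding A_def 2 3 by (simp only: mult_ac)
      also have "\<dots> = B s x"
        unfolding B_def 1 by (simp only: mult_ac)
      finally show "ennreal (norm x) * A (norm x * s) x = B s x" .
    qed
    finally show "(\<integral>\<^sup>+r. A r x \<partial>lborel) = (\<integral>\<^sup>+s. B s x \<partial>lborel)" .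
  qed
  also have "\<dots> = (\<integral>\<^sup>+s. (\<integral>\<^sup>+x. B s x \<partial>lborel) \<partial>lborel)"
    by (rule lborel_pair.Fubini'[OF Bm])
  also have "\<dots> = (\<integral>\<^sup>+s. (\<integral>\<^sup>+y. D s y \<partial>lborel) \<partial>lborel)"
  proof (rule nn_integral_cong)
    fix s :: real
    show "(\<integral>\<^sup>+x. B s x \<partial>lborel) = (\<integral>\<^sup>+y. D s y \<partial>lborel)"
    proof (cases "s > 0")
      case False
      then have "?i s = 0" and "\<And>y::real^3. indicator {norm y<..} s = (0::ennreal)"
        by (auto split: split_indicator) (metis norm_ge_zero order_le_less_trans)
      then show ?thesis by (simp add: B_def D_def)
    next
      case s: True
      define h where "h y = ennreal (s\<^sup>2) * (3 * indicator (ball 0 s) (y::real^3) * ennreal ((norm y / s) ^ 3) * f y)" for y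
      have [measurable]: "h \<in> borel_measurable borel" unfolding h_def by measurable
      have "(\<integral>\<^sup>+x. B s x \<partial>lborel) = (\<integral>\<^sup>+x. h (s *\<^sub>R x) \<partial>lborel)"
        using s by (intro nn_integral_cong) (auto simp: B_def h_def split: split_indicator)
      also have "\<dots> = (\<integral>\<^sup>+x. ennreal (1 / s^3) * h x \<partial>lborel)"
        using s by (subst nn_integral_scaleR_vec3) (auto simp: nn_integral_cmult)
      also have "\<dots> = (\<integral>\<^sup>+y. D s y \<partial>lborel)"
      proof (rule nn_integral_cong)
        fix y :: "real^3"
        have prod3: "ennreal a * (ennreal b * (3 * ennreal d)) = ennreal (a * (b * (3 * d)))"
          if "0 \<le> a" "0 \<le> b" "0 \<le> d" for a b d :: real
          using that by (simp add: ennreal_mult)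
        have "1 / s^3 * (s\<^sup>2 * (3 * (norm y / s)^3)) = 3 / s^4 * norm y ^ 3"
          using s by (simp add: field_simps eval_nat_numeral)
        moreover have "ennreal (1 / s^3) * (ennreal (s\<^sup>2) * (3 * ennreal ((norm y / s) ^ 3)))
            = ennreal (1 / s^3 * (s\<^sup>2 * (3 * (norm y / s)^3)))"
          using s by (intro prod3) auto
        ultimately have "ennreal (1 / s^3) * (ennreal (s\<^sup>2) * (3 * ennreal ((norm y / s) ^ 3))) = ennreal (3 / s^4) * ennreal (norm y ^ 3)"
          using s by (simp only: ennreal_mult[symmetric] zero_le_divide_iff zero_le_power norm_ge_zero)
            (simp add: ennreal_mult[symmetric])
        then have "ennreal (1 / s^3) * (ennreal (s\<^sup>2) * (3 * ennreal ((norm y / s) ^ 3))) * f y = ennreal (3 / s^4) * ennreal (norm y ^ 3) * f y"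
          by simp
        then show "ennreal (1 / s^3) * h y = D s y"
          by (auto simp: h_def D_def mult_ac split: split_indicator)
      qed
      finally show ?thesis .
    qed
  qed
  also have "\<dots> = (\<integral>\<^sup>+y. (\<integral>\<^sup>+s. D s y \<partial>lborel) \<partial>lborel)"
    by (rule lborel_pair.Fubini'[OF Dm])
  also have "\<dots> = (\<integral>\<^sup>+y. f y \<partial>lborel)"
  proof (intro nn_integral_cong_AE, use AE_lborel_neq[of "0::real^3"] in eventually_elim)
    fix y :: "real^3" assume y: "y \<noteq> 0"
    have "(\<integral>\<^sup>+s. D s y \<partial>lborel) = ennreal (1 / norm y ^ 3) * (ennreal (norm y ^ 3) * f y)"
      unfolding D_def using y by (simp add: nn_integral_multc nn_integral_inverse_fourth_power)
    also have "\<dots> = f y"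
      using y by (simp add: mult.assoc[symmetric] ennreal_mult[symmetric])
    finally show "(\<integral>\<^sup>+s. D s y \<partial>lborel) = f y" .
  qed
  finally show ?thesis by simp
qed

lemma finite_measure_sphere: "finite_measure sphere_measure"
proof
  have "emeasure sphere_measure UNIV = (\<integral>\<^sup>+\<omega>. 1 \<partial>sphere_measure)" by simp
  also have "\<dots> = (\<integral>\<^sup>+x. 3 * indicator (ball 0 1) (x::real^3) \<partial>lborel)"
    by (subst nn_integral_sphere_measure) auto
  also have "\<dots> = 3 * emeasure lborel (ball 0 1 :: (real^3) set)"
    by (subst nn_integral_cmult) simp_all
  also have "\<dots> \<noteq> \<infinity>"
    using emeasure_lborel_ball_finite[of "0::real^3" 1] by (simp add: ennreal_mult_eq_top_iff)
  finally show "emeasure sphere_measure (space sphere_measure) \<noteq> \<infinity>" by simp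
qed

lemma AE_sphere_norm: "AE \<omega> in sphere_measure. norm \<omega> = 1"
proof -
  have "AE x in lborel. (0::ennreal) < 3 * indicator (ball 0 1) x \<longrightarrow> norm (x /\<^sub>R norm (x::real^3)) = 1"
    using AE_lborel_neq[of "0::real^3"] by eventually_elim auto
  then have "AE x in density lborel (\<lambda>x. 3 * indicator (ball 0 1) x). norm (x /\<^sub>R norm (x::real^3)) = 1"
    by (subst AE_density) measurable
  moreover have "{\<omega>::real^3. norm \<omega> = 1} \<in> sets borel" by measurable
  ultimately show ?thesis
    unfolding sphere_measure_def by (subst AE_distr_iff) simp_all
qed

lemma nn_integral_sphere_uminus:
  assumes [measurable]: "f \<in> borel_measurable borel"
  shows "(\<integral>\<^sup>+\<omega>. f (- \<omega>) \<partial>sphere_measure) = (\<integral>\<^sup>+\<omega>. f \<omega> \<partial>sphere_measure)"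
proof -
  have "(\<integral>\<^sup>+\<omega>. f (- \<omega>) \<partial>sphere_measure) =
     (\<integral>\<^sup>+x. 3 * indicator (ball 0 1) (- x) * f ((- x) /\<^sub>R norm (- x)) \<partial>lborel)"
    by (subst nn_integral_sphere_measure) (auto intro!: nn_integral_cong split: split_indicator)
  also have "\<dots> = (\<integral>\<^sup>+\<omega>. f \<omega> \<partial>sphere_measure)"
    unfolding nn_integral_sphere_measure[OF assms]
    by (rule nn_integral_lborel_uminus) measurable
  finally show ?thesis .
qed

section \<open>Substitutions and Gaussian integrals\<close>

text \<open>
  The substitution \<open>u = r\<^sup>2\<close> on the half-line, obtained from compact intervals by exhaustion.
\<close>

lemma nn_integral_square_substitution:
  fixes f :: "real \<Rightarrow> ennreal"
  assumes [measurable]: "f \<in> borel_measurable borel"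
  shows "(\<integral>\<^sup>+u. f u * indicator {0<..} u \<partial>lborel)
    = (\<integral>\<^sup>+r. f (r\<^sup>2) * ennreal (2 * r) * indicator {0<..} r \<partial>lborel)"
proof -
  have shrink: "(\<integral>\<^sup>+x. g x * indicator {0<..} x \<partial>lborel) = (\<integral>\<^sup>+x. g x * indicator {0..} x \<partial>lborel)"
    for g :: "real \<Rightarrow> ennreal"
    by (intro nn_integral_cong_AE, use AE_lborel_neq[of "0::real"] in eventually_elim)
      (auto split: split_indicator)
  have exhaust: "(\<integral>\<^sup>+x. g x * indicator {0..} x \<partial>lborel) = (SUP n. \<integral>\<^sup>+x. g x * indicator {0..b n} x \<partial>lborel)"
    if [measurable]: "g \<in> borel_measurable borel" and b: "incseq b" "\<And>x. \<exists>n. x \<le> b n"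
    for g :: "real \<Rightarrow> ennreal" and b :: "nat \<Rightarrow> real"
  proof -
    have "(SUP n. emeasure (density lborel g) {0..b n}) = emeasure (density lborel g) (\<Union>n. {0..b n})"
      using b(1) by (intro SUP_emeasure_incseq) (auto simp: incseq_def)
    also have "(\<Union>n. {0..b n}) = {0..}" using b(2) by auto
    finally show ?thesis by (simp add: emeasure_density)
  qed
  have bnd: "\<exists>n. x \<le> (real n + 1)\<^sup>2" for x
  proof -
    obtain n where "x \<le> real n" using real_arch_simple by blast
    moreover have "real n \<le> (real n + 1)\<^sup>2" by (simp add: power2_eq_square algebra_simps)
    ultimately show ?thesis by (intro exI[of _ n]) linarith
  qed
  have "(\<integral>\<^sup>+u. f u * indicator {0<..} u \<partial>lborel) = (SUP n. \<integral>\<^sup>+x. f x * indicator {0..(real n + 1)\<^sup>2} x \<partial>lborel)"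
    unfolding shrink by (rule exhaust) (auto simp: incseq_def bnd)
  also have "\<dots> = (SUP n. \<integral>\<^sup>+x. f (x\<^sup>2) * ennreal (2 * x) * indicator {0..real n + 1} x \<partial>lborel)"
  proof (rule arg_cong[where f=Sup], rule image_cong[OF refl])
    fix n :: nat
    show "(\<integral>\<^sup>+x. f x * indicator {0..(real n + 1)\<^sup>2} x \<partial>lborel)
      = (\<integral>\<^sup>+x. f (x\<^sup>2) * ennreal (2 * x) * indicator {0..real n + 1} x \<partial>lborel)"
    proof -
      have "(\<integral>\<^sup>+x. f x * indicator {0\<^sup>2..(real n + 1)\<^sup>2} x \<partial>lborel)
        = (\<integral>\<^sup>+x. f (x\<^sup>2) * ennreal (2 * x) * indicator {0..real n + 1} x \<partial>lborel)"
        by (rule nn_integral_substitution_aux)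
          (auto intro!: derivative_eq_intros continuous_intros)
      then show ?thesis by simp
    qed
  qed
  also have "\<dots> = (\<integral>\<^sup>+r. f (r\<^sup>2) * ennreal (2 * r) * indicator {0..} r \<partial>lborel)"
  proof (rule exhaust[symmetric])
    fix x :: real
    obtain n where "x \<le> real n" using real_arch_simple by blast
    then show "\<exists>n. x \<le> real n + 1" by (intro exI[of _ n]) simp
  qed (auto simp: incseq_def)
  finally show ?thesis unfolding shrink .
qed

text \<open>
  Along the curve \<open>r\<^sup>2 - d = s\<^sup>2\<close> one has \<open>r dr = s ds\<close>. With \<open>d = 2 \<Delta>I / \<mu>\<close> this relates the relative speeds
  before and after a collision; both sides equal the same integral over the squared speed, up to a shift by \<open>d\<close>.
\<close>

lemma nn_integral_relative_speed:
  fixes \<Phi> :: "real \<Rightarrow> real \<Rightarrow> ennreal"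
  assumes [measurable]: "case_prod \<Phi> \<in> borel_measurable (borel \<Otimes>\<^sub>M borel)"
  shows "(\<integral>\<^sup>+r. (if 0 < r \<and> d < r\<^sup>2 then ennreal (2 * r) * \<Phi> r (sqrt (r\<^sup>2 - d)) else 0) \<partial>lborel)
    = (\<integral>\<^sup>+s. (if 0 < s \<and> - d < s\<^sup>2 then ennreal (2 * s) * \<Phi> (sqrt (s\<^sup>2 + d)) s else 0) \<partial>lborel)"
proof -
  define \<phi> where "\<phi> u = (if d < u then \<Phi> (sqrt u) (sqrt (u - d)) else 0)" for u
  define \<psi> where "\<psi> v = (if - d < v then \<Phi> (sqrt (v + d)) (sqrt v) else 0)" for v
  have [measurable]: "\<phi> \<in> borel_measurable borel" "\<psi> \<in> borel_measurable borel"
    unfolding \<phi>_def \<psi>_def by measurable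
  have "(\<integral>\<^sup>+r. (if 0 < r \<and> d < r\<^sup>2 then ennreal (2 * r) * \<Phi> r (sqrt (r\<^sup>2 - d)) else 0) \<partial>lborel)
     = (\<integral>\<^sup>+r. \<phi> (r\<^sup>2) * ennreal (2 * r) * indicator {0<..} r \<partial>lborel)"
    by (intro nn_integral_cong) (auto simp: \<phi>_def mult_ac)
  also have "\<dots> = (\<integral>\<^sup>+u. \<phi> u * indicator {0<..} u \<partial>lborel)"
    by (rule nn_integral_square_substitution[symmetric]) measurable
  also have "\<dots> = (\<integral>\<^sup>+u. \<phi> (d + u) * indicator {0<..} (d + u) \<partial>lborel)"
    by (rule nn_integral_translate[symmetric]) measurable
  also have "\<dots> = (\<integral>\<^sup>+v. \<psi> v * indicator {0<..} v \<partial>lborel)"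
    by (intro nn_integral_cong) (auto simp: \<phi>_def \<psi>_def add_ac split: split_indicator)
  also have "\<dots> = (\<integral>\<^sup>+r. \<psi> (r\<^sup>2) * ennreal (2 * r) * indicator {0<..} r \<partial>lborel)"
    by (rule nn_integral_square_substitution) measurable
  also have "\<dots> = (\<integral>\<^sup>+s. (if 0 < s \<and> - d < s\<^sup>2 then ennreal (2 * s) * \<Phi> (sqrt (s\<^sup>2 + d)) s else 0) \<partial>lborel)"
    by (intro nn_integral_cong) (auto simp: \<psi>_def mult_ac)
  finally show ?thesis .
qed

lemma nn_integral_exp_half_line:
  assumes "a > 0"
  shows "(\<integral>\<^sup>+x. ennreal (exp (- a * x)) * indicator {0<..} x \<partial>lborel) = ennreal (1 / a)"
proof -
  have "(\<integral>\<^sup>+x. ennreal (exp (- a * x)) * indicator {0<..} x \<partial>lborel)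
      = (\<integral>\<^sup>+x. ennreal (exp (- a * x)) * indicator {0..} x \<partial>lborel)"
    by (intro nn_integral_cong_AE, use AE_lborel_neq[of "0::real"] in eventually_elim)
      (auto split: split_indicator)
  also have "\<dots> = ennreal (0 - (- exp (- a * 0) / a))"
  proof (rule nn_integral_FTC_atLeast)
    show "DERIV (\<lambda>x. - exp (- a * x) / a) x :> exp (- a * x)" for x
      using assms by (auto intro!: derivative_eq_intros)
    have "filterlim (\<lambda>x. a * x) at_top at_top"
      using assms by (intro filterlim_tendsto_pos_mult_at_top[OF tendsto_const]) (auto simp: filterlim_ident)
    then have "((\<lambda>x. exp (- (a * x))) \<longlongrightarrow> 0) at_top"
      by (intro filterlim_compose[OF exp_at_bot]) (simp add: filterlim_uminus_at_top[symmetric])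
    from tendsto_minus[OF tendsto_divide[OF this tendsto_const[of a]]]
    show "((\<lambda>x. - exp (- a * x) / a) \<longlongrightarrow> 0) at_top" using assms by simp
  qed auto
  finally show ?thesis by simp
qed

lemma gaussian_finite:
  assumes a: "a > 0"
  shows "(\<integral>\<^sup>+x. ennreal (exp (- a * (norm (x::real^3))\<^sup>2)) \<partial>lborel) < \<infinity>"
proof -
  define S where "S = emeasure sphere_measure UNIV"
  have S: "S < \<infinity>"
    using finite_measure.emeasure_finite[OF finite_measure_sphere, of UNIV] by (auto simp: S_def top.not_eq_extremum)
  define m where "m = min 1 (a / 2)"
  have m: "0 < m" "m \<le> 1" "m \<le> a / 2" using a by (auto simp: m_def)
  have bnd: "r * exp (- a * r\<^sup>2) \<le> exp (- (a/2) * r\<^sup>2) / m" if "r > 0" for r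
  proof -
    have "m * r \<le> m * (1 + r\<^sup>2)"
      using m sum_squares_ge_zero[of "r - 1/2" 0] by (intro mult_left_mono) (auto simp: power2_eq_square algebra_simps)
    also have "\<dots> \<le> 1 + a / 2 * r\<^sup>2"
      using m mult_right_mono[OF m(3), of "r\<^sup>2"] by (simp add: algebra_simps)
    also have "\<dots> \<le> exp (a / 2 * r\<^sup>2)" by (rule exp_ge_add_one_self)
    finally have "r \<le> exp (a / 2 * r\<^sup>2) / m" using m by (simp add: field_simps)
    then have "r * exp (- a * r\<^sup>2) \<le> exp (a / 2 * r\<^sup>2) / m * exp (- a * r\<^sup>2)"
      by (rule mult_right_mono) simp
    also have "\<dots> = exp (- (a/2) * r\<^sup>2) / m"
      by (simp add: exp_add[symmetric] field_simps)
    finally show ?thesis .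
  qed
  have "(\<integral>\<^sup>+x. ennreal (exp (- a * (norm (x::real^3))\<^sup>2)) \<partial>lborel)
     = (\<integral>\<^sup>+r. indicator {0<..} r * ennreal (r\<^sup>2) * (\<integral>\<^sup>+\<omega>. ennreal (exp (- a * r\<^sup>2)) \<partial>sphere_measure) \<partial>lborel)"
  proof -
    have "(\<integral>\<^sup>+\<omega>. ennreal (exp (- a * (norm (r *\<^sub>R \<omega>))\<^sup>2)) \<partial>sphere_measure)
       = (\<integral>\<^sup>+\<omega>. ennreal (exp (- a * r\<^sup>2)) \<partial>sphere_measure)" for r
      by (rule nn_integral_cong_AE, use AE_sphere_norm in eventually_elim) (auto simp: power_mult_distrib)
    then show ?thesis by (subst nn_integral_polar) simp_all
  qed
  also have "\<dots> \<le> (\<integral>\<^sup>+r. ennreal (exp (- (a/2) * r\<^sup>2)) * ennreal (2 * r) * indicator {0<..} r * (ennreal (1 / m) * S) \<partial>lborel)"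
  proof (rule nn_integral_mono)
    fix r :: real
    show "indicator {0<..} r * ennreal (r\<^sup>2) * (\<integral>\<^sup>+\<omega>. ennreal (exp (- a * r\<^sup>2)) \<partial>sphere_measure)
      \<le> ennreal (exp (- (a/2) * r\<^sup>2)) * ennreal (2 * r) * indicator {0<..} r * (ennreal (1 / m) * S)"
    proof (cases "r > 0")
      case True
      have "r\<^sup>2 * exp (- a * r\<^sup>2) \<le> exp (- (a/2) * r\<^sup>2) * (2 * r) * (1 / m)"
      proof -
        have "r\<^sup>2 * exp (- a * r\<^sup>2) = r * (r * exp (- a * r\<^sup>2))" by (simp add: power2_eq_square)
        also have "\<dots> \<le> r * (exp (- (a/2) * r\<^sup>2) / m)" using True bnd[OF True] by (intro mult_left_mono) auto
        also have "\<dots> \<le> (2 * r) * (exp (- (a/2) * r\<^sup>2) / m)" using True m by (intro mult_right_mono) auto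
        finally show ?thesis by (simp add: mult_ac)
      qed
      then have "ennreal (r\<^sup>2) * ennreal (exp (- a * r\<^sup>2)) \<le> ennreal (exp (- (a/2) * r\<^sup>2)) * ennreal (2 * r) * ennreal (1 / m)"
        using True m by (simp add: ennreal_mult[symmetric] ennreal_leI del: ennreal_numeral)
      then have "ennreal (r\<^sup>2) * ennreal (exp (- a * r\<^sup>2)) * S \<le> ennreal (exp (- (a/2) * r\<^sup>2)) * ennreal (2 * r) * ennreal (1 / m) * S"
        by (rule mult_right_mono) simp
      then show ?thesis using True by (simp add: S_def mult.assoc)
    qed simp
  qed
  also have "\<dots> = (\<integral>\<^sup>+r. ennreal (exp (- (a/2) * r\<^sup>2)) * ennreal (2 * r) * indicator {0<..} r \<partial>lborel) * (ennreal (1 / m) * S)"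
    by (rule nn_integral_multc) measurable
  also have "(\<integral>\<^sup>+r. ennreal (exp (- (a/2) * r\<^sup>2)) * ennreal (2 * r) * indicator {0<..} r \<partial>lborel)
    = (\<integral>\<^sup>+u. ennreal (exp (- (a/2) * u)) * indicator {0<..} u \<partial>lborel)"
    by (rule nn_integral_square_substitution[symmetric]) measurable
  also have "\<dots> = ennreal (1 / (a/2))" using a by (intro nn_integral_exp_half_line) simp
  also have "\<dots> * (ennreal (1 / m) * S) < \<infinity>" using S by (simp add: ennreal_mult_less_top)
  finally show ?thesis .
qed

text \<open>
  Within distance 1 of \<open>y\<close> the Gaussian is at most 1 and \<open>1 / |y - x|\<close> is integrable in three dimensions,
  with an integral that does not depend on \<open>y\<close>; further away the second factor is at most 2.
\<close>

lemma gaussian_coulomb_bound: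
  assumes a: "a > 0"
  shows "\<exists>D::real. \<forall>y::real^3. (\<integral>\<^sup>+x. ennreal (exp (- a * (norm x)\<^sup>2)) * ennreal (1 + 1 / norm (y - x)) \<partial>lborel) \<le> ennreal D"
proof -
  define S where "S = emeasure sphere_measure UNIV"
  have S: "S < \<infinity>"
    using finite_measure.emeasure_finite[OF finite_measure_sphere, of UNIV] by (auto simp: S_def top.not_eq_extremum)
  define G where "G = (\<integral>\<^sup>+x. ennreal (exp (- a * (norm (x::real^3))\<^sup>2)) \<partial>lborel)"
  have G: "G < \<infinity>" unfolding G_def by (rule gaussian_finite[OF a])
  define c :: "real^3 \<Rightarrow> ennreal" where "c x = indicator (ball 0 1) x * ennreal (1 / norm x)" for x
  have [measurable]: "c \<in> borel_measurable borel" unfolding c_def by measurable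
  have "(\<integral>\<^sup>+x. c x \<partial>lborel) = (\<integral>\<^sup>+r. indicator {0<..} r * ennreal (r\<^sup>2) * (\<integral>\<^sup>+\<omega>. c (r *\<^sub>R \<omega>) \<partial>sphere_measure) \<partial>lborel)"
    by (rule nn_integral_polar) measurable
  also have "\<dots> \<le> (\<integral>\<^sup>+r. indicator {0..1} (r::real) * S \<partial>lborel)"
  proof (rule nn_integral_mono)
    fix r :: real
    show "indicator {0<..} r * ennreal (r\<^sup>2) * (\<integral>\<^sup>+\<omega>. c (r *\<^sub>R \<omega>) \<partial>sphere_measure) \<le> indicator {0..1} r * S"
    proof (cases "0 < r \<and> r < 1")
      case True
      have "ennreal (r\<^sup>2) * (\<integral>\<^sup>+\<omega>. c (r *\<^sub>R \<omega>) \<partial>sphere_measure) = ennreal (r\<^sup>2) * (\<integral>\<^sup>+\<omega>. ennreal (1 / r) \<partial>sphere_measure)"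
        by (intro arg_cong2[where f="(*)"] refl nn_integral_cong_AE, use AE_sphere_norm in eventually_elim)
          (use True in \<open>auto simp: c_def\<close>)
      also have "\<dots> = ennreal (r\<^sup>2 * (1 / r)) * S"
        using True by (subst ennreal_mult) (auto simp: S_def mult.assoc)
      also have "\<dots> \<le> ennreal 1 * S"
        using True by (intro mult_right_mono ennreal_leI) (auto simp: power2_eq_square)
      finally show ?thesis using True by simp
    next
      case False
      have "(\<integral>\<^sup>+\<omega>. c (r *\<^sub>R \<omega>) \<partial>sphere_measure) = (\<integral>\<^sup>+\<omega>. 0 \<partial>sphere_measure)" if "r \<ge> 1"
        by (rule nn_integral_cong_AE, use AE_sphere_norm in eventually_elim) (use that in \<open>auto simp: c_def\<close>)
      then show ?thesis using False by (auto split: split_indicator)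
    qed
  qed
  also have "\<dots> = S" by (simp add: nn_integral_multc)
  finally have c: "(\<integral>\<^sup>+x. c x \<partial>lborel) \<le> S" .
  have "(\<integral>\<^sup>+x. ennreal (exp (- a * (norm x)\<^sup>2)) * ennreal (1 + 1 / norm (y - x)) \<partial>lborel) \<le> 2 * G + S" for y :: "real^3"
  proof -
    have "(\<integral>\<^sup>+x. ennreal (exp (- a * (norm x)\<^sup>2)) * ennreal (1 + 1 / norm (y - x)) \<partial>lborel)
      \<le> (\<integral>\<^sup>+x. 2 * ennreal (exp (- a * (norm x)\<^sup>2)) + c (- y + x) \<partial>lborel)"
    proof (rule nn_integral_mono)
      fix x :: "real^3"
      show "ennreal (exp (- a * (norm x)\<^sup>2)) * ennreal (1 + 1 / norm (y - x)) \<le> 2 * ennreal (exp (- a * (norm x)\<^sup>2)) + c (- y + x)"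
      proof (cases "norm (y - x) < 1")
        case True
        have e: "exp (- a * (norm x)\<^sup>2) \<le> 1" using a by simp
        have n: "norm (- y + x) = norm (y - x)" by (simp add: norm_minus_commute)
        have "exp (- a * (norm x)\<^sup>2) * (1 + 1 / norm (y - x)) \<le> 2 * exp (- a * (norm x)\<^sup>2) + 1 / norm (y - x)"
        proof -
          have "exp (- a * (norm x)\<^sup>2) * (1 / norm (y - x)) \<le> 1 * (1 / norm (y - x))"
            by (rule mult_right_mono[OF e]) simp
          moreover have "0 \<le> exp (- a * (norm x)\<^sup>2)" by simp
          ultimately show ?thesis by (simp only: distrib_left mult_1 mult_1_right)
        qed
        then have "ennreal (exp (- a * (norm x)\<^sup>2) * (1 + 1 / norm (y - x))) \<le> ennreal (2 * exp (- a * (norm x)\<^sup>2) + 1 / norm (y - x))"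
          by (rule ennreal_leI)
        moreover have "ennreal (exp (- a * (norm x)\<^sup>2) * (1 + 1 / norm (y - x)))
            = ennreal (exp (- a * (norm x)\<^sup>2)) * ennreal (1 + 1 / norm (y - x))"
          by (rule ennreal_mult) simp_all
        moreover have "ennreal (2 * exp (- a * (norm x)\<^sup>2) + 1 / norm (y - x))
            = 2 * ennreal (exp (- a * (norm x)\<^sup>2)) + ennreal (1 / norm (y - x))"
          by (subst ennreal_plus, simp, simp, subst ennreal_mult) auto
        moreover have "c (- y + x) = ennreal (1 / norm (y - x))"
        proof -
          have "- y + x \<in> ball 0 1" using True n by simp
          then show ?thesis unfolding c_def n by simp
        qed
        ultimately show ?thesis by (simp only:)
      next
        case False
        have "exp (- a * (norm x)\<^sup>2) * (1 + 1 / norm (y - x)) \<le> exp (- a * (norm x)\<^sup>2) * 2"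
          using False by (intro mult_left_mono) (auto simp: divide_le_eq)
        then have "ennreal (exp (- a * (norm x)\<^sup>2) * (1 + 1 / norm (y - x))) \<le> ennreal (exp (- a * (norm x)\<^sup>2) * 2)"
          by (rule ennreal_leI)
        then have "ennreal (exp (- a * (norm x)\<^sup>2)) * ennreal (1 + 1 / norm (y - x)) \<le> 2 * ennreal (exp (- a * (norm x)\<^sup>2))"
          by (simp add: ennreal_mult mult.commute)
        then show ?thesis by (rule order_trans) simp
      qed
    qed
    also have "\<dots> = 2 * G + (\<integral>\<^sup>+x. c (- y + x) \<partial>lborel)"
      by (subst nn_integral_add) (simp_all add: nn_integral_cmult G_def)
    also have "(\<integral>\<^sup>+x. c (- y + x) \<partial>lborel) = (\<integral>\<^sup>+x. c x \<partial>lborel)"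
      by (rule nn_integral_translate) measurable
    also have "2 * G + \<dots> \<le> 2 * G + S" using c by (rule add_left_mono)
    finally show ?thesis .
  qed
  note main = this
  have eq: "2 * G + S = ennreal (enn2real (2 * G + S))"
    using G S by (simp add: ennreal_mult_less_top)
  show ?thesis by (rule exI[of _ "enn2real (2 * G + S)"], rule allI, subst eq[symmetric], rule main)
qed

text \<open>
  A Gaussian averaged over a sphere of radius \<open>\<rho>\<close> decays like \<open>\<rho>\<^sup>-\<^sup>2\<close>, wherever its center is. On the shell
  \<open>\<rho> < t < \<rho> + 1\<close> the points \<open>t \<omega>\<close> and \<open>\<rho> \<omega>\<close> are at distance less than 1, so the value at \<open>\<rho> \<omega>\<close> is dominated by a
  wider Gaussian at \<open>t \<omega>\<close>. Averaging over \<open>t\<close> turns the sphere into a shell, and the integral over the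
  shell is bounded by the one over the whole space.
\<close>

lemma sphere_gaussian_bound:
  assumes a: "a > 0"
  shows "\<exists>A::real. \<forall>(c::real^3) \<rho>. 0 \<le> \<rho> \<longrightarrow>
    ennreal (\<rho>\<^sup>2) * (\<integral>\<^sup>+\<omega>. ennreal (exp (- a * (norm (c - \<rho> *\<^sub>R \<omega>))\<^sup>2)) \<partial>sphere_measure) \<le> ennreal A"
proof -
  define G where "G = (\<integral>\<^sup>+x. ennreal (exp (- (a/2) * (norm (x::real^3))\<^sup>2)) \<partial>lborel)"
  have G: "G < \<infinity>" unfolding G_def using a by (intro gaussian_finite) simp
  have main: "ennreal (\<rho>\<^sup>2) * (\<integral>\<^sup>+\<omega>. ennreal (exp (- a * (norm (c - \<rho> *\<^sub>R \<omega>))\<^sup>2)) \<partial>sphere_measure) \<le> ennreal (exp a) * G"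
    if \<rho>: "0 \<le> \<rho>" for c :: "real^3" and \<rho>
  proof -
    define f :: "real^3 \<Rightarrow> ennreal" where "f x = ennreal (exp a) * ennreal (exp (- (a/2) * (norm (- c + x))\<^sup>2))" for x
    have [measurable]: "f \<in> borel_measurable borel" unfolding f_def by measurable
    let ?J = "\<integral>\<^sup>+\<omega>. ennreal (exp (- a * (norm (c - \<rho> *\<^sub>R \<omega>))\<^sup>2)) \<partial>sphere_measure"
    have "ennreal (\<rho>\<^sup>2) * ?J = (\<integral>\<^sup>+t. indicator {\<rho><..<\<rho>+1} t * (ennreal (\<rho>\<^sup>2) * ?J) \<partial>lborel)"
      by (simp add: nn_integral_multc)
    also have "\<dots> \<le> (\<integral>\<^sup>+r. indicator {0<..} r * ennreal (r\<^sup>2) * (\<integral>\<^sup>+\<omega>. f (r *\<^sub>R \<omega>) \<partial>sphere_measure) \<partial>lborel)"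
    proof (rule nn_integral_mono)
      fix t :: real
      show "indicator {\<rho><..<\<rho>+1} t * (ennreal (\<rho>\<^sup>2) * ?J) \<le> indicator {0<..} t * ennreal (t\<^sup>2) * (\<integral>\<^sup>+\<omega>. f (t *\<^sub>R \<omega>) \<partial>sphere_measure)"
      proof (cases "\<rho> < t \<and> t < \<rho> + 1")
        case True
        have "?J \<le> (\<integral>\<^sup>+\<omega>. f (t *\<^sub>R \<omega>) \<partial>sphere_measure)"
        proof (rule nn_integral_mono_AE, use AE_sphere_norm in eventually_elim)
          fix \<omega> :: "real^3" assume \<omega>: "norm \<omega> = 1"
          have "norm (- c + t *\<^sub>R \<omega>) \<le> norm (c - \<rho> *\<^sub>R \<omega>) + norm ((t - \<rho>) *\<^sub>R \<omega>)"
            using norm_triangle_ineq[of "- (c - \<rho> *\<^sub>R \<omega>)" "(t - \<rho>) *\<^sub>R \<omega>"]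
            by (simp add: algebra_simps norm_minus_commute)
          also have "\<dots> \<le> norm (c - \<rho> *\<^sub>R \<omega>) + 1" using True \<omega> by simp
          finally have "(norm (- c + t *\<^sub>R \<omega>))\<^sup>2 \<le> (norm (c - \<rho> *\<^sub>R \<omega>) + 1)\<^sup>2"
            by (rule power_mono) simp
          also have "\<dots> \<le> 2 * (norm (c - \<rho> *\<^sub>R \<omega>))\<^sup>2 + 2"
            using zero_le_power2[of "norm (c - \<rho> *\<^sub>R \<omega>) - 1"] by (simp add: power2_eq_square algebra_simps)
          finally have "(a / 2) * (norm (- c + t *\<^sub>R \<omega>))\<^sup>2 \<le> (a / 2) * (2 * (norm (c - \<rho> *\<^sub>R \<omega>))\<^sup>2 + 2)"
            using a by (intro mult_left_mono) auto
          then have "exp (- a * (norm (c - \<rho> *\<^sub>R \<omega>))\<^sup>2) \<le> exp a * exp (- (a/2) * (norm (- c + t *\<^sub>R \<omega>))\<^sup>2)"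
            by (simp add: exp_add[symmetric] algebra_simps)
          then show "ennreal (exp (- a * (norm (c - \<rho> *\<^sub>R \<omega>))\<^sup>2)) \<le> f (t *\<^sub>R \<omega>)"
            unfolding f_def by (simp add: ennreal_mult[symmetric] ennreal_leI)
        qed
        moreover have "ennreal (\<rho>\<^sup>2) \<le> ennreal (t\<^sup>2)"
          using True \<rho> by (intro ennreal_leI power_mono) auto
        ultimately have "ennreal (\<rho>\<^sup>2) * ?J \<le> ennreal (t\<^sup>2) * (\<integral>\<^sup>+\<omega>. f (t *\<^sub>R \<omega>) \<partial>sphere_measure)"
          by (intro mult_mono) auto
        then show ?thesis using True \<rho> by simp
      qed auto
    qed
    also have "\<dots> = (\<integral>\<^sup>+x. f x \<partial>lborel)" by (rule nn_integral_polar[symmetric]) measurable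
    also have "\<dots> = ennreal (exp a) * (\<integral>\<^sup>+x. ennreal (exp (- (a/2) * (norm (- c + x))\<^sup>2)) \<partial>lborel)"
      unfolding f_def by (rule nn_integral_cmult) measurable
    also have "(\<integral>\<^sup>+x. ennreal (exp (- (a/2) * (norm (- c + x))\<^sup>2)) \<partial>lborel) = G"
      unfolding G_def by (rule nn_integral_translate) measurable
    finally show ?thesis .
  qed
  have eq: "ennreal (exp a) * G = ennreal (enn2real (ennreal (exp a) * G))"
    using G by (simp add: ennreal_mult_less_top)
  show ?thesis
    by (rule exI[of _ "enn2real (ennreal (exp a) * G)"], intro allI impI, subst eq[symmetric], rule main)
qed

text \<open>
  The form in which the decay on spheres is used: \<open>R\<close> is the relative speed after a collision and \<open>\<kappa> R\<close> the
  signed radius of the sphere on which one of the two velocities after the collision lies.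
\<close>

lemma sphere_gaussian_weighted_bound:
  assumes a: "a > 0" and \<kappa>: "\<kappa> \<noteq> 0"
  shows "\<exists>A::real. \<forall>(c::real^3) R. 0 \<le> R \<longrightarrow>
    ennreal (1 + R) * (\<integral>\<^sup>+\<omega>. ennreal (exp (- a * (norm (c + (\<kappa> * R) *\<^sub>R \<omega>))\<^sup>2)) \<partial>sphere_measure) \<le> ennreal A"
proof -
  obtain A where A: "\<And>(c::real^3) \<rho>. 0 \<le> \<rho> \<Longrightarrow>
    ennreal (\<rho>\<^sup>2) * (\<integral>\<^sup>+\<omega>. ennreal (exp (- a * (norm (c - \<rho> *\<^sub>R \<omega>))\<^sup>2)) \<partial>sphere_measure) \<le> ennreal A"
    using sphere_gaussian_bound[OF a] by blast
  define S where "S = emeasure sphere_measure UNIV"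
  have S: "S < \<infinity>"
    using finite_measure.emeasure_finite[OF finite_measure_sphere, of UNIV] by (auto simp: S_def top.not_eq_extremum)
  have main: "ennreal (1 + R) * (\<integral>\<^sup>+\<omega>. ennreal (exp (- a * (norm (c + (\<kappa> * R) *\<^sub>R \<omega>))\<^sup>2)) \<partial>sphere_measure)
     \<le> 2 * S + ennreal (1 / \<kappa>\<^sup>2) * ennreal A" (is "_ * ?J \<le> _") if R: "0 \<le> R" for c :: "real^3" and R
  proof -
    have "?J \<le> (\<integral>\<^sup>+\<omega>. 1 \<partial>sphere_measure)" using a by (intro nn_integral_mono) simp
    then have J1: "?J \<le> S" by (simp add: S_def)
    have J2: "ennreal ((\<kappa> * R)\<^sup>2) * ?J \<le> ennreal A"
    proof (cases "\<kappa> < 0")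
      case True
      then show ?thesis using A[of "- (\<kappa> * R)" c] R by (simp add: mult_nonpos_nonneg)
    next
      case False
      have "norm (- c - (\<kappa> * R) *\<^sub>R \<omega>) = norm (c + (\<kappa> * R) *\<^sub>R \<omega>)" for \<omega>
        by (metis minus_add_distrib norm_minus_cancel uminus_add_conv_diff add.commute)
      then show ?thesis using A[of "\<kappa> * R" "- c"] False R by simp
    qed
    have "1 + R \<le> 2 + R\<^sup>2" using zero_le_power2[of "R - 1/2"] by (simp add: power2_eq_square algebra_simps)
    also have "\<dots> = 2 + 1 / \<kappa>\<^sup>2 * (\<kappa> * R)\<^sup>2" using \<kappa> by (simp add: power_mult_distrib)
    finally have "ennreal (1 + R) \<le> ennreal (2 + 1 / \<kappa>\<^sup>2 * (\<kappa> * R)\<^sup>2)" by (rule ennreal_leI)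
    also have "\<dots> = 2 + ennreal (1 / \<kappa>\<^sup>2) * ennreal ((\<kappa> * R)\<^sup>2)"
      by (subst ennreal_plus, simp, simp, subst ennreal_mult) auto
    finally have "ennreal (1 + R) * ?J \<le> (2 + ennreal (1 / \<kappa>\<^sup>2) * ennreal ((\<kappa> * R)\<^sup>2)) * ?J"
      by (rule mult_right_mono) simp
    also have "\<dots> = 2 * ?J + ennreal (1 / \<kappa>\<^sup>2) * (ennreal ((\<kappa> * R)\<^sup>2) * ?J)"
      by (simp add: distrib_right mult.assoc)
    also have "\<dots> \<le> 2 * S + ennreal (1 / \<kappa>\<^sup>2) * ennreal A"
      by (intro add_mono mult_left_mono J1 J2) auto
    finally show ?thesis .
  qed
  have eq: "2 * S + ennreal (1 / \<kappa>\<^sup>2) * ennreal A = ennreal (enn2real (2 * S + ennreal (1 / \<kappa>\<^sup>2) * ennreal A))"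
    using S by (simp add: ennreal_mult_less_top)
  show ?thesis
    by (rule exI[of _ "enn2real (2 * S + ennreal (1 / \<kappa>\<^sup>2) * ennreal A)"], intro allI impI,
        subst eq[symmetric], rule main)
qed

lemma gamma_integral_finite:
  assumes a: "a > 0" and b: "b > 0"
  shows "(\<integral>\<^sup>+x. ennreal (x powr (b - 1) * exp (- a * x)) * indicator {0<..} x \<partial>lborel) < \<infinity>"
proof -
  have "(\<integral>\<^sup>+x. ennreal (x powr (b - 1) * exp (- a * x)) * indicator {0<..} x \<partial>lborel)
    = ennreal (1/a) * (\<integral>\<^sup>+x. ennreal ((1/a * x) powr (b - 1) * exp (- a * (1/a * x))) * indicator {0<..} (1/a * x) \<partial>lborel)"
    using a by (intro nn_integral_scale_real) auto
  also have "\<dots> \<le> ennreal (1/a) * (\<integral>\<^sup>+x. ennreal ((1/a) powr (b - 1)) * ennreal (indicator {0..} x * x powr (b - 1) / exp x) \<partial>lborel)"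
    using a by (intro mult_left_mono nn_integral_mono)
      (auto split: split_indicator simp: powr_mult powr_divide exp_minus field_simps ennreal_mult[symmetric] intro!: ennreal_leI)
  also have "\<dots> = ennreal (1/a) * (ennreal ((1/a) powr (b - 1)) * ennreal (Gamma b))"
    by (subst nn_integral_cmult, measurable) (simp add: Gamma_conv_nn_integral_real[OF b])
  also have "\<dots> < \<infinity>" by (simp add: ennreal_mult_less_top)
  finally show ?thesis .
qed

section \<open>Phase space and collision weights\<close>

lemma sets_internal_measure [simp, measurable_cong]: "sets (internal_measure X \<alpha>) = sets borel"
  by (simp add: internal_measure_def)

lemma space_internal_measure [simp]: "space (internal_measure X \<alpha>) = UNIV"
  by (simp add: internal_measure_def)

interpretation sphere: finite_measure sphere_measure
  by (rule finite_measure_sphere)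

interpretation internal: sigma_finite_measure "internal_measure X \<alpha>" for X \<alpha>
proof (cases "monatomic X \<alpha>")
  case True
  interpret prob_space "return borel (1::real)" by (rule prob_space_return) simp
  show "sigma_finite_measure (internal_measure X \<alpha>)"
    using True sigma_finite_measure_axioms by (simp add: internal_measure_def)
next
  case False
  then show "sigma_finite_measure (internal_measure X \<alpha>)"
    using sigma_finite_measure.sigma_finite_iff_density_finite[OF lborel.sigma_finite_measure_axioms,
        of "indicator {0<..} :: real \<Rightarrow> ennreal"]
    by (auto simp: internal_measure_def split: split_indicator)
qed

interpretation phase: pair_sigma_finite lborel "internal_measure X \<alpha>" for X \<alpha> ..

interpretation phase: sigma_finite_measure "phase X \<alpha>" for X \<alpha>
  unfolding phase_def by (rule sigma_finite_pair_measure) (rule lborel.sigma_finite_measure_axioms internal.sigma_finite_measure_axioms)+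

interpretation coll: sigma_finite_measure "coll_measure X \<alpha> \<beta>" for X \<alpha> \<beta>
  unfolding coll_measure_def
  by (intro sigma_finite_pair_measure lborel.sigma_finite_measure_axioms internal.sigma_finite_measure_axioms
      sphere.sigma_finite_measure_axioms)

lemma sets_phase [measurable_cong]: "sets (phase X \<alpha>) = sets borel"
proof -
  have "sets (phase X \<alpha>) = sets ((borel :: (real^3) measure) \<Otimes>\<^sub>M (borel :: real measure))"
    unfolding phase_def by (rule sets_pair_measure_cong) auto
  then show ?thesis unfolding borel_prod .
qed

lemma space_phase [simp]: "space (phase X \<alpha>) = UNIV"
  using sets_eq_imp_space_eq[OF sets_phase] by simp

lemma sets_coll_measure [measurable_cong]: "sets (coll_measure X \<alpha> \<beta>) = sets borel"
proof -
  have "sets (coll_measure X \<alpha> \<beta>) = sets ((borel :: (real^3) measure) \<Otimes>\<^sub>M ((borel :: real measure) \<Otimes>\<^sub>M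
    ((borel :: real measure) \<Otimes>\<^sub>M ((borel :: real measure) \<Otimes>\<^sub>M (borel :: (real^3) measure)))))"
    unfolding coll_measure_def by (intro sets_pair_measure_cong) auto
  then show ?thesis unfolding borel_prod .
qed

lemma space_coll_measure [simp]: "space (coll_measure X \<alpha> \<beta>) = UNIV"
  using sets_eq_imp_space_eq[OF sets_coll_measure] by simp

lemma AE_internal_energy: "AE I in internal_measure X \<alpha>. internal_energy X \<alpha> I"
proof (cases "monatomic X \<alpha>")
  case True
  then have eq: "internal_measure X \<alpha> = return borel 1" "internal_energy X \<alpha> I = (I = 1)" for I
    by (simp_all add: internal_measure_def internal_energy_def)
  show ?thesis unfolding eq by (subst AE_return) auto
next
  case False
  then have eq: "internal_measure X \<alpha> = density lborel (indicator {0<..})" "internal_energy X \<alpha> I = (0 < I)" for I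
    by (simp_all add: internal_measure_def internal_energy_def)
  have "0 < x" if "(0::ennreal) < indicator {0<..} x" for x :: real
    using that by (cases "0 < x") auto
  then have "AE x in lborel. (0::ennreal) < indicator {0<..} (x::real) \<longrightarrow> 0 < x"
    by (intro AE_I2 impI)
  then have "AE I in density lborel (indicator {0<..} :: real \<Rightarrow> ennreal). 0 < I"
    by (subst AE_density) simp_all
  then show ?thesis by (simp only: eq)
qed

lemma nn_integral_swap:
  assumes "sigma_finite_measure M" "sigma_finite_measure N"
    and "(\<lambda>(x, y). f x y) \<in> borel_measurable (M \<Otimes>\<^sub>M N)"
  shows "(\<integral>\<^sup>+x. \<integral>\<^sup>+y. f x y \<partial>N \<partial>M) = (\<integral>\<^sup>+y. \<integral>\<^sup>+x. f x y \<partial>M \<partial>N)"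
proof -
  interpret pair_sigma_finite M N using assms(1,2) by (simp add: pair_sigma_finite_def)
  show ?thesis by (rule Fubini'[symmetric]) (use assms(3) in simp)
qed

lemma nn_integral_phase:
  assumes [measurable]: "f \<in> borel_measurable borel"
  shows "(\<integral>\<^sup>+z. f z \<partial>phase X \<alpha>) = (\<integral>\<^sup>+\<xi>. \<integral>\<^sup>+I. f (\<xi>, I) \<partial>internal_measure X \<alpha> \<partial>lborel)"
  unfolding phase_def
proof (rule internal.nn_integral_fst[symmetric])
  show "f \<in> borel_measurable (lborel \<Otimes>\<^sub>M internal_measure X \<alpha>)"
    unfolding measurable_cong_sets[OF sets_phase[unfolded phase_def] refl] by (rule assms)
qed

lemma nn_integral_coll_measure:
  assumes f: "f \<in> borel_measurable borel"
  shows "(\<integral>\<^sup>+c. f c \<partial>coll_measure X \<alpha> \<beta>) = (\<integral>\<^sup>+\<xi>s. \<integral>\<^sup>+Is. \<integral>\<^sup>+I'. \<integral>\<^sup>+Is'. \<integral>\<^sup>+\<omega>. f (\<xi>s, Is, I', Is', \<omega>)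
     \<partial>sphere_measure \<partial>internal_measure X \<beta> \<partial>internal_measure X \<alpha> \<partial>internal_measure X \<beta> \<partial>lborel)"
proof -
  let ?i = "internal_measure X"
  have fm[measurable]: "f \<in> borel_measurable (lborel \<Otimes>\<^sub>M (?i \<beta> \<Otimes>\<^sub>M (?i \<alpha> \<Otimes>\<^sub>M (?i \<beta> \<Otimes>\<^sub>M sphere_measure))))"
    unfolding measurable_cong_sets[OF sets_coll_measure[unfolded coll_measure_def] refl] by (rule f)
  interpret S4: sigma_finite_measure "?i \<beta> \<Otimes>\<^sub>M sphere_measure"
    by (intro sigma_finite_pair_measure internal.sigma_finite_measure_axioms sphere.sigma_finite_measure_axioms)
  interpret S3: sigma_finite_measure "?i \<alpha> \<Otimes>\<^sub>M (?i \<beta> \<Otimes>\<^sub>M sphere_measure)"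
    by (intro sigma_finite_pair_measure internal.sigma_finite_measure_axioms S4.sigma_finite_measure_axioms)
  interpret S2: sigma_finite_measure "?i \<beta> \<Otimes>\<^sub>M (?i \<alpha> \<Otimes>\<^sub>M (?i \<beta> \<Otimes>\<^sub>M sphere_measure))"
    by (intro sigma_finite_pair_measure internal.sigma_finite_measure_axioms S3.sigma_finite_measure_axioms)
  have "(\<integral>\<^sup>+c. f c \<partial>coll_measure X \<alpha> \<beta>)
      = (\<integral>\<^sup>+\<xi>s. \<integral>\<^sup>+y. f (\<xi>s, y) \<partial>(?i \<beta> \<Otimes>\<^sub>M (?i \<alpha> \<Otimes>\<^sub>M (?i \<beta> \<Otimes>\<^sub>M sphere_measure))) \<partial>lborel)"
    unfolding coll_measure_def by (rule S2.nn_integral_fst[symmetric, OF fm])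
  also have "\<dots> = (\<integral>\<^sup>+\<xi>s. \<integral>\<^sup>+Is. \<integral>\<^sup>+y. f (\<xi>s, Is, y) \<partial>(?i \<alpha> \<Otimes>\<^sub>M (?i \<beta> \<Otimes>\<^sub>M sphere_measure)) \<partial>?i \<beta> \<partial>lborel)"
    by (intro nn_integral_cong S3.nn_integral_fst[symmetric]) measurable
  also have "\<dots> = (\<integral>\<^sup>+\<xi>s. \<integral>\<^sup>+Is. \<integral>\<^sup>+I'. \<integral>\<^sup>+y. f (\<xi>s, Is, I', y) \<partial>(?i \<beta> \<Otimes>\<^sub>M sphere_measure) \<partial>?i \<alpha> \<partial>?i \<beta> \<partial>lborel)"
    by (intro nn_integral_cong S4.nn_integral_fst[symmetric]) measurable
  also have "\<dots> = (\<integral>\<^sup>+\<xi>s. \<integral>\<^sup>+Is. \<integral>\<^sup>+I'. \<integral>\<^sup>+Is'. \<integral>\<^sup>+\<omega>. f (\<xi>s, Is, I', Is', \<omega>)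
     \<partial>sphere_measure \<partial>?i \<beta> \<partial>?i \<alpha> \<partial>?i \<beta> \<partial>lborel)"
    by (intro nn_integral_cong sphere.nn_integral_fst[symmetric]) measurable
  finally show ?thesis .
qed

text \<open>
  The density of the transition probability in the relative speed and the scattering angle. It is cut off
  outside \<open>collision_args\<close>, so that symmetries and estimates hold for all arguments and not just almost all.
\<close>

definition scat :: "mixture \<Rightarrow> nat \<Rightarrow> nat \<Rightarrow> real \<Rightarrow> real \<Rightarrow> real \<Rightarrow> real \<Rightarrow> real \<Rightarrow> real \<Rightarrow> real" where
  "scat X \<alpha> \<beta> r c I Is I' Is' =
     (if collision_args X \<alpha> \<beta> r c I Is I' Is'
      then I powr (dof X \<alpha> / 2 - 1) * Is powr (dof X \<beta> / 2 - 1) * r * xsec X \<alpha> \<beta> r c I Is I' Is' else 0)"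

text \<open>
  A version of \<open>trans_weight\<close> that vanishes unless all internal energies are admissible and \<open>\<omega>\<close> is a unit
  vector; the two agree almost everywhere.
\<close>

definition coll_weight ::
    "mixture \<Rightarrow> nat \<Rightarrow> nat \<Rightarrow> real^3 \<Rightarrow> real^3 \<Rightarrow> real \<Rightarrow> real \<Rightarrow> real \<Rightarrow> real \<Rightarrow> real^3 \<Rightarrow> real" where
  "coll_weight X \<alpha> \<beta> \<xi> \<xi>s I Is I' Is' \<omega> =
     (if norm \<omega> = 1
      then scat X \<alpha> \<beta> (norm (\<xi> - \<xi>s)) ((\<xi> - \<xi>s) \<bullet> \<omega> / norm (\<xi> - \<xi>s)) I Is I' Is' else 0)"

lemma internal_energy_measurable [measurable]: "Measurable.pred borel (internal_energy X \<alpha>)"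
  unfolding internal_energy_def[abs_def] by (cases "monatomic X \<alpha>") simp_all

lemma internal_energy_pos: "internal_energy X \<alpha> I \<Longrightarrow> 0 < I"
  by (auto simp: internal_energy_def split: if_splits)

lemma energy_gap_reverse: "energy_gap I' Is' I Is = - energy_gap I Is I' Is'"
  by (simp add: energy_gap_def)

lemma energy_gap_swap: "energy_gap Is I Is' I' = energy_gap I Is I' Is'"
  by (simp add: energy_gap_def)

lemma red_mass_sym: "red_mass X \<alpha> \<beta> = red_mass X \<beta> \<alpha>"
  by (simp add: red_mass_def ac_simps)

lemma collision_args_swap:
  "collision_args X \<alpha> \<beta> r c I Is I' Is' \<longleftrightarrow> collision_args X \<beta> \<alpha> r c Is I Is' I'"
  by (auto simp: collision_args_def energy_gap_swap[of Is I] red_mass_sym[of X \<beta> \<alpha>])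

lemma post_speed_measurable [measurable (raw)]:
  assumes [measurable]: "r \<in> borel_measurable M" "I \<in> borel_measurable M" "Is \<in> borel_measurable M"
    "I' \<in> borel_measurable M" "Is' \<in> borel_measurable M"
  shows "(\<lambda>x. post_speed X \<alpha> \<beta> (r x) (I x) (Is x) (I' x) (Is' x)) \<in> borel_measurable M"
  unfolding post_speed_def energy_gap_def by measurable

lemma center_vel_measurable [measurable (raw)]:
  assumes [measurable]: "\<xi> \<in> borel_measurable M" "\<xi>s \<in> borel_measurable M"
  shows "(\<lambda>x. center_vel X \<alpha> \<beta> (\<xi> x) (\<xi>s x)) \<in> borel_measurable M"
  unfolding center_vel_def by measurable

lemma post_vel_measurable [measurable (raw)]:
  assumes [measurable]: "\<xi> \<in> borel_measurable M" "\<xi>s \<in> borel_measurable M" "I \<in> borel_measurable M"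
    "Is \<in> borel_measurable M" "I' \<in> borel_measurable M" "Is' \<in> borel_measurable M" "\<omega> \<in> borel_measurable M"
  shows "(\<lambda>x. post_vel X \<alpha> \<beta> (\<xi> x) (\<xi>s x) (I x) (Is x) (I' x) (Is' x) (\<omega> x)) \<in> borel_measurable M"
    and "(\<lambda>x. post_vel_s X \<alpha> \<beta> (\<xi> x) (\<xi>s x) (I x) (Is x) (I' x) (Is' x) (\<omega> x)) \<in> borel_measurable M"
  unfolding post_vel_def post_vel_s_def by measurable

lemma post_vel_swap:
  "post_vel X \<beta> \<alpha> \<xi>s \<xi> Is I Is' I' (- \<omega>) = post_vel_s X \<alpha> \<beta> \<xi> \<xi>s I Is I' Is' \<omega>"
  "post_vel_s X \<beta> \<alpha> \<xi>s \<xi> Is I Is' I' (- \<omega>) = post_vel X \<alpha> \<beta> \<xi> \<xi>s I Is I' Is' \<omega>"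
  by (simp_all add: post_vel_def post_vel_s_def center_vel_def post_speed_def norm_minus_commute
      energy_gap_swap[of I Is] red_mass_sym[of X \<alpha> \<beta>] add_ac)

context gas_mixture
begin

context
  fixes \<alpha> \<beta> assumes sp: "\<alpha> \<in> species X" "\<beta> \<in> species X"
begin

lemma red_mass_pos: "0 < red_mass X \<alpha> \<beta>"
  using mass_pos[OF sp(1)] mass_pos[OF sp(2)] by (simp add: red_mass_def)

lemma xsec_measurable' [measurable (raw)]:
  assumes [measurable]: "r \<in> borel_measurable M" "c \<in> borel_measurable M" "I \<in> borel_measurable M"
    "Is \<in> borel_measurable M" "I' \<in> borel_measurable M" "Is' \<in> borel_measurable M"
  shows "(\<lambda>x. xsec X \<alpha> \<beta> (r x) (c x) (I x) (Is x) (I' x) (Is' x)) \<in> borel_measurable M"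
proof -
  have "(\<lambda>x. (r x, c x, I x, Is x, I' x, Is' x)) \<in> borel_measurable M" by measurable
  from measurable_compose[OF this xsec_measurable[OF sp]] show ?thesis by simp
qed

lemma scat_measurable [measurable (raw)]:
  assumes [measurable]: "r \<in> borel_measurable M" "c \<in> borel_measurable M" "I \<in> borel_measurable M"
    "Is \<in> borel_measurable M" "I' \<in> borel_measurable M" "Is' \<in> borel_measurable M"
  shows "(\<lambda>x. scat X \<alpha> \<beta> (r x) (c x) (I x) (Is x) (I' x) (Is' x)) \<in> borel_measurable M"
  unfolding scat_def collision_args_def energy_gap_def by measurable

lemma coll_weight_measurable [measurable (raw)]:
  assumes [measurable]: "\<xi> \<in> borel_measurable M" "\<xi>s \<in> borel_measurable M" "I \<in> borel_measurable M"
    "Is \<in> borel_measurable M" "I' \<in> borel_measurable M" "Is' \<in> borel_measurable M" "\<omega> \<in> borel_measurable M"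
  shows "(\<lambda>x. coll_weight X \<alpha> \<beta> (\<xi> x) (\<xi>s x) (I x) (Is x) (I' x) (Is' x) (\<omega> x)) \<in> borel_measurable M"
  unfolding coll_weight_def by measurable

lemma scat_swap: "scat X \<beta> \<alpha> r c Is I Is' I' = scat X \<alpha> \<beta> r c I Is I' Is'"
  using xsec_sym[OF sp, of r c I Is I' Is'] by (simp add: scat_def collision_args_swap[of X \<beta> \<alpha>] ac_simps)

lemma coll_weight_swap:
  "coll_weight X \<beta> \<alpha> \<xi>s \<xi> Is I Is' I' (- \<omega>) = coll_weight X \<alpha> \<beta> \<xi> \<xi>s I Is I' Is' \<omega>"
proof -
  have "(\<xi>s - \<xi>) \<bullet> (- \<omega>) = (\<xi> - \<xi>s) \<bullet> \<omega>" by (simp add: inner_diff_left)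
  then show ?thesis by (simp add: coll_weight_def scat_swap norm_minus_commute[of \<xi>s])
qed

lemma post_speed_facts:
  fixes I Is I' Is' :: real
  defines "d \<equiv> 2 * energy_gap I Is I' Is' / red_mass X \<alpha> \<beta>"
  assumes r: "0 < r" "d < r\<^sup>2"
  shows "post_speed X \<alpha> \<beta> r I Is I' Is' = sqrt (r\<^sup>2 - d)"
    and "0 < post_speed X \<alpha> \<beta> r I Is I' Is'"
    and "collision_args X \<alpha> \<beta> (post_speed X \<alpha> \<beta> r I Is I' Is') c I' Is' I Is
      \<longleftrightarrow> collision_args X \<alpha> \<beta> r c I Is I' Is'"
proof -
  show 1: "post_speed X \<alpha> \<beta> r I Is I' Is' = sqrt (r\<^sup>2 - d)" by (simp add: post_speed_def d_def)
  show 2: "0 < post_speed X \<alpha> \<beta> r I Is I' Is'" using r by (simp add: 1)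
  have 3: "(post_speed X \<alpha> \<beta> r I Is I' Is')\<^sup>2 = r\<^sup>2 - d" using r by (simp add: 1)
  have a: "2 * energy_gap I Is I' Is' < red_mass X \<alpha> \<beta> * r\<^sup>2"
    using r red_mass_pos by (simp add: d_def field_simps)
  have "red_mass X \<alpha> \<beta> * (r\<^sup>2 - d) = red_mass X \<alpha> \<beta> * r\<^sup>2 - 2 * energy_gap I Is I' Is'"
    using red_mass_pos by (simp add: d_def field_simps)
  moreover have "0 < red_mass X \<alpha> \<beta> * r\<^sup>2" using red_mass_pos r by simp
  ultimately have b: "2 * energy_gap I' Is' I Is < red_mass X \<alpha> \<beta> * (post_speed X \<alpha> \<beta> r I Is I' Is')\<^sup>2"
    unfolding 3 by (simp add: energy_gap_reverse[of I'])
  show "collision_args X \<alpha> \<beta> (post_speed X \<alpha> \<beta> r I Is I' Is') c I' Is' I Is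
      \<longleftrightarrow> collision_args X \<alpha> \<beta> r c I Is I' Is'"
    using a b 2 r by (auto simp: collision_args_def)
qed

text \<open>
  Microreversibility says that \<open>r \<cdot> scat\<close> is invariant under reversal. The remaining factor of the volume element
  \<open>r\<^sup>2 dr\<close> of the relative velocity is accounted for by \<open>r dr = r' dr'\<close>.
\<close>

lemma scat_reverse:
  assumes r: "0 < r" "2 * energy_gap I Is I' Is' / red_mass X \<alpha> \<beta> < r\<^sup>2"
  shows "r * scat X \<alpha> \<beta> r c I Is I' Is' =
    post_speed X \<alpha> \<beta> r I Is I' Is' * scat X \<alpha> \<beta> (post_speed X \<alpha> \<beta> r I Is I' Is') c I' Is' I Is"
proof (cases "collision_args X \<alpha> \<beta> r c I Is I' Is'")
  case True
  then show ?thesis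
    using microreversibility[OF sp True refl] post_speed_facts(3)[OF r, of c]
    by (simp add: scat_def power2_eq_square ac_simps)
next
  case False
  then show ?thesis using post_speed_facts(3)[OF r, of c] by (simp add: scat_def)
qed

lemma scat_eq_0: "\<not> (0 < r \<and> 2 * energy_gap I Is I' Is' / red_mass X \<alpha> \<beta> < r\<^sup>2) \<Longrightarrow> scat X \<alpha> \<beta> r c I Is I' Is' = 0"
  using red_mass_pos by (auto simp: scat_def collision_args_def field_simps)

end

end

section \<open>Reversing a collision at fixed internal energies\<close>

type_synonym collision = "((real^3) \<times> real) \<times> ((real^3) \<times> real) \<times> ((real^3) \<times> real) \<times> ((real^3) \<times> real)"

text \<open>
  A collision is recorded by the states \<open>(z, z\<^sub>*, z', z'\<^sub>*)\<close> of its two particles before and after; \<open>coll_event\<close>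
  recovers them from the variables of the collision integral.
\<close>

fun coll_event :: "mixture \<Rightarrow> nat \<Rightarrow> nat \<Rightarrow> ((real^3) \<times> real) \<times> ((real^3) \<times> real \<times> real \<times> real \<times> (real^3)) \<Rightarrow> collision" where
  "coll_event X \<alpha> \<beta> ((\<xi>, I), (\<xi>s, Is, I', Is', \<omega>)) =
     ((\<xi>, I), (\<xi>s, Is), (post_vel X \<alpha> \<beta> \<xi> \<xi>s I Is I' Is' \<omega>, I'), (post_vel_s X \<alpha> \<beta> \<xi> \<xi>s I Is I' Is' \<omega>, Is'))"

fun event_weight :: "mixture \<Rightarrow> nat \<Rightarrow> nat \<Rightarrow> ((real^3) \<times> real) \<times> ((real^3) \<times> real \<times> real \<times> real \<times> (real^3)) \<Rightarrow> real" where
  "event_weight X \<alpha> \<beta> ((\<xi>, I), (\<xi>s, Is, I', Is', \<omega>)) = coll_weight X \<alpha> \<beta> \<xi> \<xi>s I Is I' Is' \<omega>"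

text \<open>
  The measure \<open>W d\<xi> d\<xi>\<^sub>* d\<xi>' d\<xi>'\<^sub>* dI dI\<^sub>* dI' dI'\<^sub>*\<close>, carried by the collisions that conserve momentum and energy.
  On the space of quadruples its symmetries become invariance under permutations of the four entries.
\<close>

definition collision_law :: "mixture \<Rightarrow> nat \<Rightarrow> nat \<Rightarrow> collision measure" where
  "collision_law X \<alpha> \<beta> = distr (density (phase X \<alpha> \<Otimes>\<^sub>M coll_measure X \<alpha> \<beta>) (\<lambda>x. ennreal (event_weight X \<alpha> \<beta> x)))
     borel (coll_event X \<alpha> \<beta>)"

lemma sets_collision_law [simp, measurable_cong]: "sets (collision_law X \<alpha> \<beta>) = sets borel"
  by (simp add: collision_law_def)

lemma sets_phase_coll [measurable_cong]: "sets (phase X \<alpha> \<Otimes>\<^sub>M coll_measure X \<beta> \<gamma>) = sets borel"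
proof -
  have "sets (phase X \<alpha> \<Otimes>\<^sub>M coll_measure X \<beta> \<gamma>) = sets ((borel :: ((real^3) \<times> real) measure)
     \<Otimes>\<^sub>M (borel :: ((real^3) \<times> real \<times> real \<times> real \<times> (real^3)) measure))"
    by (intro sets_pair_measure_cong sets_phase sets_coll_measure)
  then show ?thesis unfolding borel_prod .
qed

lemma event_split: "x = ((fst (fst x), snd (fst x)), (fst (snd x), fst (snd (snd x)), fst (snd (snd (snd x))),
     fst (snd (snd (snd (snd x)))), snd (snd (snd (snd (snd x))))))"
  by simp

lemma fst_measurable_borel [measurable (raw)]:
  fixes f :: "'c \<Rightarrow> 'a::second_countable_topology \<times> 'b::second_countable_topology"
  assumes "f \<in> borel_measurable M" shows "(\<lambda>x. fst (f x)) \<in> borel_measurable M"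
proof (rule measurable_compose[OF assms])
  show "fst \<in> borel_measurable (borel :: ('a \<times> 'b) measure)" unfolding borel_prod[symmetric] by measurable
qed

lemma snd_measurable_borel [measurable (raw)]:
  fixes f :: "'c \<Rightarrow> 'a::second_countable_topology \<times> 'b::second_countable_topology"
  assumes "f \<in> borel_measurable M" shows "(\<lambda>x. snd (f x)) \<in> borel_measurable M"
proof (rule measurable_compose[OF assms])
  show "snd \<in> borel_measurable (borel :: ('a \<times> 'b) measure)" unfolding borel_prod[symmetric] by measurable
qed

lemma coll_event_measurable [measurable]: "coll_event X \<alpha> \<beta> \<in> borel_measurable borel"
  by (subst measurable_cong[OF arg_cong[OF event_split, of "coll_event X \<alpha> \<beta>"]])
    (simp only: coll_event.simps, measurable)

lemma measurable_compose_borel2: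
  fixes H :: "'a::second_countable_topology \<Rightarrow> 'b::second_countable_topology \<Rightarrow> 'c::topological_space"
  assumes "(\<lambda>(x, y). H x y) \<in> borel_measurable borel"
    and "f \<in> borel_measurable M" "g \<in> borel_measurable M"
  shows "(\<lambda>x. H (f x) (g x)) \<in> borel_measurable M"
  using measurable_compose[OF borel_measurable_Pair[OF assms(2,3)] assms(1)] by simp

lemma measurable_compose3:
  assumes "(\<lambda>(x, y, z). f x y z) \<in> measurable (M \<Otimes>\<^sub>M (N \<Otimes>\<^sub>M P)) K"
    and "a \<in> measurable L M" "b \<in> measurable L N" "c \<in> measurable L P"
  shows "(\<lambda>w. f (a w) (b w) (c w)) \<in> measurable L K"
  using measurable_compose[OF measurable_Pair[OF assms(2) measurable_Pair[OF assms(3,4)]] assms(1)] by simp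

lemma measurable_compose_borel4:
  fixes F :: "'a::second_countable_topology \<Rightarrow> 'a \<Rightarrow> 'a \<Rightarrow> 'a \<Rightarrow> 'c::topological_space"
  assumes "(\<lambda>(x, y, z, w). F x y z w) \<in> borel_measurable borel"
    and "a \<in> borel_measurable M" "b \<in> borel_measurable M" "c \<in> borel_measurable M" "d \<in> borel_measurable M"
  shows "(\<lambda>x. F (a x) (b x) (c x) (d x)) \<in> borel_measurable M"
  using measurable_compose[OF borel_measurable_Pair[OF assms(2) borel_measurable_Pair[OF assms(3)
      borel_measurable_Pair[OF assms(4,5)]]] assms(1)] by simp

text \<open>
  Passing to the relative velocity \<open>g\<close> and the center of mass velocity \<open>G\<close> is a composition of two shears,
  hence of translations in one variable with the other one fixed.
\<close>

lemma nn_integral_center_of_mass: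
  fixes H :: "real^3 \<Rightarrow> real^3 \<Rightarrow> ennreal"
  assumes H: "(\<lambda>(x, y). H x y) \<in> borel_measurable borel" and b: "b1 + b2 = 1"
  shows "(\<integral>\<^sup>+\<xi>. \<integral>\<^sup>+\<xi>s. H \<xi> \<xi>s \<partial>lborel \<partial>lborel) = (\<integral>\<^sup>+g. \<integral>\<^sup>+G. H (G + b2 *\<^sub>R g) (G - b1 *\<^sub>R g) \<partial>lborel \<partial>lborel)"
proof -
  note [measurable (raw)] = measurable_compose_borel2[OF H]
  have "(\<integral>\<^sup>+\<xi>. \<integral>\<^sup>+\<xi>s. H \<xi> \<xi>s \<partial>lborel \<partial>lborel) = (\<integral>\<^sup>+\<xi>s. \<integral>\<^sup>+\<xi>. H \<xi> \<xi>s \<partial>lborel \<partial>lborel)"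
    by (rule nn_integral_swap) (auto simp: lborel.sigma_finite_measure_axioms)
  also have "\<dots> = (\<integral>\<^sup>+\<xi>s. \<integral>\<^sup>+g. H (\<xi>s + g) \<xi>s \<partial>lborel \<partial>lborel)"
    by (intro nn_integral_cong nn_integral_translate[symmetric]) measurable
  also have "\<dots> = (\<integral>\<^sup>+g. \<integral>\<^sup>+\<xi>s. H (\<xi>s + g) \<xi>s \<partial>lborel \<partial>lborel)"
    by (rule nn_integral_swap) (auto simp: lborel.sigma_finite_measure_axioms)
  also have "\<dots> = (\<integral>\<^sup>+g. \<integral>\<^sup>+G. H (- (b1 *\<^sub>R g) + G + g) (- (b1 *\<^sub>R g) + G) \<partial>lborel \<partial>lborel)"
  proof (rule nn_integral_cong)
    fix g :: "real^3"
    show "(\<integral>\<^sup>+\<xi>s. H (\<xi>s + g) \<xi>s \<partial>lborel) = (\<integral>\<^sup>+G. H (- (b1 *\<^sub>R g) + G + g) (- (b1 *\<^sub>R g) + G) \<partial>lborel)"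
      by (rule nn_integral_translate[symmetric]) measurable
  qed
  also have "\<dots> = (\<integral>\<^sup>+g. \<integral>\<^sup>+G. H (G + b2 *\<^sub>R g) (G - b1 *\<^sub>R g) \<partial>lborel \<partial>lborel)"
  proof -
    have b2: "b2 = 1 - b1" using b by simp
    have "- (b1 *\<^sub>R g) + G + g = G + b2 *\<^sub>R g" "- (b1 *\<^sub>R g) + G = G - b1 *\<^sub>R g" for g G :: "real^3"
      unfolding b2 by (simp_all add: scaleR_diff_left)
    then show ?thesis by (simp only:)
  qed
  finally show ?thesis .
qed

lemma nn_integral_reverse3:
  assumes [measurable]: "(\<lambda>(x, y, z). f x y z) \<in> borel_measurable (M \<Otimes>\<^sub>M (N \<Otimes>\<^sub>M P))"
    and s: "sigma_finite_measure M" "sigma_finite_measure N" "sigma_finite_measure P"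
  shows "(\<integral>\<^sup>+x. \<integral>\<^sup>+y. \<integral>\<^sup>+z. f x y z \<partial>P \<partial>N \<partial>M) = (\<integral>\<^sup>+z. \<integral>\<^sup>+y. \<integral>\<^sup>+x. f x y z \<partial>M \<partial>N \<partial>P)"
proof -
  interpret M: sigma_finite_measure M by fact
  interpret N: sigma_finite_measure N by fact
  interpret P: sigma_finite_measure P by fact
  note [measurable (raw)] = measurable_compose3[OF assms(1)]
  have "(\<integral>\<^sup>+x. \<integral>\<^sup>+y. \<integral>\<^sup>+z. f x y z \<partial>P \<partial>N \<partial>M) = (\<integral>\<^sup>+x. \<integral>\<^sup>+z. \<integral>\<^sup>+y. f x y z \<partial>N \<partial>P \<partial>M)"
    by (intro nn_integral_cong nn_integral_swap s) measurable
  also have "\<dots> = (\<integral>\<^sup>+z. \<integral>\<^sup>+x. \<integral>\<^sup>+y. f x y z \<partial>N \<partial>M \<partial>P)"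
    by (intro nn_integral_swap s) measurable
  also have "\<dots> = (\<integral>\<^sup>+z. \<integral>\<^sup>+y. \<integral>\<^sup>+x. f x y z \<partial>M \<partial>N \<partial>P)"
    by (intro nn_integral_cong nn_integral_swap s) measurable
  finally show ?thesis .
qed


context gas_mixture
begin

context
  fixes \<alpha> \<beta> assumes sp: "\<alpha> \<in> species X" "\<beta> \<in> species X"
begin

text \<open>
  The collision integrand in center of mass coordinates: \<open>\<eta>\<close> and \<open>\<omega>\<close> are the directions of the relative
  velocity before and after the collision, \<open>r\<close> is its modulus before.
\<close>

definition radial_gain :: "(real^3 \<Rightarrow> real^3 \<Rightarrow> real^3 \<Rightarrow> real^3 \<Rightarrow> ennreal) \<Rightarrow> real \<Rightarrow> real \<Rightarrow> real \<Rightarrow> real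
    \<Rightarrow> real^3 \<Rightarrow> real^3 \<Rightarrow> real^3 \<Rightarrow> real \<Rightarrow> ennreal" where
  "radial_gain F I Is I' Is' \<eta> G \<omega> r = (let b1 = mass X \<alpha> / (mass X \<alpha> + mass X \<beta>);
       b2 = mass X \<beta> / (mass X \<alpha> + mass X \<beta>); r' = post_speed X \<alpha> \<beta> r I Is I' Is'
     in F (G + (b2 * r) *\<^sub>R \<eta>) (G - (b1 * r) *\<^sub>R \<eta>) (G + (b2 * r') *\<^sub>R \<omega>) (G - (b1 * r') *\<^sub>R \<omega>)
        * ennreal (scat X \<alpha> \<beta> r (\<eta> \<bullet> \<omega>) I Is I' Is'))"

lemma radial_gain_measurable [measurable (raw)]:
  assumes "(\<lambda>(x, y, z, w). F x y z w) \<in> borel_measurable borel"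
    and [measurable]: "\<eta> \<in> borel_measurable M" "G \<in> borel_measurable M" "\<omega> \<in> borel_measurable M" "r \<in> borel_measurable M"
  shows "(\<lambda>x. radial_gain F I Is I' Is' (\<eta> x) (G x) (\<omega> x) (r x)) \<in> borel_measurable M"
proof -
  note [measurable (raw)] = measurable_compose_borel4[OF assms(1)] scat_measurable[OF sp]
  show ?thesis unfolding radial_gain_def Let_def by measurable
qed

lemma mass_fractions: "mass X \<alpha> / (mass X \<alpha> + mass X \<beta>) + mass X \<beta> / (mass X \<alpha> + mass X \<beta>) = 1"
  using mass_pos[OF sp(1)] mass_pos[OF sp(2)] by (simp add: add_divide_distrib[symmetric])

lemma center_vel_center_of_mass:
  fixes G g :: "real^3"
  defines "b1 \<equiv> mass X \<alpha> / (mass X \<alpha> + mass X \<beta>)" and "b2 \<equiv> mass X \<beta> / (mass X \<alpha> + mass X \<beta>)"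
  shows "center_vel X \<alpha> \<beta> (G + b2 *\<^sub>R g) (G - b1 *\<^sub>R g) = G"
    and "(G + b2 *\<^sub>R g) - (G - b1 *\<^sub>R g) = g"
proof -
  have M: "mass X \<alpha> + mass X \<beta> \<noteq> 0" using mass_pos[OF sp(1)] mass_pos[OF sp(2)] by simp
  have "mass X \<alpha> *\<^sub>R (G + b2 *\<^sub>R g) + mass X \<beta> *\<^sub>R (G - b1 *\<^sub>R g)
      = (mass X \<alpha> + mass X \<beta>) *\<^sub>R G + (mass X \<alpha> * b2 - mass X \<beta> * b1) *\<^sub>R g"
    by (simp add: algebra_simps)
  also have "mass X \<alpha> * b2 - mass X \<beta> * b1 = 0" by (simp add: b1_def b2_def)
  finally show "center_vel X \<alpha> \<beta> (G + b2 *\<^sub>R g) (G - b1 *\<^sub>R g) = G"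
    using M by (simp add: center_vel_def)
  have "(G + b2 *\<^sub>R g) - (G - b1 *\<^sub>R g) = (b1 + b2) *\<^sub>R g" by (simp add: algebra_simps)
  then show "(G + b2 *\<^sub>R g) - (G - b1 *\<^sub>R g) = g" using mass_fractions by (simp add: b1_def b2_def)
qed

lemma velocity_integral_polar:
  assumes F: "(\<lambda>(x, y, z, w). F x y z w) \<in> borel_measurable borel"
  shows "(\<integral>\<^sup>+\<xi>. \<integral>\<^sup>+\<xi>s. \<integral>\<^sup>+\<omega>. F \<xi> \<xi>s (post_vel X \<alpha> \<beta> \<xi> \<xi>s I Is I' Is' \<omega>) (post_vel_s X \<alpha> \<beta> \<xi> \<xi>s I Is I' Is' \<omega>)
       * ennreal (coll_weight X \<alpha> \<beta> \<xi> \<xi>s I Is I' Is' \<omega>) \<partial>sphere_measure \<partial>lborel \<partial>lborel)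
    = (\<integral>\<^sup>+\<eta>. \<integral>\<^sup>+G. \<integral>\<^sup>+\<omega>. \<integral>\<^sup>+r. indicator {0<..} r * ennreal (r\<^sup>2) * radial_gain F I Is I' Is' \<eta> G \<omega> r
       \<partial>lborel \<partial>sphere_measure \<partial>lborel \<partial>sphere_measure)"
proof -
  note [measurable (raw)] = measurable_compose_borel4[OF F] scat_measurable[OF sp] coll_weight_measurable[OF sp]
    radial_gain_measurable[OF F]
  define b1 where "b1 = mass X \<alpha> / (mass X \<alpha> + mass X \<beta>)"
  define b2 where "b2 = mass X \<beta> / (mass X \<alpha> + mass X \<beta>)"
  define H where "H \<xi> \<xi>s \<omega> = F \<xi> \<xi>s (post_vel X \<alpha> \<beta> \<xi> \<xi>s I Is I' Is' \<omega>) (post_vel_s X \<alpha> \<beta> \<xi> \<xi>s I Is I' Is' \<omega>)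
       * ennreal (coll_weight X \<alpha> \<beta> \<xi> \<xi>s I Is I' Is' \<omega>)" for \<xi> \<xi>s \<omega>
  have Hm: "(\<lambda>(x, y, z). H x y z) \<in> borel_measurable (borel \<Otimes>\<^sub>M (borel \<Otimes>\<^sub>M borel))"
    unfolding H_def by measurable
  note [measurable (raw)] = measurable_compose3[OF Hm]
  have "(\<integral>\<^sup>+\<xi>. \<integral>\<^sup>+\<xi>s. \<integral>\<^sup>+\<omega>. H \<xi> \<xi>s \<omega> \<partial>sphere_measure \<partial>lborel \<partial>lborel)
    = (\<integral>\<^sup>+g. \<integral>\<^sup>+G. \<integral>\<^sup>+\<omega>. H (G + b2 *\<^sub>R g) (G - b1 *\<^sub>R g) \<omega> \<partial>sphere_measure \<partial>lborel \<partial>lborel)"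
  proof (rule nn_integral_center_of_mass)
    show "b1 + b2 = 1" using mass_fractions by (simp add: b1_def b2_def)
    show "(\<lambda>(x, y). \<integral>\<^sup>+\<omega>. H x y \<omega> \<partial>sphere_measure) \<in> borel_measurable borel"
      unfolding borel_prod[symmetric] by measurable
  qed
  also have "\<dots> = (\<integral>\<^sup>+r. indicator {0<..} r * ennreal (r\<^sup>2) *
      (\<integral>\<^sup>+\<eta>. \<integral>\<^sup>+G. \<integral>\<^sup>+\<omega>. H (G + b2 *\<^sub>R (r *\<^sub>R \<eta>)) (G - b1 *\<^sub>R (r *\<^sub>R \<eta>)) \<omega> \<partial>sphere_measure \<partial>lborel \<partial>sphere_measure) \<partial>lborel)"
    by (rule nn_integral_polar) measurable
  also have "\<dots> = (\<integral>\<^sup>+r. \<integral>\<^sup>+\<eta>. \<integral>\<^sup>+G. \<integral>\<^sup>+\<omega>. indicator {0<..} r * ennreal (r\<^sup>2) *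
      H (G + b2 *\<^sub>R (r *\<^sub>R \<eta>)) (G - b1 *\<^sub>R (r *\<^sub>R \<eta>)) \<omega> \<partial>sphere_measure \<partial>lborel \<partial>sphere_measure \<partial>lborel)"
    by (intro nn_integral_cong, subst nn_integral_cmult[symmetric], measurable)
      (intro nn_integral_cong, subst nn_integral_cmult[symmetric], measurable,
        intro nn_integral_cong, subst nn_integral_cmult[symmetric], measurable)
  also have "\<dots> = (\<integral>\<^sup>+r. \<integral>\<^sup>+\<eta>. \<integral>\<^sup>+G. \<integral>\<^sup>+\<omega>. indicator {0<..} r * ennreal (r\<^sup>2) *
      radial_gain F I Is I' Is' \<eta> G \<omega> r \<partial>sphere_measure \<partial>lborel \<partial>sphere_measure \<partial>lborel)"
  proof (rule nn_integral_cong, rule nn_integral_cong_AE)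
    fix r :: real
    show "AE \<eta> in sphere_measure. (\<integral>\<^sup>+G. \<integral>\<^sup>+\<omega>. indicator {0<..} r * ennreal (r\<^sup>2) *
        H (G + b2 *\<^sub>R (r *\<^sub>R \<eta>)) (G - b1 *\<^sub>R (r *\<^sub>R \<eta>)) \<omega> \<partial>sphere_measure \<partial>lborel)
      = (\<integral>\<^sup>+G. \<integral>\<^sup>+\<omega>. indicator {0<..} r * ennreal (r\<^sup>2) * radial_gain F I Is I' Is' \<eta> G \<omega> r \<partial>sphere_measure \<partial>lborel)"
    proof (use AE_sphere_norm in eventually_elim, rule nn_integral_cong, rule nn_integral_cong_AE)
      fix \<eta> G :: "real^3" assume \<eta>: "norm \<eta> = 1"
      show "AE \<omega> in sphere_measure. indicator {0<..} r * ennreal (r\<^sup>2) *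
          H (G + b2 *\<^sub>R (r *\<^sub>R \<eta>)) (G - b1 *\<^sub>R (r *\<^sub>R \<eta>)) \<omega>
        = indicator {0<..} r * ennreal (r\<^sup>2) * radial_gain F I Is I' Is' \<eta> G \<omega> r"
      proof (use AE_sphere_norm in eventually_elim)
        fix \<omega> :: "real^3" assume \<omega>: "norm \<omega> = 1"
        show "indicator {0<..} r * ennreal (r\<^sup>2) * H (G + b2 *\<^sub>R (r *\<^sub>R \<eta>)) (G - b1 *\<^sub>R (r *\<^sub>R \<eta>)) \<omega>
          = indicator {0<..} r * ennreal (r\<^sup>2) * radial_gain F I Is I' Is' \<eta> G \<omega> r"
        proof (cases "0 < r")
          case True
          have cm: "center_vel X \<alpha> \<beta> (G + b2 *\<^sub>R (r *\<^sub>R \<eta>)) (G - b1 *\<^sub>R (r *\<^sub>R \<eta>)) = G"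
            "(G + b2 *\<^sub>R (r *\<^sub>R \<eta>)) - (G - b1 *\<^sub>R (r *\<^sub>R \<eta>)) = r *\<^sub>R \<eta>"
            unfolding b1_def b2_def by (rule center_vel_center_of_mass)+
          have n: "norm (r *\<^sub>R \<eta>) = r" using \<eta> True by simp
          have c: "(r *\<^sub>R \<eta>) \<bullet> \<omega> / r = \<eta> \<bullet> \<omega>" using True by simp
          have "H (G + b2 *\<^sub>R (r *\<^sub>R \<eta>)) (G - b1 *\<^sub>R (r *\<^sub>R \<eta>)) \<omega> = radial_gain F I Is I' Is' \<eta> G \<omega> r"
            unfolding H_def post_vel_def post_vel_s_def coll_weight_def radial_gain_def Let_def cm n c
            using \<omega> by (simp add: b1_def b2_def)
          then show ?thesis by simp
        qed simp
      qed
    qed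
  qed
  also have "\<dots> = (\<integral>\<^sup>+\<eta>. \<integral>\<^sup>+r. \<integral>\<^sup>+G. \<integral>\<^sup>+\<omega>. indicator {0<..} r * ennreal (r\<^sup>2) *
      radial_gain F I Is I' Is' \<eta> G \<omega> r \<partial>sphere_measure \<partial>lborel \<partial>lborel \<partial>sphere_measure)"
    by (intro nn_integral_swap lborel.sigma_finite_measure_axioms sphere.sigma_finite_measure_axioms) measurable
  also have "\<dots> = (\<integral>\<^sup>+\<eta>. \<integral>\<^sup>+G. \<integral>\<^sup>+r. \<integral>\<^sup>+\<omega>. indicator {0<..} r * ennreal (r\<^sup>2) *
      radial_gain F I Is I' Is' \<eta> G \<omega> r \<partial>sphere_measure \<partial>lborel \<partial>lborel \<partial>sphere_measure)"
    by (intro nn_integral_cong nn_integral_swap lborel.sigma_finite_measure_axioms sphere.sigma_finite_measure_axioms) measurable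
  also have "\<dots> = (\<integral>\<^sup>+\<eta>. \<integral>\<^sup>+G. \<integral>\<^sup>+\<omega>. \<integral>\<^sup>+r. indicator {0<..} r * ennreal (r\<^sup>2) *
      radial_gain F I Is I' Is' \<eta> G \<omega> r \<partial>lborel \<partial>sphere_measure \<partial>lborel \<partial>sphere_measure)"
    by (intro nn_integral_cong nn_integral_swap lborel.sigma_finite_measure_axioms sphere.sigma_finite_measure_axioms) measurable
  finally show ?thesis unfolding H_def .
qed

text \<open>
  Reversing a collision exchanges \<open>\<eta>\<close> with \<open>\<omega>\<close> and \<open>r\<close> with the speed \<open>r'\<close> after the collision. Of the weight
  \<open>r\<^sup>2 dr = r \<cdot> (r dr)\<close>, the first factor is converted by microreversibility, the second by \<open>r dr = r' dr'\<close>.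
\<close>

lemma radial_gain_reverse:
  assumes F: "(\<lambda>(x, y, z, w). F x y z w) \<in> borel_measurable borel"
  shows "(\<integral>\<^sup>+r. indicator {0<..} r * ennreal (r\<^sup>2) * radial_gain F I Is I' Is' \<eta> G \<omega> r \<partial>lborel)
    = (\<integral>\<^sup>+r. indicator {0<..} r * ennreal (r\<^sup>2) * radial_gain (\<lambda>x y z w. F z w x y) I' Is' I Is \<omega> G \<eta> r \<partial>lborel)"
proof -
  note [measurable (raw)] = measurable_compose_borel4[OF F] scat_measurable[OF sp]
  define b1 where "b1 = mass X \<alpha> / (mass X \<alpha> + mass X \<beta>)"
  define b2 where "b2 = mass X \<beta> / (mass X \<alpha> + mass X \<beta>)"
  define d where "d = 2 * energy_gap I Is I' Is' / red_mass X \<alpha> \<beta>"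
  have d': "2 * energy_gap I' Is' I Is / red_mass X \<alpha> \<beta> = - d"
    by (simp add: d_def energy_gap_reverse[of I'])
  define \<Phi> where "\<Phi> r r' = F (G + (b2 * r) *\<^sub>R \<eta>) (G - (b1 * r) *\<^sub>R \<eta>) (G + (b2 * r') *\<^sub>R \<omega>) (G - (b1 * r') *\<^sub>R \<omega>)
     * ennreal (r' / 2 * scat X \<alpha> \<beta> r' (\<eta> \<bullet> \<omega>) I' Is' I Is)" for r r'
  have "(\<integral>\<^sup>+r. indicator {0<..} r * ennreal (r\<^sup>2) * radial_gain F I Is I' Is' \<eta> G \<omega> r \<partial>lborel)
     = (\<integral>\<^sup>+r. (if 0 < r \<and> d < r\<^sup>2 then ennreal (2 * r) * \<Phi> r (sqrt (r\<^sup>2 - d)) else 0) \<partial>lborel)"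
  proof (rule nn_integral_cong)
    fix r :: real
    show "indicator {0<..} r * ennreal (r\<^sup>2) * radial_gain F I Is I' Is' \<eta> G \<omega> r
      = (if 0 < r \<and> d < r\<^sup>2 then ennreal (2 * r) * \<Phi> r (sqrt (r\<^sup>2 - d)) else 0)"
    proof (cases "0 < r \<and> d < r\<^sup>2")
      case True
      then have r: "0 < r" "2 * energy_gap I Is I' Is' / red_mass X \<alpha> \<beta> < r\<^sup>2" by (simp_all add: d_def)
      have p: "post_speed X \<alpha> \<beta> r I Is I' Is' = sqrt (r\<^sup>2 - d)"
        using post_speed_facts(1)[OF sp r] by (simp add: d_def)
      let ?s = "scat X \<alpha> \<beta> r (\<eta> \<bullet> \<omega>) I Is I' Is'"
      let ?s' = "scat X \<alpha> \<beta> (sqrt (r\<^sup>2 - d)) (\<eta> \<bullet> \<omega>) I' Is' I Is"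
      have "ennreal (r\<^sup>2) * ennreal ?s = ennreal (r * (r * ?s))"
        by (subst ennreal_mult'[symmetric]) (simp_all add: power2_eq_square mult.assoc)
      also have "r * ?s = sqrt (r\<^sup>2 - d) * ?s'"
        using scat_reverse[OF sp r] unfolding p .
      also have "r * (sqrt (r\<^sup>2 - d) * ?s') = 2 * r * (sqrt (r\<^sup>2 - d) / 2 * ?s')" by simp
      also have "ennreal \<dots> = ennreal (2 * r) * ennreal (sqrt (r\<^sup>2 - d) / 2 * ?s')"
        using r by (subst ennreal_mult') simp_all
      finally have w: "ennreal (r\<^sup>2) * ennreal ?s = ennreal (2 * r) * ennreal (sqrt (r\<^sup>2 - d) / 2 * ?s')" .
      have "indicator {0<..} r * ennreal (r\<^sup>2) * radial_gain F I Is I' Is' \<eta> G \<omega> r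
        = F (G + (b2 * r) *\<^sub>R \<eta>) (G - (b1 * r) *\<^sub>R \<eta>) (G + (b2 * sqrt (r\<^sup>2 - d)) *\<^sub>R \<omega>) (G - (b1 * sqrt (r\<^sup>2 - d)) *\<^sub>R \<omega>)
          * (ennreal (r\<^sup>2) * ennreal ?s)"
        using r unfolding radial_gain_def Let_def p b1_def[symmetric] b2_def[symmetric] by (simp add: mult_ac)
      also have "\<dots> = ennreal (2 * r) * \<Phi> r (sqrt (r\<^sup>2 - d))"
        unfolding w \<Phi>_def by (simp only: mult_ac)
      finally show ?thesis using True by simp
    next
      case False
      then have "radial_gain F I Is I' Is' \<eta> G \<omega> r = 0"
        using scat_eq_0[OF sp, of r I Is I' Is'] by (simp add: radial_gain_def d_def)
      then show ?thesis using False by auto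
    qed
  qed
  also have "\<dots> = (\<integral>\<^sup>+s. (if 0 < s \<and> - d < s\<^sup>2 then ennreal (2 * s) * \<Phi> (sqrt (s\<^sup>2 + d)) s else 0) \<partial>lborel)"
    by (rule nn_integral_relative_speed) (unfold \<Phi>_def, measurable)
  also have "\<dots> = (\<integral>\<^sup>+r. indicator {0<..} r * ennreal (r\<^sup>2) * radial_gain (\<lambda>x y z w. F z w x y) I' Is' I Is \<omega> G \<eta> r \<partial>lborel)"
  proof (rule nn_integral_cong)
    fix s :: real
    show "(if 0 < s \<and> - d < s\<^sup>2 then ennreal (2 * s) * \<Phi> (sqrt (s\<^sup>2 + d)) s else 0)
      = indicator {0<..} s * ennreal (s\<^sup>2) * radial_gain (\<lambda>x y z w. F z w x y) I' Is' I Is \<omega> G \<eta> s"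
    proof (cases "0 < s \<and> - d < s\<^sup>2")
      case True
      then have s: "0 < s" "2 * energy_gap I' Is' I Is / red_mass X \<alpha> \<beta> < s\<^sup>2" by (simp_all add: d')
      have p: "post_speed X \<alpha> \<beta> s I' Is' I Is = sqrt (s\<^sup>2 + d)"
        using post_speed_facts(1)[OF sp s] by (simp add: d')
      let ?s = "scat X \<alpha> \<beta> s (\<eta> \<bullet> \<omega>) I' Is' I Is"
      have "ennreal (2 * s) * ennreal (s / 2 * ?s) = ennreal (2 * s * (s / 2 * ?s))"
        using s by (subst ennreal_mult') simp_all
      also have "2 * s * (s / 2 * ?s) = s\<^sup>2 * ?s" by (simp add: power2_eq_square)
      also have "ennreal \<dots> = ennreal (s\<^sup>2) * ennreal ?s" by (rule ennreal_mult') simp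
      finally have w: "ennreal (2 * s) * ennreal (s / 2 * ?s) = ennreal (s\<^sup>2) * ennreal ?s" .
      have "ennreal (2 * s) * \<Phi> (sqrt (s\<^sup>2 + d)) s
         = F (G + (b2 * sqrt (s\<^sup>2 + d)) *\<^sub>R \<eta>) (G - (b1 * sqrt (s\<^sup>2 + d)) *\<^sub>R \<eta>) (G + (b2 * s) *\<^sub>R \<omega>) (G - (b1 * s) *\<^sub>R \<omega>)
           * (ennreal (2 * s) * ennreal (s / 2 * ?s))"
        unfolding \<Phi>_def by (simp only: mult_ac)
      also have "\<dots> = indicator {0<..} s * ennreal (s\<^sup>2) * radial_gain (\<lambda>x y z w. F z w x y) I' Is' I Is \<omega> G \<eta> s"
        using s unfolding w radial_gain_def Let_def p b1_def[symmetric] b2_def[symmetric]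
        by (simp add: mult_ac inner_commute)
      finally show ?thesis using True by simp
    next
      case False
      then have "radial_gain (\<lambda>x y z w. F z w x y) I' Is' I Is \<omega> G \<eta> s = 0"
        using scat_eq_0[OF sp, of s I' Is' I Is] by (simp add: radial_gain_def d')
      then show ?thesis using False by auto
    qed
  qed
  finally show ?thesis .
qed

text \<open>
  In center of mass coordinates the two sides differ by the names of the two directions, which are
  integrated against the same measure.
\<close>

lemma velocity_integral_reverse:
  assumes F: "(\<lambda>(x, y, z, w). F x y z w) \<in> borel_measurable borel"
  shows "(\<integral>\<^sup>+\<xi>. \<integral>\<^sup>+\<xi>s. \<integral>\<^sup>+\<omega>. F \<xi> \<xi>s (post_vel X \<alpha> \<beta> \<xi> \<xi>s I Is I' Is' \<omega>) (post_vel_s X \<alpha> \<beta> \<xi> \<xi>s I Is I' Is' \<omega>)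
       * ennreal (coll_weight X \<alpha> \<beta> \<xi> \<xi>s I Is I' Is' \<omega>) \<partial>sphere_measure \<partial>lborel \<partial>lborel)
    = (\<integral>\<^sup>+\<xi>. \<integral>\<^sup>+\<xi>s. \<integral>\<^sup>+\<omega>. F (post_vel X \<alpha> \<beta> \<xi> \<xi>s I' Is' I Is \<omega>) (post_vel_s X \<alpha> \<beta> \<xi> \<xi>s I' Is' I Is \<omega>) \<xi> \<xi>s
       * ennreal (coll_weight X \<alpha> \<beta> \<xi> \<xi>s I' Is' I Is \<omega>) \<partial>sphere_measure \<partial>lborel \<partial>lborel)"
proof -
  define F' where "F' = (\<lambda>x y z w. F z w x y)"
  note [measurable (raw)] = measurable_compose_borel4[OF F]
  have F': "(\<lambda>(x, y, z, w). F' x y z w) \<in> borel_measurable borel"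
    unfolding F'_def case_prod_beta by measurable
  note [measurable (raw)] = radial_gain_measurable[OF F']
  have "(\<integral>\<^sup>+\<eta>. \<integral>\<^sup>+G. \<integral>\<^sup>+\<omega>. \<integral>\<^sup>+r. indicator {0<..} r * ennreal (r\<^sup>2) * radial_gain F I Is I' Is' \<eta> G \<omega> r
       \<partial>lborel \<partial>sphere_measure \<partial>lborel \<partial>sphere_measure)
     = (\<integral>\<^sup>+\<eta>. \<integral>\<^sup>+G. \<integral>\<^sup>+\<omega>. \<integral>\<^sup>+r. indicator {0<..} r * ennreal (r\<^sup>2) * radial_gain F' I' Is' I Is \<omega> G \<eta> r
       \<partial>lborel \<partial>sphere_measure \<partial>lborel \<partial>sphere_measure)"
    unfolding radial_gain_reverse[OF F] F'_def ..
  also have "\<dots> = (\<integral>\<^sup>+\<omega>. \<integral>\<^sup>+G. \<integral>\<^sup>+\<eta>. \<integral>\<^sup>+r. indicator {0<..} r * ennreal (r\<^sup>2) * radial_gain F' I' Is' I Is \<omega> G \<eta> r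
       \<partial>lborel \<partial>sphere_measure \<partial>lborel \<partial>sphere_measure)"
    by (rule nn_integral_reverse3) (auto simp: lborel.sigma_finite_measure_axioms sphere.sigma_finite_measure_axioms)
  finally show ?thesis
    unfolding velocity_integral_polar[OF F] velocity_integral_polar[OF F', unfolded F'_def] F'_def .
qed

end

end

section \<open>Symmetries of the collision measure\<close>

lemma measurable_compose_borel7:
  fixes F :: "'a::second_countable_topology \<Rightarrow> 'b::second_countable_topology \<Rightarrow> 'c::second_countable_topology
    \<Rightarrow> 'd::second_countable_topology \<Rightarrow> 'e::second_countable_topology \<Rightarrow> 'f::second_countable_topology
    \<Rightarrow> 'g::second_countable_topology \<Rightarrow> 'h::topological_space"
  assumes "(\<lambda>(x1, x2, x3, x4, x5, x6, x7). F x1 x2 x3 x4 x5 x6 x7) \<in> borel_measurable borel"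
    and "a1 \<in> borel_measurable M" "a2 \<in> borel_measurable M" "a3 \<in> borel_measurable M" "a4 \<in> borel_measurable M"
    "a5 \<in> borel_measurable M" "a6 \<in> borel_measurable M" "a7 \<in> borel_measurable M"
  shows "(\<lambda>x. F (a1 x) (a2 x) (a3 x) (a4 x) (a5 x) (a6 x) (a7 x)) \<in> borel_measurable M"
  using measurable_compose[OF borel_measurable_Pair[OF assms(2) borel_measurable_Pair[OF assms(3)
      borel_measurable_Pair[OF assms(4) borel_measurable_Pair[OF assms(5) borel_measurable_Pair[OF assms(6)
      borel_measurable_Pair[OF assms(7,8)]]]]]] assms(1)] by simp

text \<open>
  Brings all internal energies to the outside, where they are parameters of the velocity integrals.
\<close>

lemma internal_energies_outside:
  fixes f :: "real^3 \<Rightarrow> real \<Rightarrow> real^3 \<Rightarrow> real \<Rightarrow> real \<Rightarrow> real \<Rightarrow> real^3 \<Rightarrow> ennreal"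
    and X :: mixture and \<alpha> \<beta> :: nat
  assumes f: "(\<lambda>(\<xi>, I, \<xi>s, Is, I', Is', \<omega>). f \<xi> I \<xi>s Is I' Is' \<omega>) \<in> borel_measurable borel"
  defines "A \<equiv> internal_measure X \<alpha>" and "B \<equiv> internal_measure X \<beta>" and "V \<equiv> (lborel :: (real^3) measure)"
    and "S \<equiv> sphere_measure"
  shows "(\<integral>\<^sup>+\<xi>. \<integral>\<^sup>+I. \<integral>\<^sup>+\<xi>s. \<integral>\<^sup>+Is. \<integral>\<^sup>+I'. \<integral>\<^sup>+Is'. \<integral>\<^sup>+\<omega>. f \<xi> I \<xi>s Is I' Is' \<omega> \<partial>S \<partial>B \<partial>A \<partial>B \<partial>V \<partial>A \<partial>V)
    = (\<integral>\<^sup>+I. \<integral>\<^sup>+Is. \<integral>\<^sup>+I'. \<integral>\<^sup>+Is'. \<integral>\<^sup>+\<xi>. \<integral>\<^sup>+\<xi>s. \<integral>\<^sup>+\<omega>. f \<xi> I \<xi>s Is I' Is' \<omega> \<partial>S \<partial>V \<partial>V \<partial>B \<partial>A \<partial>B \<partial>A)"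
proof -
  note [measurable (raw)] = measurable_compose_borel7[OF f]
  note sf = lborel.sigma_finite_measure_axioms internal.sigma_finite_measure_axioms
  note defs = A_def B_def V_def S_def
  have "(\<integral>\<^sup>+\<xi>. \<integral>\<^sup>+I. \<integral>\<^sup>+\<xi>s. \<integral>\<^sup>+Is. \<integral>\<^sup>+I'. \<integral>\<^sup>+Is'. \<integral>\<^sup>+\<omega>. f \<xi> I \<xi>s Is I' Is' \<omega> \<partial>S \<partial>B \<partial>A \<partial>B \<partial>V \<partial>A \<partial>V)
     = (\<integral>\<^sup>+\<xi>. \<integral>\<^sup>+I. \<integral>\<^sup>+Is. \<integral>\<^sup>+\<xi>s. \<integral>\<^sup>+I'. \<integral>\<^sup>+Is'. \<integral>\<^sup>+\<omega>. f \<xi> I \<xi>s Is I' Is' \<omega> \<partial>S \<partial>B \<partial>A \<partial>V \<partial>B \<partial>A \<partial>V)"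
    unfolding defs by (rule nn_integral_cong, rule nn_integral_cong, rule nn_integral_swap[OF sf]) measurable
  also have "\<dots> = (\<integral>\<^sup>+\<xi>. \<integral>\<^sup>+I. \<integral>\<^sup>+Is. \<integral>\<^sup>+I'. \<integral>\<^sup>+\<xi>s. \<integral>\<^sup>+Is'. \<integral>\<^sup>+\<omega>. f \<xi> I \<xi>s Is I' Is' \<omega> \<partial>S \<partial>B \<partial>V \<partial>A \<partial>B \<partial>A \<partial>V)"
    unfolding defs by (rule nn_integral_cong, rule nn_integral_cong, rule nn_integral_cong, rule nn_integral_swap[OF sf]) measurable
  also have "\<dots> = (\<integral>\<^sup>+\<xi>. \<integral>\<^sup>+I. \<integral>\<^sup>+Is. \<integral>\<^sup>+I'. \<integral>\<^sup>+Is'. \<integral>\<^sup>+\<xi>s. \<integral>\<^sup>+\<omega>. f \<xi> I \<xi>s Is I' Is' \<omega> \<partial>S \<partial>V \<partial>B \<partial>A \<partial>B \<partial>A \<partial>V)"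
    unfolding defs by (rule nn_integral_cong, rule nn_integral_cong, rule nn_integral_cong, rule nn_integral_cong, rule nn_integral_swap[OF sf]) measurable
  also have "\<dots> = (\<integral>\<^sup>+I. \<integral>\<^sup>+\<xi>. \<integral>\<^sup>+Is. \<integral>\<^sup>+I'. \<integral>\<^sup>+Is'. \<integral>\<^sup>+\<xi>s. \<integral>\<^sup>+\<omega>. f \<xi> I \<xi>s Is I' Is' \<omega> \<partial>S \<partial>V \<partial>B \<partial>A \<partial>B \<partial>V \<partial>A)"
    unfolding defs by (rule nn_integral_swap[OF sf]) measurable
  also have "\<dots> = (\<integral>\<^sup>+I. \<integral>\<^sup>+Is. \<integral>\<^sup>+\<xi>. \<integral>\<^sup>+I'. \<integral>\<^sup>+Is'. \<integral>\<^sup>+\<xi>s. \<integral>\<^sup>+\<omega>. f \<xi> I \<xi>s Is I' Is' \<omega> \<partial>S \<partial>V \<partial>B \<partial>A \<partial>V \<partial>B \<partial>A)"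
    unfolding defs by (rule nn_integral_cong, rule nn_integral_swap[OF sf]) measurable
  also have "\<dots> = (\<integral>\<^sup>+I. \<integral>\<^sup>+Is. \<integral>\<^sup>+I'. \<integral>\<^sup>+\<xi>. \<integral>\<^sup>+Is'. \<integral>\<^sup>+\<xi>s. \<integral>\<^sup>+\<omega>. f \<xi> I \<xi>s Is I' Is' \<omega> \<partial>S \<partial>V \<partial>B \<partial>V \<partial>A \<partial>B \<partial>A)"
    unfolding defs by (rule nn_integral_cong, rule nn_integral_cong, rule nn_integral_swap[OF sf]) measurable
  also have "\<dots> = (\<integral>\<^sup>+I. \<integral>\<^sup>+Is. \<integral>\<^sup>+I'. \<integral>\<^sup>+Is'. \<integral>\<^sup>+\<xi>. \<integral>\<^sup>+\<xi>s. \<integral>\<^sup>+\<omega>. f \<xi> I \<xi>s Is I' Is' \<omega> \<partial>S \<partial>V \<partial>V \<partial>B \<partial>A \<partial>B \<partial>A)"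
    unfolding defs by (rule nn_integral_cong, rule nn_integral_cong, rule nn_integral_cong, rule nn_integral_swap[OF sf]) measurable
  finally show ?thesis .
qed

text \<open>
  The two symmetries of a collision: exchange of the states before and after it, and exchange of the two
  particles.
\<close>

definition reverse_event :: "collision \<Rightarrow> collision" where
  "reverse_event = (\<lambda>(z, zs, z', zs'). (z', zs', z, zs))"

definition swap_event :: "collision \<Rightarrow> collision" where
  "swap_event = (\<lambda>(z, zs, z', zs'). (zs, z, zs', z'))"

lemma event_maps_measurable [measurable]:
  "reverse_event \<in> borel_measurable borel" "swap_event \<in> borel_measurable borel"
  unfolding reverse_event_def swap_event_def case_prod_beta by measurable

context gas_mixture
begin

context
  fixes \<alpha> \<beta> assumes sp: "\<alpha> \<in> species X" "\<beta> \<in> species X"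
begin

lemma event_weight_measurable [measurable]: "event_weight X \<alpha> \<beta> \<in> borel_measurable borel"
proof -
  note [measurable (raw)] = coll_weight_measurable[OF sp]
  show ?thesis
    by (subst measurable_cong[OF arg_cong[OF event_split, of "event_weight X \<alpha> \<beta>"]])
      (simp only: event_weight.simps, measurable)
qed

lemma nn_integral_collision_law:
  assumes F[measurable]: "F \<in> borel_measurable borel"
  shows "(\<integral>\<^sup>+x. F x \<partial>collision_law X \<alpha> \<beta>) =
    (\<integral>\<^sup>+z. \<integral>\<^sup>+c. F (coll_event X \<alpha> \<beta> (z, c)) * ennreal (event_weight X \<alpha> \<beta> (z, c)) \<partial>coll_measure X \<alpha> \<beta> \<partial>phase X \<alpha>)"
proof -
  have "(\<integral>\<^sup>+x. F x \<partial>collision_law X \<alpha> \<beta>)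
    = (\<integral>\<^sup>+x. F (coll_event X \<alpha> \<beta> x) \<partial>density (phase X \<alpha> \<Otimes>\<^sub>M coll_measure X \<alpha> \<beta>) (\<lambda>x. ennreal (event_weight X \<alpha> \<beta> x)))"
    unfolding collision_law_def by (rule nn_integral_distr) measurable
  also have "\<dots> = (\<integral>\<^sup>+x. ennreal (event_weight X \<alpha> \<beta> x) * F (coll_event X \<alpha> \<beta> x) \<partial>(phase X \<alpha> \<Otimes>\<^sub>M coll_measure X \<alpha> \<beta>))"
    by (rule nn_integral_density) measurable
  also have "\<dots> = (\<integral>\<^sup>+x. F (coll_event X \<alpha> \<beta> x) * ennreal (event_weight X \<alpha> \<beta> x) \<partial>(phase X \<alpha> \<Otimes>\<^sub>M coll_measure X \<alpha> \<beta>))"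
    by (simp only: mult.commute)
  also have "\<dots> = (\<integral>\<^sup>+z. \<integral>\<^sup>+c. F (coll_event X \<alpha> \<beta> (z, c)) * ennreal (event_weight X \<alpha> \<beta> (z, c)) \<partial>coll_measure X \<alpha> \<beta> \<partial>phase X \<alpha>)"
    by (rule coll.nn_integral_fst[symmetric]) measurable
  finally show ?thesis .
qed

lemma nn_integral_collision_law_iterated:
  assumes F[measurable]: "F \<in> borel_measurable borel"
  shows "(\<integral>\<^sup>+x. F x \<partial>collision_law X \<alpha> \<beta>) =
    (\<integral>\<^sup>+I. \<integral>\<^sup>+Is. \<integral>\<^sup>+I'. \<integral>\<^sup>+Is'. \<integral>\<^sup>+\<xi>. \<integral>\<^sup>+\<xi>s. \<integral>\<^sup>+\<omega>.
       F ((\<xi>, I), (\<xi>s, Is), (post_vel X \<alpha> \<beta> \<xi> \<xi>s I Is I' Is' \<omega>, I'), (post_vel_s X \<alpha> \<beta> \<xi> \<xi>s I Is I' Is' \<omega>, Is'))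
       * ennreal (coll_weight X \<alpha> \<beta> \<xi> \<xi>s I Is I' Is' \<omega>)
     \<partial>sphere_measure \<partial>lborel \<partial>lborel \<partial>internal_measure X \<beta> \<partial>internal_measure X \<alpha> \<partial>internal_measure X \<beta> \<partial>internal_measure X \<alpha>)"
proof -
  note [measurable (raw)] = coll_weight_measurable[OF sp] measurable_compose[OF _ F]
  have G: "(\<lambda>c. F (coll_event X \<alpha> \<beta> (z, c)) * ennreal (event_weight X \<alpha> \<beta> (z, c))) \<in> borel_measurable borel" for z
    by measurable
  have "(\<integral>\<^sup>+x. F x \<partial>collision_law X \<alpha> \<beta>) = (\<integral>\<^sup>+\<xi>. \<integral>\<^sup>+I. \<integral>\<^sup>+\<xi>s. \<integral>\<^sup>+Is. \<integral>\<^sup>+I'. \<integral>\<^sup>+Is'. \<integral>\<^sup>+\<omega>.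
       F ((\<xi>, I), (\<xi>s, Is), (post_vel X \<alpha> \<beta> \<xi> \<xi>s I Is I' Is' \<omega>, I'), (post_vel_s X \<alpha> \<beta> \<xi> \<xi>s I Is I' Is' \<omega>, Is'))
       * ennreal (coll_weight X \<alpha> \<beta> \<xi> \<xi>s I Is I' Is' \<omega>)
     \<partial>sphere_measure \<partial>internal_measure X \<beta> \<partial>internal_measure X \<alpha> \<partial>internal_measure X \<beta> \<partial>lborel \<partial>internal_measure X \<alpha> \<partial>lborel)"
    unfolding nn_integral_collision_law[OF F]
    by (subst nn_integral_phase, rule coll.borel_measurable_nn_integral, measurable)
      (subst nn_integral_coll_measure[OF G], simp)
  also have "\<dots> = (\<integral>\<^sup>+I. \<integral>\<^sup>+Is. \<integral>\<^sup>+I'. \<integral>\<^sup>+Is'. \<integral>\<^sup>+\<xi>. \<integral>\<^sup>+\<xi>s. \<integral>\<^sup>+\<omega>.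
       F ((\<xi>, I), (\<xi>s, Is), (post_vel X \<alpha> \<beta> \<xi> \<xi>s I Is I' Is' \<omega>, I'), (post_vel_s X \<alpha> \<beta> \<xi> \<xi>s I Is I' Is' \<omega>, Is'))
       * ennreal (coll_weight X \<alpha> \<beta> \<xi> \<xi>s I Is I' Is' \<omega>)
     \<partial>sphere_measure \<partial>lborel \<partial>lborel \<partial>internal_measure X \<beta> \<partial>internal_measure X \<alpha> \<partial>internal_measure X \<beta> \<partial>internal_measure X \<alpha>)"
    by (rule internal_energies_outside) (unfold case_prod_beta, measurable)
  finally show ?thesis .
qed

end

lemma collision_law_eqI:
  assumes T: "T \<in> borel_measurable borel"
    and "\<And>F :: collision \<Rightarrow> ennreal. F \<in> borel_measurable borel \<Longrightarrow>
      (\<integral>\<^sup>+x. F (T x) \<partial>collision_law X \<alpha> \<beta>) = (\<integral>\<^sup>+x. F x \<partial>collision_law X \<alpha>' \<beta>')"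
  shows "distr (collision_law X \<alpha> \<beta>) borel T = collision_law X \<alpha>' \<beta>'"
proof (rule measure_eqI)
  fix A :: "collision set" assume "A \<in> sets (distr (collision_law X \<alpha> \<beta>) borel T)"
  then have A[measurable]: "A \<in> sets borel" by simp
  have T': "T \<in> measurable (collision_law X \<alpha> \<beta>) borel"
    unfolding measurable_cong_sets[OF sets_collision_law refl] by (rule T)
  have "emeasure (distr (collision_law X \<alpha> \<beta>) borel T) A = (\<integral>\<^sup>+x. indicator A x \<partial>distr (collision_law X \<alpha> \<beta>) borel T)"
    by (rule nn_integral_indicator[symmetric]) simp
  also have "\<dots> = (\<integral>\<^sup>+x. indicator A (T x) \<partial>collision_law X \<alpha> \<beta>)"
    by (rule nn_integral_distr[OF T']) simp
  also have "\<dots> = (\<integral>\<^sup>+x. indicator A x \<partial>collision_law X \<alpha>' \<beta>')"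
    by (rule assms(2)) simp
  also have "\<dots> = emeasure (collision_law X \<alpha>' \<beta>') A" by (rule nn_integral_indicator) simp
  finally show "emeasure (distr (collision_law X \<alpha> \<beta>) borel T) A = emeasure (collision_law X \<alpha>' \<beta>') A" .
qed simp

lemma collision_law_reverse:
  assumes sp: "\<alpha> \<in> species X" "\<beta> \<in> species X"
  shows "distr (collision_law X \<alpha> \<beta>) borel reverse_event = collision_law X \<alpha> \<beta>"
proof (rule collision_law_eqI)
  fix F :: "collision \<Rightarrow> ennreal" assume F: "F \<in> borel_measurable borel"
  note [measurable (raw)] = coll_weight_measurable[OF sp] measurable_compose[OF _ F]
  let ?A = "internal_measure X \<alpha>" and ?B = "internal_measure X \<beta>"
  define h where "h I Is I' Is' = (\<integral>\<^sup>+\<xi>. \<integral>\<^sup>+\<xi>s. \<integral>\<^sup>+\<omega>.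
       F ((\<xi>, I), (\<xi>s, Is), (post_vel X \<alpha> \<beta> \<xi> \<xi>s I Is I' Is' \<omega>, I'), (post_vel_s X \<alpha> \<beta> \<xi> \<xi>s I Is I' Is' \<omega>, Is'))
       * ennreal (coll_weight X \<alpha> \<beta> \<xi> \<xi>s I Is I' Is' \<omega>) \<partial>sphere_measure \<partial>lborel \<partial>lborel)" for I Is I' Is'
  have hm4: "(\<lambda>(a, b, c, d). h a b c d) \<in> borel_measurable borel"
    unfolding h_def case_prod_beta by measurable
  note [measurable (raw)] = measurable_compose_borel4[OF hm4]
  note sf = internal.sigma_finite_measure_axioms
  have "(\<integral>\<^sup>+x. F (reverse_event x) \<partial>collision_law X \<alpha> \<beta>)
     = (\<integral>\<^sup>+I. \<integral>\<^sup>+Is. \<integral>\<^sup>+I'. \<integral>\<^sup>+Is'. h I' Is' I Is \<partial>?B \<partial>?A \<partial>?B \<partial>?A)"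
  proof (subst nn_integral_collision_law_iterated[OF sp])
    show "(\<lambda>x. F (reverse_event x)) \<in> borel_measurable borel" by measurable
    have "(\<integral>\<^sup>+\<xi>. \<integral>\<^sup>+\<xi>s. \<integral>\<^sup>+\<omega>.
       F ((post_vel X \<alpha> \<beta> \<xi> \<xi>s I Is I' Is' \<omega>, I'), (post_vel_s X \<alpha> \<beta> \<xi> \<xi>s I Is I' Is' \<omega>, Is'), (\<xi>, I), (\<xi>s, Is))
       * ennreal (coll_weight X \<alpha> \<beta> \<xi> \<xi>s I Is I' Is' \<omega>) \<partial>sphere_measure \<partial>lborel \<partial>lborel) = h I' Is' I Is"
      for I Is I' Is'
      unfolding h_def
      by (rule velocity_integral_reverse[OF sp, of "\<lambda>x y z w. F ((z, I'), (w, Is'), (x, I), (y, Is))"])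
        (unfold case_prod_beta, measurable)
    then show "(\<integral>\<^sup>+I. \<integral>\<^sup>+Is. \<integral>\<^sup>+I'. \<integral>\<^sup>+Is'. \<integral>\<^sup>+\<xi>. \<integral>\<^sup>+\<xi>s. \<integral>\<^sup>+\<omega>.
       F (reverse_event ((\<xi>, I), (\<xi>s, Is), (post_vel X \<alpha> \<beta> \<xi> \<xi>s I Is I' Is' \<omega>, I'), (post_vel_s X \<alpha> \<beta> \<xi> \<xi>s I Is I' Is' \<omega>, Is')))
       * ennreal (coll_weight X \<alpha> \<beta> \<xi> \<xi>s I Is I' Is' \<omega>)
     \<partial>sphere_measure \<partial>lborel \<partial>lborel \<partial>?B \<partial>?A \<partial>?B \<partial>?A) = (\<integral>\<^sup>+I. \<integral>\<^sup>+Is. \<integral>\<^sup>+I'. \<integral>\<^sup>+Is'. h I' Is' I Is \<partial>?B \<partial>?A \<partial>?B \<partial>?A)"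
      unfolding reverse_event_def by (simp only: prod.case)
  qed
  also have "\<dots> = (\<integral>\<^sup>+I. \<integral>\<^sup>+I'. \<integral>\<^sup>+Is. \<integral>\<^sup>+Is'. h I' Is' I Is \<partial>?B \<partial>?B \<partial>?A \<partial>?A)"
    by (rule nn_integral_cong, rule nn_integral_swap[OF sf sf]) measurable
  also have "\<dots> = (\<integral>\<^sup>+I'. \<integral>\<^sup>+I. \<integral>\<^sup>+Is. \<integral>\<^sup>+Is'. h I' Is' I Is \<partial>?B \<partial>?B \<partial>?A \<partial>?A)"
    by (rule nn_integral_swap[OF sf sf]) measurable
  also have "\<dots> = (\<integral>\<^sup>+I'. \<integral>\<^sup>+I. \<integral>\<^sup>+Is'. \<integral>\<^sup>+Is. h I' Is' I Is \<partial>?B \<partial>?B \<partial>?A \<partial>?A)"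
    by (rule nn_integral_cong, rule nn_integral_cong, rule nn_integral_swap[OF sf sf]) measurable
  also have "\<dots> = (\<integral>\<^sup>+I'. \<integral>\<^sup>+Is'. \<integral>\<^sup>+I. \<integral>\<^sup>+Is. h I' Is' I Is \<partial>?B \<partial>?A \<partial>?B \<partial>?A)"
    by (rule nn_integral_cong, rule nn_integral_swap[OF sf sf]) measurable
  also have "\<dots> = (\<integral>\<^sup>+x. F x \<partial>collision_law X \<alpha> \<beta>)"
    unfolding nn_integral_collision_law_iterated[OF sp F] h_def ..
  finally show "(\<integral>\<^sup>+x. F (reverse_event x) \<partial>collision_law X \<alpha> \<beta>) = (\<integral>\<^sup>+x. F x \<partial>collision_law X \<alpha> \<beta>)" .
qed measurable

text \<open>
  Exchanging the particles reverses the relative velocities before and after the collision, so \<open>\<omega>\<close> becomes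
  \<open>- \<omega>\<close> and the scattering angle is unchanged.
\<close>

lemma collision_law_swap:
  assumes sp: "\<alpha> \<in> species X" "\<beta> \<in> species X"
  shows "distr (collision_law X \<alpha> \<beta>) borel swap_event = collision_law X \<beta> \<alpha>"
proof (rule collision_law_eqI)
  fix F :: "collision \<Rightarrow> ennreal" assume F: "F \<in> borel_measurable borel"
  note [measurable (raw)] = coll_weight_measurable[OF sp] coll_weight_measurable[OF sp(2,1)] measurable_compose[OF _ F]
  let ?A = "internal_measure X \<alpha>" and ?B = "internal_measure X \<beta>"
  define h where "h Is I Is' I' = (\<integral>\<^sup>+\<xi>s. \<integral>\<^sup>+\<xi>. \<integral>\<^sup>+\<omega>.
       F ((\<xi>s, Is), (\<xi>, I), (post_vel X \<beta> \<alpha> \<xi>s \<xi> Is I Is' I' \<omega>, Is'), (post_vel_s X \<beta> \<alpha> \<xi>s \<xi> Is I Is' I' \<omega>, I'))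
       * ennreal (coll_weight X \<beta> \<alpha> \<xi>s \<xi> Is I Is' I' \<omega>) \<partial>sphere_measure \<partial>lborel \<partial>lborel)" for I Is I' Is'
  have hm4: "(\<lambda>(a, b, c, d). h a b c d) \<in> borel_measurable borel"
    unfolding h_def case_prod_beta by measurable
  note [measurable (raw)] = measurable_compose_borel4[OF hm4]
  note sf = internal.sigma_finite_measure_axioms
  have core: "(\<integral>\<^sup>+\<xi>. \<integral>\<^sup>+\<xi>s. \<integral>\<^sup>+\<omega>.
       F ((\<xi>s, Is), (\<xi>, I), (post_vel_s X \<alpha> \<beta> \<xi> \<xi>s I Is I' Is' \<omega>, Is'), (post_vel X \<alpha> \<beta> \<xi> \<xi>s I Is I' Is' \<omega>, I'))
       * ennreal (coll_weight X \<alpha> \<beta> \<xi> \<xi>s I Is I' Is' \<omega>) \<partial>sphere_measure \<partial>lborel \<partial>lborel) = h Is I Is' I'"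
    (is "?L = _") for I Is I' Is'
  proof -
    define g where "g \<xi>s \<xi> \<omega> = F ((\<xi>s, Is), (\<xi>, I), (post_vel X \<beta> \<alpha> \<xi>s \<xi> Is I Is' I' \<omega>, Is'), (post_vel_s X \<beta> \<alpha> \<xi>s \<xi> Is I Is' I' \<omega>, I'))
       * ennreal (coll_weight X \<beta> \<alpha> \<xi>s \<xi> Is I Is' I' \<omega>)" for \<xi>s \<xi> \<omega>
    have gm: "(\<lambda>(x, y, z). g x y z) \<in> borel_measurable (borel \<Otimes>\<^sub>M (borel \<Otimes>\<^sub>M borel))"
      unfolding g_def case_prod_beta by measurable
    note [measurable (raw)] = measurable_compose3[OF gm]
    have "?L = (\<integral>\<^sup>+\<xi>. \<integral>\<^sup>+\<xi>s. \<integral>\<^sup>+\<omega>. g \<xi>s \<xi> (- \<omega>) \<partial>sphere_measure \<partial>lborel \<partial>lborel)"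
      unfolding g_def post_vel_swap coll_weight_swap[OF sp] ..
    also have "\<dots> = (\<integral>\<^sup>+\<xi>. \<integral>\<^sup>+\<xi>s. \<integral>\<^sup>+\<omega>. g \<xi>s \<xi> \<omega> \<partial>sphere_measure \<partial>lborel \<partial>lborel)"
      by (rule nn_integral_cong, rule nn_integral_cong, rule nn_integral_sphere_uminus) measurable
    also have "\<dots> = (\<integral>\<^sup>+\<xi>s. \<integral>\<^sup>+\<xi>. \<integral>\<^sup>+\<omega>. g \<xi>s \<xi> \<omega> \<partial>sphere_measure \<partial>lborel \<partial>lborel)"
      by (rule nn_integral_swap[OF lborel.sigma_finite_measure_axioms lborel.sigma_finite_measure_axioms]) measurable
    finally show ?thesis unfolding h_def g_def .
  qed
  have "(\<integral>\<^sup>+x. F (swap_event x) \<partial>collision_law X \<alpha> \<beta>)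
     = (\<integral>\<^sup>+I. \<integral>\<^sup>+Is. \<integral>\<^sup>+I'. \<integral>\<^sup>+Is'. h Is I Is' I' \<partial>?B \<partial>?A \<partial>?B \<partial>?A)"
  proof (subst nn_integral_collision_law_iterated[OF sp])
    show "(\<lambda>x. F (swap_event x)) \<in> borel_measurable borel" by measurable
    show "(\<integral>\<^sup>+I. \<integral>\<^sup>+Is. \<integral>\<^sup>+I'. \<integral>\<^sup>+Is'. \<integral>\<^sup>+\<xi>. \<integral>\<^sup>+\<xi>s. \<integral>\<^sup>+\<omega>.
       F (swap_event ((\<xi>, I), (\<xi>s, Is), (post_vel X \<alpha> \<beta> \<xi> \<xi>s I Is I' Is' \<omega>, I'), (post_vel_s X \<alpha> \<beta> \<xi> \<xi>s I Is I' Is' \<omega>, Is')))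
       * ennreal (coll_weight X \<alpha> \<beta> \<xi> \<xi>s I Is I' Is' \<omega>)
     \<partial>sphere_measure \<partial>lborel \<partial>lborel \<partial>?B \<partial>?A \<partial>?B \<partial>?A) = (\<integral>\<^sup>+I. \<integral>\<^sup>+Is. \<integral>\<^sup>+I'. \<integral>\<^sup>+Is'. h Is I Is' I' \<partial>?B \<partial>?A \<partial>?B \<partial>?A)"
      unfolding swap_event_def by (simp only: prod.case core)
  qed
  also have "\<dots> = (\<integral>\<^sup>+Is. \<integral>\<^sup>+I. \<integral>\<^sup>+I'. \<integral>\<^sup>+Is'. h Is I Is' I' \<partial>?B \<partial>?A \<partial>?A \<partial>?B)"
    by (rule nn_integral_swap[OF sf sf]) measurable
  also have "\<dots> = (\<integral>\<^sup>+Is. \<integral>\<^sup>+I. \<integral>\<^sup>+Is'. \<integral>\<^sup>+I'. h Is I Is' I' \<partial>?A \<partial>?B \<partial>?A \<partial>?B)"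
    by (rule nn_integral_cong, rule nn_integral_cong, rule nn_integral_swap[OF sf sf]) measurable
  also have "\<dots> = (\<integral>\<^sup>+x. F x \<partial>collision_law X \<beta> \<alpha>)"
    unfolding nn_integral_collision_law_iterated[OF sp(2,1) F] h_def ..
  finally show "(\<integral>\<^sup>+x. F (swap_event x) \<partial>collision_law X \<alpha> \<beta>) = (\<integral>\<^sup>+x. F x \<partial>collision_law X \<beta> \<alpha>)" .
qed measurable

end

section \<open>Energy conservation and the bound on the cross section\<close>

definition particle_energy :: "mixture \<Rightarrow> nat \<Rightarrow> (real^3) \<times> real \<Rightarrow> real" where
  "particle_energy X \<alpha> z = mass X \<alpha> / 2 * (norm (fst z))\<^sup>2 + snd z"

text \<open>
  \<open>gibbs\<close> is the Maxwellian without its factor \<open>I powr (\<delta> / 2 - 1)\<close>. The internal energy of a monatomic particle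
  is 1, so the constant \<open>exp 1\<close> compensates the factor \<open>exp (- I)\<close> that \<open>gibbs\<close> has for all species. In this form
  energy conservation reads \<open>gibbs z \<cdot> gibbs z\<^sub>* = gibbs z' \<cdot> gibbs z'\<^sub>*\<close>.
\<close>

definition gibbs_const :: "mixture \<Rightarrow> nat \<Rightarrow> real" where
  "gibbs_const X \<alpha> = dens X \<alpha> * mass X \<alpha> powr (3/2) / (2 * pi) powr (3/2) *
     (if monatomic X \<alpha> then exp 1 else 1 / Gamma (dof X \<alpha> / 2))"

definition gibbs :: "mixture \<Rightarrow> nat \<Rightarrow> (real^3) \<times> real \<Rightarrow> real" where
  "gibbs X \<alpha> z = gibbs_const X \<alpha> * exp (- particle_energy X \<alpha> z)"

text \<open>
  A density of mass at most 1 that dominates \<open>x powr (\<delta> / 2 - 1) / E powr (\<delta> / 2)\<close>, one of the two factors of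
  \<open>Upsilon\<close>: for a polyatomic species energy conservation gives \<open>x < E\<close>, and \<open>\<delta> \<ge> 2\<close>.
\<close>

definition state_weight :: "mixture \<Rightarrow> nat \<Rightarrow> real \<Rightarrow> real \<Rightarrow> real" where
  "state_weight X \<alpha> E x = (if monatomic X \<alpha> then 1 else indicator {0<..<E} x / E)"

lemma particle_energy_measurable [measurable (raw)]:
  assumes [measurable]: "z \<in> borel_measurable M"
  shows "(\<lambda>x. particle_energy X \<alpha> (z x)) \<in> borel_measurable M"
  unfolding particle_energy_def by measurable

lemma gibbs_measurable [measurable (raw)]:
  assumes [measurable]: "z \<in> borel_measurable M"
  shows "(\<lambda>x. gibbs X \<alpha> (z x)) \<in> borel_measurable M"
  unfolding gibbs_def by measurable

lemma state_weight_measurable [measurable (raw)]: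
  assumes [measurable]: "E \<in> borel_measurable M" "x \<in> borel_measurable M"
  shows "(\<lambda>y. state_weight X \<alpha> (E y) (x y)) \<in> borel_measurable M"
proof -
  have "state_weight X \<alpha> (E y) (x y) = (if monatomic X \<alpha> then 1 else if 0 < x y \<and> x y < E y then 1 / E y else 0)" for y
    by (auto simp: state_weight_def)
  then show ?thesis by simp
qed

lemma nn_integral_internal_measure:
  assumes [measurable]: "f \<in> borel_measurable borel"
  shows "(\<integral>\<^sup>+x. f x \<partial>internal_measure X \<alpha>) =
    (if monatomic X \<alpha> then f 1 else (\<integral>\<^sup>+x. f x * indicator {0<..} x \<partial>lborel))"
  by (auto simp: internal_measure_def nn_integral_return nn_integral_density mult.commute)

lemma nn_integral_state_weight:
  "(\<integral>\<^sup>+x. ennreal (state_weight X \<alpha> E x) \<partial>internal_measure X \<alpha>) \<le> 1"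
proof (cases "monatomic X \<alpha>")
  case True
  then show ?thesis by (subst nn_integral_internal_measure) (simp_all add: state_weight_def)
next
  case False
  have "(\<integral>\<^sup>+x. ennreal (state_weight X \<alpha> E x) \<partial>internal_measure X \<alpha>)
      = (\<integral>\<^sup>+x. ennreal (1 / E) * indicator {0<..<E} x \<partial>lborel)"
    using False by (simp add: nn_integral_internal_measure)
      (intro nn_integral_cong, auto simp: state_weight_def split: split_indicator)
  also have "\<dots> = ennreal (1 / E) * emeasure lborel {0<..<E}"
    by (subst nn_integral_cmult) auto
  also have "\<dots> \<le> 1"
  proof (cases "0 < E")
    case True
    then show ?thesis by (simp add: ennreal_mult[symmetric])
  qed simp
  finally show ?thesis .
qed

context gas_mixture
begin

lemma dof_ge_2: "\<alpha> \<in> species X \<Longrightarrow> 2 \<le> dof X \<alpha>"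
  using dof_mono[of \<alpha>] dof_poly[of \<alpha>] by fastforce

lemma gibbs_const_pos: "\<alpha> \<in> species X \<Longrightarrow> 0 < gibbs_const X \<alpha>"
  using dens_pos[of \<alpha>] mass_pos[of \<alpha>] dof_ge_2[of \<alpha>]
  by (simp add: gibbs_const_def Gamma_real_pos)

lemma gibbs_pos: "\<alpha> \<in> species X \<Longrightarrow> 0 < gibbs X \<alpha> z"
  using gibbs_const_pos by (simp add: gibbs_def)

lemma maxwellian_gibbs:
  assumes "internal_energy X \<alpha> I"
  shows "maxwellian X \<alpha> \<xi> I = I powr (dof X \<alpha> / 2 - 1) * gibbs X \<alpha> (\<xi>, I)"
proof (cases "monatomic X \<alpha>")
  case True
  then have "I = 1" using assms by (simp add: internal_energy_def)
  with True show ?thesis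
    by (simp add: maxwellian_def gibbs_def gibbs_const_def particle_energy_def exp_add[symmetric] exp_minus[symmetric] mult.assoc)
next
  case False
  then show ?thesis
    by (simp add: maxwellian_def gibbs_def gibbs_const_def particle_energy_def mult.assoc exp_diff exp_minus)
      (simp add: field_simps exp_add)
qed

lemma gamma_weight_finite:
  assumes "\<alpha> \<in> species X" "a > 0"
  shows "(\<integral>\<^sup>+x. ennreal (x powr (dof X \<alpha> / 2 - 1) * exp (- a * x)) \<partial>internal_measure X \<alpha>) < \<infinity>"
  using gamma_integral_finite[OF assms(2), of "dof X \<alpha> / 2"] dof_ge_2[OF assms(1)]
  by (simp add: nn_integral_internal_measure)

context
  fixes \<alpha> \<beta> assumes sp: "\<alpha> \<in> species X" "\<beta> \<in> species X"
begin

lemma kinetic_energy_center_of_mass: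
  fixes G v :: "real^3"
  defines "b1 \<equiv> mass X \<alpha> / (mass X \<alpha> + mass X \<beta>)" and "b2 \<equiv> mass X \<beta> / (mass X \<alpha> + mass X \<beta>)"
  shows "mass X \<alpha> * (norm (G + b2 *\<^sub>R v))\<^sup>2 + mass X \<beta> * (norm (G - b1 *\<^sub>R v))\<^sup>2
    = (mass X \<alpha> + mass X \<beta>) * (norm G)\<^sup>2 + red_mass X \<alpha> \<beta> * (norm v)\<^sup>2"
proof -
  let ?a = "mass X \<alpha>" and ?b = "mass X \<beta>"
  have M: "?a + ?b \<noteq> 0" using mass_pos[OF sp(1)] mass_pos[OF sp(2)] by simp
  have p: "?a * b2 = red_mass X \<alpha> \<beta>" "?b * b1 = red_mass X \<alpha> \<beta>" by (simp_all add: b1_def b2_def red_mass_def)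
  have q: "b1 + b2 = 1" unfolding b1_def b2_def by (rule mass_fractions[OF sp])
  have "?a * (norm (G + b2 *\<^sub>R v))\<^sup>2 + ?b * (norm (G - b1 *\<^sub>R v))\<^sup>2
     = (?a + ?b) * (G \<bullet> G) + 2 * (?a * b2 - ?b * b1) * (G \<bullet> v) + (?a * b2 * b2 + ?b * b1 * b1) * (v \<bullet> v)"
    by (simp add: power2_norm_eq_inner inner_add_left inner_add_right inner_diff_left inner_diff_right
        inner_commute[of v G] algebra_simps)
  also have "?a * b2 * b2 + ?b * b1 * b1 = red_mass X \<alpha> \<beta> * (b1 + b2)" unfolding p by (simp add: algebra_simps)
  finally show ?thesis unfolding p q by (simp add: power2_norm_eq_inner)
qed

lemma velocities_center_of_mass:
  fixes \<xi> \<xi>s :: "real^3"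
  defines "G \<equiv> center_vel X \<alpha> \<beta> \<xi> \<xi>s"
  shows "\<xi> = G + (mass X \<beta> / (mass X \<alpha> + mass X \<beta>)) *\<^sub>R (\<xi> - \<xi>s)"
    and "\<xi>s = G - (mass X \<alpha> / (mass X \<alpha> + mass X \<beta>)) *\<^sub>R (\<xi> - \<xi>s)"
proof -
  let ?a = "mass X \<alpha>" and ?b = "mass X \<beta>"
  have M: "?a + ?b \<noteq> 0" using mass_pos[OF sp(1)] mass_pos[OF sp(2)] by simp
  have G: "G = (?a / (?a + ?b)) *\<^sub>R \<xi> + (?b / (?a + ?b)) *\<^sub>R \<xi>s"
    by (simp add: G_def center_vel_def scaleR_add_right)
  have "G + (?b / (?a + ?b)) *\<^sub>R (\<xi> - \<xi>s) = (?a / (?a + ?b) + ?b / (?a + ?b)) *\<^sub>R \<xi>"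
    unfolding G by (simp only: algebra_simps; simp)
  then show "\<xi> = G + (?b / (?a + ?b)) *\<^sub>R (\<xi> - \<xi>s)" unfolding mass_fractions[OF sp] by simp
  have "G - (?a / (?a + ?b)) *\<^sub>R (\<xi> - \<xi>s) = (?a / (?a + ?b) + ?b / (?a + ?b)) *\<^sub>R \<xi>s"
    unfolding G by (simp only: algebra_simps; simp)
  then show "\<xi>s = G - (?a / (?a + ?b)) *\<^sub>R (\<xi> - \<xi>s)" unfolding mass_fractions[OF sp] by simp
qed

lemma energy_conservation:
  assumes \<omega>: "norm \<omega> = 1" and c: "collision_args X \<alpha> \<beta> (norm (\<xi> - \<xi>s)) c I Is I' Is'"
  shows "particle_energy X \<alpha> (post_vel X \<alpha> \<beta> \<xi> \<xi>s I Is I' Is' \<omega>, I') + particle_energy X \<beta> (post_vel_s X \<alpha> \<beta> \<xi> \<xi>s I Is I' Is' \<omega>, Is')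
    = particle_energy X \<alpha> (\<xi>, I) + particle_energy X \<beta> (\<xi>s, Is)"
proof -
  let ?a = "mass X \<alpha>" and ?b = "mass X \<beta>" and ?m = "red_mass X \<alpha> \<beta>"
  let ?b1 = "?a / (?a + ?b)" and ?b2 = "?b / (?a + ?b)"
  define G where "G = center_vel X \<alpha> \<beta> \<xi> \<xi>s"
  define r where "r = norm (\<xi> - \<xi>s)"
  define r' where "r' = post_speed X \<alpha> \<beta> r I Is I' Is'"
  have m: "0 < ?m" by (rule red_mass_pos[OF sp])
  have cond: "2 * energy_gap I Is I' Is' < ?m * r\<^sup>2" "0 < r" using c by (simp_all add: collision_args_def r_def)
  then have "2 * energy_gap I Is I' Is' / ?m \<le> r\<^sup>2" using m by (simp add: field_simps)
  then have r'2: "r'\<^sup>2 = r\<^sup>2 - 2 * energy_gap I Is I' Is' / ?m" by (simp add: r'_def post_speed_def)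
  have "?a * (norm \<xi>)\<^sup>2 + ?b * (norm \<xi>s)\<^sup>2 = (?a + ?b) * (norm G)\<^sup>2 + ?m * r\<^sup>2"
    using kinetic_energy_center_of_mass[of G "\<xi> - \<xi>s"]
    unfolding G_def r_def velocities_center_of_mass[symmetric] .
  moreover have "?a * (norm (post_vel X \<alpha> \<beta> \<xi> \<xi>s I Is I' Is' \<omega>))\<^sup>2 + ?b * (norm (post_vel_s X \<alpha> \<beta> \<xi> \<xi>s I Is I' Is' \<omega>))\<^sup>2
     = (?a + ?b) * (norm G)\<^sup>2 + ?m * r'\<^sup>2"
  proof -
    have "post_vel X \<alpha> \<beta> \<xi> \<xi>s I Is I' Is' \<omega> = G + ?b2 *\<^sub>R (r' *\<^sub>R \<omega>)"
      "post_vel_s X \<alpha> \<beta> \<xi> \<xi>s I Is I' Is' \<omega> = G - ?b1 *\<^sub>R (r' *\<^sub>R \<omega>)"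
      by (simp_all add: post_vel_def post_vel_s_def G_def r'_def r_def)
    moreover have "(norm (r' *\<^sub>R \<omega>))\<^sup>2 = r'\<^sup>2" using \<omega> by (simp add: power_mult_distrib)
    ultimately show ?thesis using kinetic_energy_center_of_mass[of G "r' *\<^sub>R \<omega>"] by simp
  qed
  moreover have "?m * r'\<^sup>2 = ?m * r\<^sup>2 - 2 * energy_gap I Is I' Is'"
    unfolding r'2 using m by (simp add: field_simps)
  ultimately show ?thesis by (simp add: particle_energy_def energy_gap_def)
qed

end

end

locale bounded_mixture = gas_mixture +
  fixes \<gamma> C :: real
  assumes \<gamma>: "0 < \<gamma>" "\<gamma> < 1" and C: "0 < C"
    and xsec_bound: "\<And>\<alpha> \<beta> r c I Is I' Is'.
      \<alpha> \<in> species X \<Longrightarrow> \<beta> \<in> species X \<Longrightarrow> collision_args X \<alpha> \<beta> r c I Is I' Is' \<Longrightarrow>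
      0 \<le> xsec X \<alpha> \<beta> r c I Is I' Is' \<and>
      xsec X \<alpha> \<beta> r c I Is I' Is' \<le>
        C * ((Psi X \<alpha> \<beta> r I Is I' Is' + Psi X \<alpha> \<beta> r I Is I' Is' powr (\<gamma> / 2)) / r\<^sup>2)
          * Upsilon X \<alpha> \<beta> r I Is I' Is'"
begin

context
  fixes \<alpha> \<beta> assumes sp: "\<alpha> \<in> species X" "\<beta> \<in> species X"
begin

lemma scat_nonneg: "0 \<le> scat X \<alpha> \<beta> r c I Is I' Is'"
  using xsec_bound[OF sp] by (auto simp: scat_def collision_args_def)

lemma event_weight_nonneg: "0 \<le> event_weight X \<alpha> \<beta> x"
  by (subst event_split[of x]) (simp only: event_weight.simps coll_weight_def scat_nonneg split: if_split, simp)

lemma state_weight_bound: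
  assumes "internal_energy X \<delta> x" "\<delta> \<in> species X" "if monatomic X \<delta> then E = 1 else x < E"
  shows "x powr (dof X \<delta> / 2 - 1) / E powr (dof X \<delta> / 2) \<le> state_weight X \<delta> E x"
proof (cases "monatomic X \<delta>")
  case True
  then show ?thesis using assms by (simp add: state_weight_def internal_energy_def)
next
  case False
  then have x: "0 < x" "x < E" using assms by (auto simp: internal_energy_def)
  have "x powr (dof X \<delta> / 2 - 1) / E powr (dof X \<delta> / 2) \<le> E powr (dof X \<delta> / 2 - 1) / E powr (dof X \<delta> / 2)"
    using x dof_ge_2[OF assms(2)] by (intro divide_right_mono powr_mono2) auto
  also have "\<dots> = 1 / E" using x by (simp add: powr_diff)
  finally show ?thesis using False x by (simp add: state_weight_def)
qed

lemma energy_fac_cases: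
  assumes c: "collision_args X \<alpha> \<beta> r c I Is I' Is'"
  shows "if monatomic X \<alpha> then energy_fac X \<alpha> \<beta> r I Is = 1 else I' < energy_fac X \<alpha> \<beta> r I Is"
    and "if monatomic X \<beta> then energy_fac_s X \<alpha> \<beta> r I Is = 1 else Is' < energy_fac_s X \<alpha> \<beta> r I Is"
  using c by (auto simp: collision_args_def energy_fac_def energy_fac_s_def internal_energy_def energy_gap_def split: if_splits)

lemma Upsilon_bound:
  assumes c: "collision_args X \<alpha> \<beta> r c I Is I' Is'"
  shows "Upsilon X \<alpha> \<beta> r I Is I' Is' \<le>
     state_weight X \<alpha> (energy_fac X \<alpha> \<beta> r I Is) I' * state_weight X \<beta> (energy_fac_s X \<alpha> \<beta> r I Is) Is'"
proof -
  have i: "internal_energy X \<alpha> I'" "internal_energy X \<beta> Is'" using c by (simp_all add: collision_args_def)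
  have "Upsilon X \<alpha> \<beta> r I Is I' Is' = (I' powr (dof X \<alpha> / 2 - 1) / energy_fac X \<alpha> \<beta> r I Is powr (dof X \<alpha> / 2))
     * (Is' powr (dof X \<beta> / 2 - 1) / energy_fac_s X \<alpha> \<beta> r I Is powr (dof X \<beta> / 2))"
    by (simp add: Upsilon_def)
  also have "\<dots> \<le> state_weight X \<alpha> (energy_fac X \<alpha> \<beta> r I Is) I' * state_weight X \<beta> (energy_fac_s X \<alpha> \<beta> r I Is) Is'"
    using state_weight_bound[OF i(1) sp(1) energy_fac_cases(1)[OF c]] state_weight_bound[OF i(2) sp(2) energy_fac_cases(2)[OF c]]
    by (intro mult_mono) (auto intro: order_trans[rotated])
  finally show ?thesis .
qed

lemma Psi_bound:
  assumes c: "collision_args X \<alpha> \<beta> r c I Is I' Is'"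
  defines "r' \<equiv> post_speed X \<alpha> \<beta> r I Is I' Is'"
  shows "r * ((Psi X \<alpha> \<beta> r I Is I' Is' + Psi X \<alpha> \<beta> r I Is I' Is' powr (\<gamma> / 2)) / r\<^sup>2) \<le> 2 * (1 + 1 / r) * (1 + r')"
    and "0 < r'"
proof -
  have r: "0 < r" using c by (simp add: collision_args_def)
  have "2 * energy_gap I Is I' Is' / red_mass X \<alpha> \<beta> < r\<^sup>2"
    using c red_mass_pos[OF sp] by (simp add: collision_args_def field_simps)
  then show r': "0 < r'" unfolding r'_def by (rule post_speed_facts(2)[OF sp r])
  have P: "Psi X \<alpha> \<beta> r I Is I' Is' = r * r'" by (simp add: Psi_def r'_def post_speed_def)
  have "(r * r') powr (\<gamma> / 2) \<le> 1 + r * r'"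
  proof (cases "r * r' \<le> 1")
    case True
    then have "(r * r') powr (\<gamma> / 2) \<le> 1 powr (\<gamma> / 2)" using r r' \<gamma> by (intro powr_mono2) auto
    then show ?thesis using r r' by (simp add: add_increasing2)
  next
    case False
    then have "(r * r') powr (\<gamma> / 2) \<le> (r * r') powr 1" using \<gamma> by (intro powr_mono) auto
    then show ?thesis using False r r' by simp
  qed
  then have "r * ((r * r' + (r * r') powr (\<gamma> / 2)) / r\<^sup>2) \<le> r * ((r * r' + (1 + r * r')) / r\<^sup>2)"
    using r by (intro mult_left_mono divide_right_mono) auto
  also have "\<dots> = 2 * r' + 1 / r" using r by (simp add: field_simps power2_eq_square)
  also have "\<dots> \<le> 2 * (1 + 1 / r) * (1 + r')" using r r' by (simp add: field_simps)
  finally show "r * ((Psi X \<alpha> \<beta> r I Is I' Is' + Psi X \<alpha> \<beta> r I Is I' Is' powr (\<gamma> / 2)) / r\<^sup>2) \<le> 2 * (1 + 1 / r) * (1 + r')"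
    unfolding P .
qed

text \<open>
  The assumption on the cross sections in the form used for integration: at most linear growth in the
  relative speed after the collision, a singularity of order \<open>1 / r\<close>, and separate densities for the two
  internal energies after the collision. The exponent \<open>\<gamma> / 2 < 1\<close> enters through \<open>x powr (\<gamma> / 2) \<le> 1 + x\<close>.
\<close>

lemma scat_bound:
  assumes c: "collision_args X \<alpha> \<beta> r c I Is I' Is'"
  shows "scat X \<alpha> \<beta> r c I Is I' Is' \<le> I powr (dof X \<alpha> / 2 - 1) * Is powr (dof X \<beta> / 2 - 1) *
    (2 * C * (1 + 1 / r) * (1 + post_speed X \<alpha> \<beta> r I Is I' Is')) *
    (state_weight X \<alpha> (energy_fac X \<alpha> \<beta> r I Is) I' * state_weight X \<beta> (energy_fac_s X \<alpha> \<beta> r I Is) Is')"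
proof -
  let ?P = "(Psi X \<alpha> \<beta> r I Is I' Is' + Psi X \<alpha> \<beta> r I Is I' Is' powr (\<gamma> / 2)) / r\<^sup>2"
  let ?U = "Upsilon X \<alpha> \<beta> r I Is I' Is'" and ?r' = "post_speed X \<alpha> \<beta> r I Is I' Is'"
  have r: "0 < r" using c by (simp add: collision_args_def)
  have U0: "0 \<le> ?U" by (simp add: Upsilon_def)
  have "r * xsec X \<alpha> \<beta> r c I Is I' Is' \<le> r * (C * ?P * ?U)"
    using xsec_bound[OF sp c] r by (intro mult_left_mono) auto
  also have "\<dots> = C * (r * ?P) * ?U" by (simp add: mult_ac)
  also have "\<dots> \<le> C * (2 * (1 + 1 / r) * (1 + ?r')) * ?U"
    using Psi_bound(1)[OF c] C U0 by (intro mult_right_mono mult_left_mono) auto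
  also have "\<dots> \<le> C * (2 * (1 + 1 / r) * (1 + ?r')) *
     (state_weight X \<alpha> (energy_fac X \<alpha> \<beta> r I Is) I' * state_weight X \<beta> (energy_fac_s X \<alpha> \<beta> r I Is) Is')"
    using Upsilon_bound[OF c] C r Psi_bound(2)[OF c] by (intro mult_left_mono) auto
  finally have "I powr (dof X \<alpha> / 2 - 1) * Is powr (dof X \<beta> / 2 - 1) * (r * xsec X \<alpha> \<beta> r c I Is I' Is')
    \<le> I powr (dof X \<alpha> / 2 - 1) * Is powr (dof X \<beta> / 2 - 1) * (C * (2 * (1 + 1 / r) * (1 + ?r')) *
     (state_weight X \<alpha> (energy_fac X \<alpha> \<beta> r I Is) I' * state_weight X \<beta> (energy_fac_s X \<alpha> \<beta> r I Is) Is'))"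
    by (rule mult_left_mono) simp
  then show ?thesis using c by (simp add: scat_def mult_ac)
qed

end

end

section \<open>A uniform estimate of collision integrals\<close>

text \<open>
  Every kernel below is compared with this function. It decays in the state \<open>z\<^sub>*\<close> before the collision, which makes
  the integral over \<open>z\<^sub>*\<close> converge, and in one of the velocities after it, which compensates the growth
  of the cross section in the relative speed.
\<close>

fun tail :: "mixture \<Rightarrow> nat \<Rightarrow> real \<Rightarrow> collision \<Rightarrow> real" where
  "tail X \<alpha> a ((\<xi>, I), (\<xi>s, Is), (\<xi>', I'), (\<xi>s', Is')) =
     exp (- a * (norm \<xi>s)\<^sup>2) * exp (- a * Is) *
     (exp (- a * (norm \<xi>')\<^sup>2) + exp (- a * (norm \<xi>s')\<^sup>2)) / I powr (dof X \<alpha> / 2 - 1)"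

text \<open>
  For \<open>\<kappa> = m\<^sub>\<beta> / (m\<^sub>\<alpha> + m\<^sub>\<beta>)\<close> and \<open>\<kappa> = - m\<^sub>\<alpha> / (m\<^sub>\<alpha> + m\<^sub>\<beta>)\<close> the third Gaussian is evaluated at \<open>\<xi>'\<close> and \<open>\<xi>'\<^sub>*\<close>,
  so these are the two summands of \<open>tail\<close>, multiplied by the collision weight.
\<close>

fun gauss_flux :: "mixture \<Rightarrow> nat \<Rightarrow> nat \<Rightarrow> real \<Rightarrow> real \<Rightarrow> real^3 \<Rightarrow> real \<Rightarrow> (real^3) \<times> real \<times> real \<times> real \<times> (real^3) \<Rightarrow> ennreal" where
  "gauss_flux X \<alpha> \<beta> a \<kappa> \<xi> I (\<xi>s, Is, I', Is', \<omega>) = ennreal (exp (- a * (norm \<xi>s)\<^sup>2) * exp (- a * Is) *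
     exp (- a * (norm (center_vel X \<alpha> \<beta> \<xi> \<xi>s + (\<kappa> * post_speed X \<alpha> \<beta> (norm (\<xi> - \<xi>s)) I Is I' Is') *\<^sub>R \<omega>))\<^sup>2)
       / I powr (dof X \<alpha> / 2 - 1)) * ennreal (coll_weight X \<alpha> \<beta> \<xi> \<xi>s I Is I' Is' \<omega>)"

context bounded_mixture
begin

context
  fixes \<alpha> \<beta> assumes sp: "\<alpha> \<in> species X" "\<beta> \<in> species X"
begin

lemma gauss_flux_measurable [measurable]: "gauss_flux X \<alpha> \<beta> a \<kappa> \<xi> I \<in> borel_measurable borel"
proof -
  note [measurable (raw)] = coll_weight_measurable[OF sp]
  have "gauss_flux X \<alpha> \<beta> a \<kappa> \<xi> I = (\<lambda>(\<xi>s, Is, I', Is', \<omega>). gauss_flux X \<alpha> \<beta> a \<kappa> \<xi> I (\<xi>s, Is, I', Is', \<omega>))" by auto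
  also have "\<dots> \<in> borel_measurable borel" unfolding gauss_flux.simps case_prod_beta by measurable
  finally show ?thesis .
qed

text \<open>
  For fixed internal energies, the factor \<open>1 + r'\<close> from the cross section is absorbed by the decay of
  Gaussians on spheres; what remains is a product of functions of one variable each.
\<close>

lemma sphere_integral_bound:
  assumes A: "\<And>(c::real^3) R. 0 \<le> R \<Longrightarrow>
      ennreal (1 + R) * (\<integral>\<^sup>+\<omega>. ennreal (exp (- a * (norm (c + (\<kappa> * R) *\<^sub>R \<omega>))\<^sup>2)) \<partial>sphere_measure) \<le> A"
    and I: "internal_energy X \<alpha> I"
  shows "(\<integral>\<^sup>+\<omega>. gauss_flux X \<alpha> \<beta> a \<kappa> \<xi> I (\<xi>s, Is, I', Is', \<omega>) \<partial>sphere_measure)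
    \<le> ennreal (exp (- a * (norm \<xi>s)\<^sup>2)) * ennreal (1 + 1 / norm (\<xi> - \<xi>s)) * ennreal (Is powr (dof X \<beta> / 2 - 1) * exp (- a * Is))
      * (ennreal (2 * C) * A) * ennreal (state_weight X \<alpha> (energy_fac X \<alpha> \<beta> (norm (\<xi> - \<xi>s)) I Is) I')
      * ennreal (state_weight X \<beta> (energy_fac_s X \<alpha> \<beta> (norm (\<xi> - \<xi>s)) I Is) Is')"
proof (cases "collision_args X \<alpha> \<beta> (norm (\<xi> - \<xi>s)) 0 I Is I' Is'")
  case False
  then have "\<And>c. \<not> collision_args X \<alpha> \<beta> (norm (\<xi> - \<xi>s)) c I Is I' Is'"
    by (auto simp: collision_args_def)
  then have "coll_weight X \<alpha> \<beta> \<xi> \<xi>s I Is I' Is' \<omega> = 0" for \<omega> by (simp add: coll_weight_def scat_def)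
  then show ?thesis by simp
next
  case True
  let ?E1 = "exp (- a * (norm \<xi>s)\<^sup>2)" and ?E2 = "exp (- a * Is)" and ?Ip = "I powr (dof X \<alpha> / 2 - 1)"
  let ?g = "\<lambda>\<omega>. exp (- a * (norm (center_vel X \<alpha> \<beta> \<xi> \<xi>s + (\<kappa> * post_speed X \<alpha> \<beta> (norm (\<xi> - \<xi>s)) I Is I' Is') *\<^sub>R \<omega>))\<^sup>2)"
  let ?w = "coll_weight X \<alpha> \<beta> \<xi> \<xi>s I Is I' Is'"
  let ?r = "norm (\<xi> - \<xi>s)"
  let ?r' = "post_speed X \<alpha> \<beta> ?r I Is I' Is'"
  let ?ua = "state_weight X \<alpha> (energy_fac X \<alpha> \<beta> ?r I Is) I'" and ?ub = "state_weight X \<beta> (energy_fac_s X \<alpha> \<beta> ?r I Is) Is'"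
  let ?q = "Is powr (dof X \<beta> / 2 - 1)"
  let ?K = "ennreal ?E1 * ennreal (1 + 1 / ?r) * ennreal (?q * ?E2) * ennreal (2 * C) * ennreal ?ua * ennreal ?ub"
  note [measurable (raw)] = coll_weight_measurable[OF sp]
  have r: "0 < ?r" using True by (simp add: collision_args_def)
  have r': "0 < ?r'" by (rule Psi_bound(2)[OF sp True])
  have Ip: "0 < ?Ip" using internal_energy_pos[OF I] by simp
  have u: "0 \<le> ?ua" "0 \<le> ?ub" by (auto simp: state_weight_def indicator_def)
  have pt: "ennreal (?E1 * ?E2 * ?g \<omega> / ?Ip) * ennreal (?w \<omega>) \<le> ?K * (ennreal (1 + ?r') * ennreal (?g \<omega>))" for \<omega>
  proof (cases "?w \<omega> = 0")
    case True
    then show ?thesis by simp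
  next
    case nz: False
    let ?c = "(\<xi> - \<xi>s) \<bullet> \<omega> / norm (\<xi> - \<xi>s)"
    have c: "collision_args X \<alpha> \<beta> ?r ?c I Is I' Is'" and w: "?w \<omega> = scat X \<alpha> \<beta> ?r ?c I Is I' Is'"
      using nz by (auto simp: coll_weight_def scat_def split: if_splits)
    have "?E1 * ?E2 * ?g \<omega> / ?Ip * ?w \<omega> \<le> ?E1 * ?E2 * ?g \<omega> / ?Ip * (?Ip * ?q * (2 * C * (1 + 1 / ?r) * (1 + ?r')) * (?ua * ?ub))"
      unfolding w using scat_bound[OF sp c] Ip by (intro mult_left_mono) auto
    also have "\<dots> = ?E1 * (1 + 1 / ?r) * (?q * ?E2) * (2 * C) * ?ua * ?ub * ((1 + ?r') * ?g \<omega>)"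
      using Ip by (simp add: mult_ac)
    finally have le: "?E1 * ?E2 * ?g \<omega> / ?Ip * ?w \<omega> \<le> ?E1 * (1 + 1 / ?r) * (?q * ?E2) * (2 * C) * ?ua * ?ub * ((1 + ?r') * ?g \<omega>)" .
    have "ennreal (?E1 * ?E2 * ?g \<omega> / ?Ip) * ennreal (?w \<omega>) = ennreal (?E1 * ?E2 * ?g \<omega> / ?Ip * ?w \<omega>)"
      by (rule ennreal_mult'[symmetric]) simp
    also have "\<dots> \<le> ennreal (?E1 * (1 + 1 / ?r) * (?q * ?E2) * (2 * C) * ?ua * ?ub * ((1 + ?r') * ?g \<omega>))"
      using le by (rule ennreal_leI)
    also have "\<dots> = ?K * (ennreal (1 + ?r') * ennreal (?g \<omega>))"
      using u C r r' by (simp only: ennreal_mult mult_nonneg_nonneg exp_ge_zero powr_ge_zero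
          add_nonneg_nonneg zero_le_one less_imp_le zero_le_divide_iff norm_ge_zero zero_le_numeral simp_thms)
    finally show ?thesis .
  qed
  have "(\<integral>\<^sup>+\<omega>. ennreal (?E1 * ?E2 * ?g \<omega> / ?Ip) * ennreal (?w \<omega>) \<partial>sphere_measure)
    \<le> (\<integral>\<^sup>+\<omega>. ?K * (ennreal (1 + ?r') * ennreal (?g \<omega>)) \<partial>sphere_measure)"
    by (rule nn_integral_mono) (rule pt)
  also have "\<dots> = ?K * (ennreal (1 + ?r') * (\<integral>\<^sup>+\<omega>. ennreal (?g \<omega>) \<partial>sphere_measure))"
    by (subst nn_integral_cmult, measurable)+
  also have "\<dots> \<le> ?K * A"
    using r' by (intro mult_left_mono A) auto
  also have "\<dots> = ennreal ?E1 * ennreal (1 + 1 / ?r) * ennreal (?q * ?E2) * (ennreal (2 * C) * A) * ennreal ?ua * ennreal ?ub"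
    by (simp only: mult_ac)
  finally show ?thesis unfolding gauss_flux.simps .
qed

text \<open>
  Integrating the bound on the sphere over one variable after the other: the densities in \<open>I'\<close> and \<open>I'\<^sub>*\<close> have mass
  at most 1, the integral over \<open>I\<^sub>*\<close> is a Gamma integral, and the one over \<open>\<xi>\<^sub>*\<close> is that of a Gaussian
  against \<open>1 + 1 / |g|\<close>. None of the bounds depends on the state \<open>(\<xi>, I)\<close>.
\<close>

lemma coll_gaussian_estimate:
  assumes a: "a > 0" and \<kappa>: "\<kappa> \<noteq> 0"
  shows "\<exists>B::real. \<forall>\<xi> I. internal_energy X \<alpha> I \<longrightarrow>
    (\<integral>\<^sup>+c. gauss_flux X \<alpha> \<beta> a \<kappa> \<xi> I c \<partial>coll_measure X \<alpha> \<beta>) \<le> ennreal B"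
proof -
  obtain A where A: "\<And>(c::real^3) R. 0 \<le> R \<Longrightarrow>
      ennreal (1 + R) * (\<integral>\<^sup>+\<omega>. ennreal (exp (- a * (norm (c + (\<kappa> * R) *\<^sub>R \<omega>))\<^sup>2)) \<partial>sphere_measure) \<le> ennreal A"
    using sphere_gaussian_weighted_bound[OF a \<kappa>] by blast
  obtain D where D: "\<And>y::real^3. (\<integral>\<^sup>+x. ennreal (exp (- a * (norm x)\<^sup>2)) * ennreal (1 + 1 / norm (y - x)) \<partial>lborel) \<le> ennreal D"
    using gaussian_coulomb_bound[OF a] by blast
  define H where "H = (\<integral>\<^sup>+x. ennreal (x powr (dof X \<beta> / 2 - 1) * exp (- a * x)) \<partial>internal_measure X \<beta>)"
  have H: "H < \<infinity>" unfolding H_def by (rule gamma_weight_finite[OF sp(2) a])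
  define A' where "A' = ennreal (2 * C) * ennreal A"
  define B where "B = enn2real (ennreal D * (H * A'))"
  have B: "ennreal B = ennreal D * (H * A')"
    using H by (simp add: B_def A'_def ennreal_mult_less_top)
  note [measurable (raw)] = coll_weight_measurable[OF sp]
  note sw = nn_integral_state_weight
  show ?thesis
  proof (rule exI[of _ B], intro allI impI)
    fix \<xi> :: "real^3" and I :: real assume I: "internal_energy X \<alpha> I"
    let ?f = "\<lambda>\<xi>s Is I' Is' \<omega>. gauss_flux X \<alpha> \<beta> a \<kappa> \<xi> I (\<xi>s, Is, I', Is', \<omega>)"
    let ?A = "internal_measure X \<alpha>" and ?B = "internal_measure X \<beta>" and ?S = sphere_measure
    let ?e = "\<lambda>\<xi>s. ennreal (exp (- a * (norm \<xi>s)\<^sup>2)) * ennreal (1 + 1 / norm (\<xi> - \<xi>s))"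
    let ?h = "\<lambda>Is. ennreal (Is powr (dof X \<beta> / 2 - 1) * exp (- a * Is))"
    let ?ua = "\<lambda>\<xi>s Is I'. ennreal (state_weight X \<alpha> (energy_fac X \<alpha> \<beta> (norm (\<xi> - \<xi>s)) I Is) I')"
    let ?ub = "\<lambda>\<xi>s Is Is'. ennreal (state_weight X \<beta> (energy_fac_s X \<alpha> \<beta> (norm (\<xi> - \<xi>s)) I Is) Is')"
    have 1: "(\<integral>\<^sup>+\<omega>. ?f \<xi>s Is I' Is' \<omega> \<partial>?S) \<le> ?e \<xi>s * ?h Is * A' * ?ua \<xi>s Is I' * ?ub \<xi>s Is Is'" for \<xi>s Is I' Is'
      unfolding A'_def by (rule sphere_integral_bound[OF A I])
    have 2: "(\<integral>\<^sup>+Is'. \<integral>\<^sup>+\<omega>. ?f \<xi>s Is I' Is' \<omega> \<partial>?S \<partial>?B) \<le> ?e \<xi>s * ?h Is * A' * ?ua \<xi>s Is I'" for \<xi>s Is I'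
    proof -
      have "(\<integral>\<^sup>+Is'. \<integral>\<^sup>+\<omega>. ?f \<xi>s Is I' Is' \<omega> \<partial>?S \<partial>?B)
         \<le> (\<integral>\<^sup>+Is'. ?e \<xi>s * ?h Is * A' * ?ua \<xi>s Is I' * ?ub \<xi>s Is Is' \<partial>?B)"
        by (rule nn_integral_mono) (rule 1)
      also have "\<dots> = ?e \<xi>s * ?h Is * A' * ?ua \<xi>s Is I' * (\<integral>\<^sup>+Is'. ?ub \<xi>s Is Is' \<partial>?B)"
        by (rule nn_integral_cmult) measurable
      also have "\<dots> \<le> ?e \<xi>s * ?h Is * A' * ?ua \<xi>s Is I' * 1" by (intro mult_left_mono sw) simp
      finally show ?thesis by simp
    qed
    have 3: "(\<integral>\<^sup>+I'. \<integral>\<^sup>+Is'. \<integral>\<^sup>+\<omega>. ?f \<xi>s Is I' Is' \<omega> \<partial>?S \<partial>?B \<partial>?A)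
        \<le> ?e \<xi>s * A' * ?h Is" for \<xi>s Is
    proof -
      have "(\<integral>\<^sup>+I'. \<integral>\<^sup>+Is'. \<integral>\<^sup>+\<omega>. ?f \<xi>s Is I' Is' \<omega> \<partial>?S \<partial>?B \<partial>?A)
         \<le> (\<integral>\<^sup>+I'. ?e \<xi>s * ?h Is * A' * ?ua \<xi>s Is I' \<partial>?A)"
        by (rule nn_integral_mono) (rule 2)
      also have "\<dots> = ?e \<xi>s * ?h Is * A' * (\<integral>\<^sup>+I'. ?ua \<xi>s Is I' \<partial>?A)"
        by (rule nn_integral_cmult) measurable
      also have "\<dots> \<le> ?e \<xi>s * ?h Is * A' * 1" by (intro mult_left_mono sw) simp
      also have "\<dots> = ?e \<xi>s * A' * ?h Is" by (simp only: mult_1_right mult_1_left mult_ac)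
      finally show ?thesis .
    qed
    have 4: "(\<integral>\<^sup>+Is. \<integral>\<^sup>+I'. \<integral>\<^sup>+Is'. \<integral>\<^sup>+\<omega>. ?f \<xi>s Is I' Is' \<omega> \<partial>?S \<partial>?B \<partial>?A \<partial>?B)
        \<le> ?e \<xi>s * (H * A')" for \<xi>s
    proof -
      have "(\<integral>\<^sup>+Is. \<integral>\<^sup>+I'. \<integral>\<^sup>+Is'. \<integral>\<^sup>+\<omega>. ?f \<xi>s Is I' Is' \<omega> \<partial>?S \<partial>?B \<partial>?A \<partial>?B)
         \<le> (\<integral>\<^sup>+Is. ?e \<xi>s * A' * ?h Is \<partial>?B)"
        by (rule nn_integral_mono) (rule 3)
      also have "\<dots> = ?e \<xi>s * A' * H"
        unfolding H_def by (rule nn_integral_cmult) measurable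
      also have "\<dots> = ?e \<xi>s * (H * A')" by (simp only: mult_ac)
      finally show ?thesis .
    qed
    have "(\<integral>\<^sup>+c. gauss_flux X \<alpha> \<beta> a \<kappa> \<xi> I c \<partial>coll_measure X \<alpha> \<beta>)
      = (\<integral>\<^sup>+\<xi>s. \<integral>\<^sup>+Is. \<integral>\<^sup>+I'. \<integral>\<^sup>+Is'. \<integral>\<^sup>+\<omega>. ?f \<xi>s Is I' Is' \<omega> \<partial>?S \<partial>?B \<partial>?A \<partial>?B \<partial>lborel)"
      by (rule nn_integral_coll_measure[OF gauss_flux_measurable])
    also have "\<dots> \<le> (\<integral>\<^sup>+\<xi>s. ?e \<xi>s * (H * A') \<partial>lborel)" by (rule nn_integral_mono) (rule 4)
    also have "\<dots> = (\<integral>\<^sup>+\<xi>s. ?e \<xi>s \<partial>lborel) * (H * A')" by (rule nn_integral_multc) measurable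
    also have "\<dots> \<le> ennreal D * (H * A')" by (intro mult_right_mono D) simp
    finally show "(\<integral>\<^sup>+c. gauss_flux X \<alpha> \<beta> a \<kappa> \<xi> I c \<partial>coll_measure X \<alpha> \<beta>) \<le> ennreal B"
      unfolding B .
  qed
qed

lemma tail_estimate:
  assumes a: "a > 0"
  shows "\<exists>B::real. \<forall>z. internal_energy X \<alpha> (snd z) \<longrightarrow>
    (\<integral>\<^sup>+c. ennreal (tail X \<alpha> a (coll_event X \<alpha> \<beta> (z, c))) * ennreal (event_weight X \<alpha> \<beta> (z, c)) \<partial>coll_measure X \<alpha> \<beta>) \<le> ennreal B"
proof -
  let ?M = "mass X \<alpha> + mass X \<beta>"
  let ?f = "gauss_flux X \<alpha> \<beta> a"
  note [measurable (raw)] = coll_weight_measurable[OF sp]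
  have m: "0 < mass X \<alpha>" "0 < mass X \<beta>" using mass_pos sp by auto
  obtain B1 where B1: "\<And>\<xi> I. internal_energy X \<alpha> I \<Longrightarrow> (\<integral>\<^sup>+c. ?f (mass X \<beta> / ?M) \<xi> I c \<partial>coll_measure X \<alpha> \<beta>) \<le> ennreal B1"
    using coll_gaussian_estimate[OF a, of "mass X \<beta> / ?M"] m by fastforce
  obtain B2 where B2: "\<And>\<xi> I. internal_energy X \<alpha> I \<Longrightarrow> (\<integral>\<^sup>+c. ?f (- (mass X \<alpha> / ?M)) \<xi> I c \<partial>coll_measure X \<alpha> \<beta>) \<le> ennreal B2"
    using coll_gaussian_estimate[OF a, of "- (mass X \<alpha> / ?M)"] m by fastforce
  have "(\<integral>\<^sup>+c. ennreal (tail X \<alpha> a (coll_event X \<alpha> \<beta> ((\<xi>, I), c))) * ennreal (event_weight X \<alpha> \<beta> ((\<xi>, I), c)) \<partial>coll_measure X \<alpha> \<beta>)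
     \<le> ennreal (max 0 B1 + max 0 B2)" if I: "internal_energy X \<alpha> I" for \<xi> I
  proof -
    have "ennreal (tail X \<alpha> a (coll_event X \<alpha> \<beta> ((\<xi>, I), c))) * ennreal (event_weight X \<alpha> \<beta> ((\<xi>, I), c))
      = ?f (mass X \<beta> / ?M) \<xi> I c + ?f (- (mass X \<alpha> / ?M)) \<xi> I c" for c
    proof -
      obtain \<xi>s Is I' Is' \<omega> where c: "c = (\<xi>s, Is, I', Is', \<omega>)" by (cases c)
      have "tail X \<alpha> a (coll_event X \<alpha> \<beta> ((\<xi>, I), c)) =
         exp (- a * (norm \<xi>s)\<^sup>2) * exp (- a * Is) *
           exp (- a * (norm (center_vel X \<alpha> \<beta> \<xi> \<xi>s + (mass X \<beta> / ?M * post_speed X \<alpha> \<beta> (norm (\<xi> - \<xi>s)) I Is I' Is') *\<^sub>R \<omega>))\<^sup>2)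
           / I powr (dof X \<alpha> / 2 - 1)
        + exp (- a * (norm \<xi>s)\<^sup>2) * exp (- a * Is) *
           exp (- a * (norm (center_vel X \<alpha> \<beta> \<xi> \<xi>s + (- (mass X \<alpha> / ?M) * post_speed X \<alpha> \<beta> (norm (\<xi> - \<xi>s)) I Is I' Is') *\<^sub>R \<omega>))\<^sup>2)
           / I powr (dof X \<alpha> / 2 - 1)" (is "_ = ?t1 + ?t2")
        unfolding c by (simp add: post_vel_def post_vel_s_def distrib_left add_divide_distrib)
      then have "ennreal (tail X \<alpha> a (coll_event X \<alpha> \<beta> ((\<xi>, I), c))) = ennreal ?t1 + ennreal ?t2"
        by (simp only:) (rule ennreal_plus, simp_all)
      then show ?thesis unfolding c by (simp only: distrib_right gauss_flux.simps event_weight.simps)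
    qed
    then have "(\<integral>\<^sup>+c. ennreal (tail X \<alpha> a (coll_event X \<alpha> \<beta> ((\<xi>, I), c))) * ennreal (event_weight X \<alpha> \<beta> ((\<xi>, I), c)) \<partial>coll_measure X \<alpha> \<beta>)
      = (\<integral>\<^sup>+c. ?f (mass X \<beta> / ?M) \<xi> I c + ?f (- (mass X \<alpha> / ?M)) \<xi> I c \<partial>coll_measure X \<alpha> \<beta>)" by (simp only:)
    also have "\<dots> = (\<integral>\<^sup>+c. ?f (mass X \<beta> / ?M) \<xi> I c \<partial>coll_measure X \<alpha> \<beta>) + (\<integral>\<^sup>+c. ?f (- (mass X \<alpha> / ?M)) \<xi> I c \<partial>coll_measure X \<alpha> \<beta>)"
      by (rule nn_integral_add) measurable
    also have "\<dots> \<le> ennreal B1 + ennreal B2" by (intro add_mono B1 B2 I)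
    also have "\<dots> \<le> ennreal (max 0 B1) + ennreal (max 0 B2)" by (intro add_mono ennreal_leI) auto
    also have "\<dots> = ennreal (max 0 B1 + max 0 B2)" by (rule ennreal_plus[symmetric]) auto
    finally show ?thesis .
  qed
  then show ?thesis by (intro exI[of _ "max 0 B1 + max 0 B2"]) (auto)
qed

end

end

section \<open>The Schur test and row bounds\<close>

definition L2 :: "'a measure \<Rightarrow> ('a \<Rightarrow> real) set" where
  "L2 M = {f. f \<in> borel_measurable M \<and> integrable M (\<lambda>z. (f z)\<^sup>2)}"

lemma L2D: "f \<in> L2 M \<Longrightarrow> f \<in> borel_measurable M" "f \<in> L2 M \<Longrightarrow> integrable M (\<lambda>z. (f z)\<^sup>2)"
  by (simp_all add: L2_def)

text \<open>
  The Schur test for a kernel \<open>D = sqrt (P Q)\<close> that acts along a map \<open>\<pi>\<close> from pairs \<open>(z, c)\<close> to the state at which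
  \<open>h\<close> is evaluated. By the Cauchy-Schwarz inequality in \<open>c\<close>, the square of the integral is at most
  \<open>\<integral> P dc\<close>, which is bounded, times \<open>\<integral> h(\<pi>)\<^sup>2 Q dc\<close>, whose integral over \<open>z\<close> is controlled by the column
  bound. Working with \<open>\<pi>\<close> avoids computing an integral kernel between the states \<open>z\<close> and \<open>\<pi>(z, c)\<close>.
\<close>

lemma schur_test:
  fixes D P Q :: "'a \<times> 'b \<Rightarrow> real" and h :: "'c \<Rightarrow> real"
  assumes sf: "sigma_finite_measure M" "sigma_finite_measure N"
    and [measurable]: "D \<in> borel_measurable (M \<Otimes>\<^sub>M N)" "P \<in> borel_measurable (M \<Otimes>\<^sub>M N)" "Q \<in> borel_measurable (M \<Otimes>\<^sub>M N)"
    and nonneg: "\<And>x. 0 \<le> D x" "\<And>x. 0 \<le> P x" "\<And>x. 0 \<le> Q x"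
    and DPQ: "\<And>x. (D x)\<^sup>2 = P x * Q x"
    and \<pi>[measurable]: "\<pi> \<in> measurable (M \<Otimes>\<^sub>M N) L"
    and row: "AE z in M. (\<integral>\<^sup>+c. ennreal (P (z, c)) \<partial>N) \<le> ennreal B"
    and col: "\<And>\<phi>. \<phi> \<in> borel_measurable L \<Longrightarrow>
      (\<integral>\<^sup>+x. \<phi> (\<pi> x) * ennreal (Q x) \<partial>(M \<Otimes>\<^sub>M N)) \<le> ennreal B' * (\<integral>\<^sup>+y. \<phi> y \<partial>L)"
    and hL2: "h \<in> L2 L"
  shows schur_integrable: "AE z in M. integrable N (\<lambda>c. h (\<pi> (z, c)) * D (z, c))"
    and schur_L2: "(\<lambda>z. LINT c|N. h (\<pi> (z, c)) * D (z, c)) \<in> L2 M"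
    and schur_pairing: "f \<in> L2 M \<Longrightarrow> integrable (M \<Otimes>\<^sub>M N) (\<lambda>x. f (fst x) * (h (\<pi> x) * D x))"
proof -
  interpret M: sigma_finite_measure M by fact
  interpret N: sigma_finite_measure N by fact
  interpret MN: pair_sigma_finite M N ..
  note [measurable] = L2D(1)[OF hL2] and h2 = L2D(2)[OF hL2]
  define W where "W z = (\<integral>\<^sup>+c. ennreal (\<bar>h (\<pi> (z, c))\<bar> * D (z, c)) \<partial>N)" for z
  have [measurable]: "W \<in> borel_measurable M" unfolding W_def by measurable
  have W2: "AE z in M. (W z)\<^sup>2 \<le> ennreal B * (\<integral>\<^sup>+c. ennreal ((h (\<pi> (z, c)))\<^sup>2) * ennreal (Q (z, c)) \<partial>N)"
    using row AE_space
  proof eventually_elim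
    fix z assume z: "(\<integral>\<^sup>+c. ennreal (P (z, c)) \<partial>N) \<le> ennreal B" and [measurable]: "z \<in> space M"
    have "ennreal (\<bar>h (\<pi> (z, c))\<bar> * D (z, c)) = ennreal (sqrt (P (z, c))) * ennreal (\<bar>h (\<pi> (z, c))\<bar> * sqrt (Q (z, c)))" for c
    proof -
      have "D (z, c) = sqrt (P (z, c)) * sqrt (Q (z, c))"
        using DPQ[of "(z, c)"] nonneg(1)[of "(z, c)"] by (simp add: real_sqrt_mult[symmetric] real_sqrt_unique)
      then show ?thesis using nonneg by (simp add: ennreal_mult[symmetric] mult_ac)
    qed
    then have "(W z)\<^sup>2 = (\<integral>\<^sup>+c. ennreal (sqrt (P (z, c))) * ennreal (\<bar>h (\<pi> (z, c))\<bar> * sqrt (Q (z, c))) \<partial>N)\<^sup>2"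
      by (simp add: W_def)
    also have "\<dots> \<le> (\<integral>\<^sup>+c. (ennreal (sqrt (P (z, c))))\<^sup>2 \<partial>N) * (\<integral>\<^sup>+c. (ennreal (\<bar>h (\<pi> (z, c))\<bar> * sqrt (Q (z, c))))\<^sup>2 \<partial>N)"
      by (rule Cauchy_Schwarz_nn_integral) measurable
    also have "(\<integral>\<^sup>+c. (ennreal (sqrt (P (z, c))))\<^sup>2 \<partial>N) = (\<integral>\<^sup>+c. ennreal (P (z, c)) \<partial>N)"
      using nonneg by (simp add: ennreal_power)
    also have "(\<integral>\<^sup>+c. (ennreal (\<bar>h (\<pi> (z, c))\<bar> * sqrt (Q (z, c))))\<^sup>2 \<partial>N) = (\<integral>\<^sup>+c. ennreal ((h (\<pi> (z, c)))\<^sup>2) * ennreal (Q (z, c)) \<partial>N)"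
      using nonneg by (simp add: ennreal_power power_mult_distrib ennreal_mult)
    also have "(\<integral>\<^sup>+c. ennreal (P (z, c)) \<partial>N) * \<dots> \<le> ennreal B * \<dots>"
      using z by (rule mult_right_mono) simp
    finally show "(W z)\<^sup>2 \<le> ennreal B * (\<integral>\<^sup>+c. ennreal ((h (\<pi> (z, c)))\<^sup>2) * ennreal (Q (z, c)) \<partial>N)" .
  qed
  have W2_fin: "(\<integral>\<^sup>+z. (W z)\<^sup>2 \<partial>M) < \<infinity>"
  proof -
    have "(\<integral>\<^sup>+z. (W z)\<^sup>2 \<partial>M) \<le> (\<integral>\<^sup>+z. ennreal B * (\<integral>\<^sup>+c. ennreal ((h (\<pi> (z, c)))\<^sup>2) * ennreal (Q (z, c)) \<partial>N) \<partial>M)"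
      using W2 by (rule nn_integral_mono_AE)
    also have "\<dots> = ennreal B * (\<integral>\<^sup>+z. (\<integral>\<^sup>+c. ennreal ((h (\<pi> (z, c)))\<^sup>2) * ennreal (Q (z, c)) \<partial>N) \<partial>M)"
      by (rule nn_integral_cmult) measurable
    also have "(\<integral>\<^sup>+z. (\<integral>\<^sup>+c. ennreal ((h (\<pi> (z, c)))\<^sup>2) * ennreal (Q (z, c)) \<partial>N) \<partial>M)
      = (\<integral>\<^sup>+x. ennreal ((h (\<pi> x))\<^sup>2) * ennreal (Q x) \<partial>(M \<Otimes>\<^sub>M N))"
      by (rule N.nn_integral_fst) measurable
    also have "\<dots> \<le> ennreal B' * (\<integral>\<^sup>+y. ennreal ((h y)\<^sup>2) \<partial>L)"
      by (rule col) measurable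
    also have "ennreal B * (ennreal B' * (\<integral>\<^sup>+y. ennreal ((h y)\<^sup>2) \<partial>L)) < \<infinity>"
      using h2 by (auto simp: integrable_iff_bounded ennreal_mult_less_top)
    finally show ?thesis by (simp add: mult_left_mono)
  qed
  have W_fin: "AE z in M. W z < \<infinity>"
  proof -
    have "AE z in M. (W z)\<^sup>2 \<noteq> \<infinity>" using W2_fin by (intro nn_integral_PInf_AE) auto
    then show ?thesis
    proof eventually_elim
      fix z assume W: "(W z)\<^sup>2 \<noteq> \<infinity>"
      show "W z < \<infinity>"
      proof (rule ccontr)
        assume "\<not> W z < \<infinity>"
        then have "W z = \<top>" by (simp add: less_top[symmetric])
        with W show False by (simp add: power2_eq_square ennreal_top_mult)
      qed
    qed
  qed
  show int: "AE z in M. integrable N (\<lambda>c. h (\<pi> (z, c)) * D (z, c))"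
    using W_fin AE_space
  proof eventually_elim
    fix z assume z: "W z < \<infinity>" and [measurable]: "z \<in> space M"
    show "integrable N (\<lambda>c. h (\<pi> (z, c)) * D (z, c))"
      using z nonneg(1) by (auto simp: integrable_iff_bounded W_def abs_mult)
  qed
  have Gm: "(\<lambda>z. LINT c|N. h (\<pi> (z, c)) * D (z, c)) \<in> borel_measurable M"
    by measurable
  have G: "AE z in M. ennreal \<bar>LINT c|N. h (\<pi> (z, c)) * D (z, c)\<bar> \<le> W z"
    using int
  proof eventually_elim
    fix z assume "integrable N (\<lambda>c. h (\<pi> (z, c)) * D (z, c))"
    then have "ennreal (norm (LINT c|N. h (\<pi> (z, c)) * D (z, c))) \<le> (\<integral>\<^sup>+c. ennreal (norm (h (\<pi> (z, c)) * D (z, c))) \<partial>N)"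
      by (rule integral_norm_bound_ennreal)
    then show "ennreal \<bar>LINT c|N. h (\<pi> (z, c)) * D (z, c)\<bar> \<le> W z"
      using nonneg(1) by (simp add: W_def abs_mult)
  qed
  have "integrable M (\<lambda>z. (LINT c|N. h (\<pi> (z, c)) * D (z, c))\<^sup>2)"
  proof (rule integrableI_bounded)
    have "(\<integral>\<^sup>+z. ennreal (norm ((LINT c|N. h (\<pi> (z, c)) * D (z, c))\<^sup>2)) \<partial>M) \<le> (\<integral>\<^sup>+z. (W z)\<^sup>2 \<partial>M)"
    proof (rule nn_integral_mono_AE, use G in eventually_elim)
      fix z assume "ennreal \<bar>LINT c|N. h (\<pi> (z, c)) * D (z, c)\<bar> \<le> W z"
      then have "(ennreal \<bar>LINT c|N. h (\<pi> (z, c)) * D (z, c)\<bar>)\<^sup>2 \<le> (W z)\<^sup>2" by (rule power_mono) simp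
      then show "ennreal (norm ((LINT c|N. h (\<pi> (z, c)) * D (z, c))\<^sup>2)) \<le> (W z)\<^sup>2" by (simp add: ennreal_power)
    qed
    then show "(\<integral>\<^sup>+z. ennreal (norm ((LINT c|N. h (\<pi> (z, c)) * D (z, c))\<^sup>2)) \<partial>M) < \<infinity>"
      using W2_fin by (rule order_le_less_trans)
  qed (use Gm in simp)
  with Gm show "(\<lambda>z. LINT c|N. h (\<pi> (z, c)) * D (z, c)) \<in> L2 M" by (simp add: L2_def)
  show "integrable (M \<Otimes>\<^sub>M N) (\<lambda>x. f (fst x) * (h (\<pi> x) * D x))" if f: "f \<in> L2 M"
  proof (rule integrableI_bounded)
    note [measurable] = L2D(1)[OF f] and f2 = L2D(2)[OF f]
    have "(\<integral>\<^sup>+x. ennreal (norm (f (fst x) * (h (\<pi> x) * D x))) \<partial>(M \<Otimes>\<^sub>M N))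
      = (\<integral>\<^sup>+z. \<integral>\<^sup>+c. ennreal (norm (f (fst (z, c)) * (h (\<pi> (z, c)) * D (z, c)))) \<partial>N \<partial>M)"
      by (rule N.nn_integral_fst[symmetric]) measurable
    also have "\<dots> = (\<integral>\<^sup>+z. ennreal \<bar>f z\<bar> * W z \<partial>M)"
    proof (rule nn_integral_cong)
      fix z assume [measurable]: "z \<in> space M"
      have "(\<integral>\<^sup>+c. ennreal (norm (f (fst (z, c)) * (h (\<pi> (z, c)) * D (z, c)))) \<partial>N)
        = (\<integral>\<^sup>+c. ennreal \<bar>f z\<bar> * ennreal (\<bar>h (\<pi> (z, c))\<bar> * D (z, c)) \<partial>N)"
        using nonneg(1) by (simp add: abs_mult ennreal_mult)
      also have "\<dots> = ennreal \<bar>f z\<bar> * W z" unfolding W_def by (rule nn_integral_cmult) measurable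
      finally show "(\<integral>\<^sup>+c. ennreal (norm (f (fst (z, c)) * (h (\<pi> (z, c)) * D (z, c)))) \<partial>N) = ennreal \<bar>f z\<bar> * W z" .
    qed
    finally have eq: "(\<integral>\<^sup>+x. ennreal (norm (f (fst x) * (h (\<pi> x) * D x))) \<partial>(M \<Otimes>\<^sub>M N)) = (\<integral>\<^sup>+z. ennreal \<bar>f z\<bar> * W z \<partial>M)" .
    have "(\<integral>\<^sup>+z. ennreal \<bar>f z\<bar> * W z \<partial>M)\<^sup>2 \<le> (\<integral>\<^sup>+z. (ennreal \<bar>f z\<bar>)\<^sup>2 \<partial>M) * (\<integral>\<^sup>+z. (W z)\<^sup>2 \<partial>M)"
      by (rule Cauchy_Schwarz_nn_integral) measurable
    also have "\<dots> < \<infinity>"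
      using W2_fin f2 by (auto simp: integrable_iff_bounded ennreal_mult_less_top ennreal_power)
    finally show "(\<integral>\<^sup>+x. ennreal (norm (f (fst x) * (h (\<pi> x) * D x))) \<partial>(M \<Otimes>\<^sub>M N)) < \<infinity>"
    proof (rule contrapos_pp)
      assume "\<not> (\<integral>\<^sup>+x. ennreal (norm (f (fst x) * (h (\<pi> x) * D x))) \<partial>(M \<Otimes>\<^sub>M N)) < \<infinity>"
      then have "(\<integral>\<^sup>+z. ennreal \<bar>f z\<bar> * W z \<partial>M) = \<top>" unfolding eq by (simp add: less_top[symmetric])
      then show "\<not> (\<integral>\<^sup>+z. ennreal \<bar>f z\<bar> * W z \<partial>M)\<^sup>2 < \<infinity>" by (simp add: power2_eq_square ennreal_top_mult)
    qed
    show "(\<lambda>x. f (fst x) * (h (\<pi> x) * D x)) \<in> borel_measurable (M \<Otimes>\<^sub>M N)" by measurable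
  qed
qed

text \<open>
  One formula for the Maxwellians of all species, as a function of the state. It agrees with \<open>maxwellian\<close> at
  admissible internal energies.
\<close>

definition maxw :: "mixture \<Rightarrow> nat \<Rightarrow> (real^3) \<times> real \<Rightarrow> real" where
  "maxw X \<alpha> z = snd z powr (dof X \<alpha> / 2 - 1) * gibbs X \<alpha> z"

definition joint_gibbs :: "mixture \<Rightarrow> nat \<Rightarrow> nat \<Rightarrow> collision \<Rightarrow> real" where
  "joint_gibbs X \<alpha> \<beta> = (\<lambda>(z, zs, z', zs'). sqrt (gibbs X \<alpha> z * gibbs X \<beta> zs * gibbs X \<alpha> z' * gibbs X \<beta> zs'))"

text \<open>
  \<open>T\<close> permutes the states of a collision, and the first entry of \<open>T Z\<close> is the state at which \<open>h\<close> is evaluated.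
  \<open>sym_kernel\<close> is the density of the corresponding part of \<open>K\<close> with respect to \<open>collision_law\<close>; it is invariant
  under \<open>T\<close> up to the change of species. \<open>row_kernel\<close> is one of the two factors of its square, the other one is its transpose under \<open>T\<close>. The
  Schur weight \<open>sqrt (gibbs z / gibbs z\<^sub>T)\<close> is chosen such that both \<open>gibbs z\<close> and \<open>gibbs z\<^sub>T\<close> cancel, which leaves
  the two remaining states in \<open>row_kernel\<close>.
\<close>

definition sym_kernel :: "mixture \<Rightarrow> nat \<Rightarrow> nat \<Rightarrow> nat \<Rightarrow> (collision \<Rightarrow> collision) \<Rightarrow> collision \<Rightarrow> real" where
  "sym_kernel X \<alpha> \<beta> \<tau> T Z = joint_gibbs X \<alpha> \<beta> Z / (sqrt (maxw X \<alpha> (fst Z)) * sqrt (maxw X \<tau> (fst (T Z))))"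

definition row_kernel :: "mixture \<Rightarrow> nat \<Rightarrow> nat \<Rightarrow> nat \<Rightarrow> (collision \<Rightarrow> collision) \<Rightarrow> collision \<Rightarrow> real" where
  "row_kernel X \<alpha> \<beta> \<tau> T Z = joint_gibbs X \<alpha> \<beta> Z / maxw X \<alpha> (fst Z) * sqrt (gibbs X \<alpha> (fst Z) / gibbs X \<tau> (fst (T Z)))"

abbreviation cross_event :: "collision \<Rightarrow> collision" where
  "cross_event \<equiv> reverse_event \<circ> swap_event"

text \<open>
  The three parts of \<open>K\<close> evaluate \<open>h\<close> at \<open>z'\<close>, \<open>z'\<^sub>*\<close> and \<open>z\<^sub>*\<close>. In each case the permutation \<open>T\<close> is an involution that
  brings this state to the first place, and it maps collisions of species \<open>\<alpha>\<close> and \<open>\<beta>\<close> to collisions of species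
  \<open>\<tau>\<close> and \<open>\<beta>'\<close>.
\<close>

definition partner :: "nat \<Rightarrow> nat \<Rightarrow> nat \<Rightarrow> nat \<Rightarrow> (collision \<Rightarrow> collision) \<Rightarrow> bool" where
  "partner \<alpha> \<beta> \<tau> \<beta>' T \<longleftrightarrow>
     T = reverse_event \<and> \<tau> = \<alpha> \<and> \<beta>' = \<beta> \<or>
     T = cross_event \<and> \<tau> = \<beta> \<and> \<beta>' = \<alpha> \<or>
     T = swap_event \<and> \<tau> = \<beta> \<and> \<beta>' = \<alpha>"

lemma reverse_event_apply [simp]: "reverse_event (z, zs, z', zs') = (z', zs', z, zs)"
  and swap_event_apply [simp]: "swap_event (z, zs, z', zs') = (zs, z, zs', z')"
  by (simp_all add: reverse_event_def swap_event_def)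

lemma event_maps_distinct: "reverse_event \<noteq> swap_event" "reverse_event \<noteq> cross_event"
  by (auto dest!: fun_cong[of _ _ "((0, 0), (0, 1), (0, 2), (0, 3))"])

lemma maxw_measurable [measurable (raw)]:
  assumes [measurable]: "z \<in> borel_measurable M"
  shows "(\<lambda>x. maxw X \<alpha> (z x)) \<in> borel_measurable M"
  unfolding maxw_def by measurable

lemma joint_gibbs_measurable [measurable]: "joint_gibbs X \<alpha> \<beta> \<in> borel_measurable borel"
  unfolding joint_gibbs_def case_prod_beta by measurable

lemma partner_measurable: "partner \<alpha> \<beta> \<tau> \<beta>' T \<Longrightarrow> T \<in> borel_measurable borel"
  using measurable_comp[OF event_maps_measurable(2,1)] event_maps_measurable by (auto simp: partner_def)

lemma partner_involution: "partner \<alpha> \<beta> \<tau> \<beta>' T \<Longrightarrow> T (T Z) = Z"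
  by (cases Z rule: prod_cases4) (auto simp: partner_def)

lemma partner_sym: "partner \<alpha> \<beta> \<tau> \<beta>' T \<Longrightarrow> partner \<tau> \<beta>' \<alpha> \<beta> T"
  by (auto simp: partner_def)

lemma joint_gibbs_partner: "partner \<alpha> \<beta> \<tau> \<beta>' T \<Longrightarrow> joint_gibbs X \<tau> \<beta>' (T Z) = joint_gibbs X \<alpha> \<beta> Z"
  by (cases Z rule: prod_cases4) (auto simp: partner_def joint_gibbs_def mult_ac)

lemma sym_kernel_partner: "partner \<alpha> \<beta> \<tau> \<beta>' T \<Longrightarrow> sym_kernel X \<tau> \<beta>' \<alpha> T (T Z) = sym_kernel X \<alpha> \<beta> \<tau> T Z"
  by (simp add: sym_kernel_def joint_gibbs_partner partner_involution mult.commute)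

lemma partner_species: "partner \<alpha> \<beta> \<tau> \<beta>' T \<Longrightarrow> \<alpha> \<in> S \<Longrightarrow> \<beta> \<in> S \<Longrightarrow> \<tau> \<in> S \<and> \<beta>' \<in> S"
  by (auto simp: partner_def)

context gas_mixture
begin

lemma collision_law_partner:
  assumes p: "partner \<alpha> \<beta> \<tau> \<beta>' T" and sp: "\<alpha> \<in> species X" "\<beta> \<in> species X"
  shows "distr (collision_law X \<alpha> \<beta>) borel T = collision_law X \<tau> \<beta>'"
proof -
  have "distr (collision_law X \<alpha> \<beta>) borel (cross_event)
     = distr (distr (collision_law X \<alpha> \<beta>) borel swap_event) borel reverse_event"
  proof (rule distr_distr[symmetric])
    show "reverse_event \<in> borel_measurable borel" by measurable
    show "swap_event \<in> measurable (collision_law X \<alpha> \<beta>) borel" by measurable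
  qed
  then show ?thesis
    using p collision_law_reverse[OF sp] collision_law_swap[OF sp] collision_law_reverse[OF sp(2,1)]
    by (auto simp: partner_def)
qed

lemma sqrt_gibbs: "\<alpha> \<in> species X \<Longrightarrow> sqrt (gibbs X \<alpha> z) = sqrt (gibbs_const X \<alpha>) * exp (- (particle_energy X \<alpha> z / 2))"
proof -
  have "exp (- particle_energy X \<alpha> z) = (exp (- (particle_energy X \<alpha> z / 2)))\<^sup>2"
    by (simp add: power2_eq_square exp_add[symmetric])
  then show ?thesis by (simp add: gibbs_def real_sqrt_mult)
qed

end

context bounded_mixture
begin

context
  fixes \<alpha> \<beta> assumes sp: "\<alpha> \<in> species X" "\<beta> \<in> species X"
begin

lemma event_weight_nonzero:
  assumes "event_weight X \<alpha> \<beta> ((\<xi>, I), (\<xi>s, Is, I', Is', \<omega>)) \<noteq> 0"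
  obtains c where "norm \<omega> = 1" "collision_args X \<alpha> \<beta> (norm (\<xi> - \<xi>s)) c I Is I' Is'"
  using assms by (auto simp: coll_weight_def scat_def split: if_splits)

text \<open>
  Here \<open>B\<close> does not depend on \<open>z\<close>, but \<open>K\<close> may: uniform bounds on the kernels of \<open>K\<close> and the mere finiteness of
  the collision frequency at each state follow from the same estimate.
\<close>

lemma tail_dominated_bound:
  assumes a: "a > 0"
  shows "\<exists>B\<ge>0. \<forall>z k K. internal_energy X \<alpha> (snd z) \<longrightarrow> 0 \<le> K \<longrightarrow>
    (\<forall>c. event_weight X \<alpha> \<beta> (z, c) \<noteq> 0 \<longrightarrow> k c \<le> K * tail X \<alpha> a (coll_event X \<alpha> \<beta> (z, c))) \<longrightarrow>
    (\<integral>\<^sup>+c. ennreal (k c) * ennreal (event_weight X \<alpha> \<beta> (z, c)) \<partial>coll_measure X \<alpha> \<beta>) \<le> ennreal (K * B)"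
proof -
  obtain B where B: "\<And>z. internal_energy X \<alpha> (snd z) \<Longrightarrow>
    (\<integral>\<^sup>+c. ennreal (tail X \<alpha> a (coll_event X \<alpha> \<beta> (z, c))) * ennreal (event_weight X \<alpha> \<beta> (z, c)) \<partial>coll_measure X \<alpha> \<beta>) \<le> ennreal B"
    using tail_estimate[OF sp a] by blast
  have tm: "tail X \<alpha> a \<in> borel_measurable borel"
  proof -
    have "tail X \<alpha> a = (\<lambda>((\<xi>, I), (\<xi>s, Is), (\<xi>', I'), (\<xi>s', Is')). tail X \<alpha> a ((\<xi>, I), (\<xi>s, Is), (\<xi>', I'), (\<xi>s', Is')))"
      by auto
    also have "\<dots> \<in> borel_measurable borel" unfolding tail.simps case_prod_beta by measurable
    finally show ?thesis .
  qed
  note [measurable] = event_weight_measurable[OF sp] tm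
  have "(\<integral>\<^sup>+c. ennreal (k c) * ennreal (event_weight X \<alpha> \<beta> (z, c)) \<partial>coll_measure X \<alpha> \<beta>) \<le> ennreal (K * max 0 B)"
    if z: "internal_energy X \<alpha> (snd z)" and K: "0 \<le> K"
      and k: "\<And>c. event_weight X \<alpha> \<beta> (z, c) \<noteq> 0 \<Longrightarrow> k c \<le> K * tail X \<alpha> a (coll_event X \<alpha> \<beta> (z, c))" for z k K
  proof -
    have "(\<integral>\<^sup>+c. ennreal (k c) * ennreal (event_weight X \<alpha> \<beta> (z, c)) \<partial>coll_measure X \<alpha> \<beta>)
      \<le> (\<integral>\<^sup>+c. ennreal K * (ennreal (tail X \<alpha> a (coll_event X \<alpha> \<beta> (z, c))) * ennreal (event_weight X \<alpha> \<beta> (z, c))) \<partial>coll_measure X \<alpha> \<beta>)"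
    proof (rule nn_integral_mono)
      fix c
      show "ennreal (k c) * ennreal (event_weight X \<alpha> \<beta> (z, c))
        \<le> ennreal K * (ennreal (tail X \<alpha> a (coll_event X \<alpha> \<beta> (z, c))) * ennreal (event_weight X \<alpha> \<beta> (z, c)))"
      proof (cases "event_weight X \<alpha> \<beta> (z, c) = 0")
        case False
        have "ennreal (k c) \<le> ennreal (K * tail X \<alpha> a (coll_event X \<alpha> \<beta> (z, c)))" using k[OF False] by (rule ennreal_leI)
        also have "\<dots> = ennreal K * ennreal (tail X \<alpha> a (coll_event X \<alpha> \<beta> (z, c)))" using K by (rule ennreal_mult')
        finally show ?thesis unfolding mult.assoc[symmetric] by (rule mult_right_mono) simp
      qed simp
    qed
    also have "\<dots> = ennreal K * (\<integral>\<^sup>+c. ennreal (tail X \<alpha> a (coll_event X \<alpha> \<beta> (z, c))) * ennreal (event_weight X \<alpha> \<beta> (z, c)) \<partial>coll_measure X \<alpha> \<beta>)"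
      by (rule nn_integral_cmult) measurable
    also have "\<dots> \<le> ennreal K * ennreal (max 0 B)"
      using B[OF z] by (intro mult_left_mono order_trans[OF B[OF z]] ennreal_leI) auto
    also have "\<dots> = ennreal (K * max 0 B)" using K by (simp add: ennreal_mult)
    finally show ?thesis .
  qed
  then show ?thesis by (intro exI[of _ "max 0 B"]) auto
qed

lemma exp_le_tail:
  assumes "0 < I" and "a * (norm \<xi>s)\<^sup>2 + a * Is + a * (norm v)\<^sup>2 \<le> x" and "v = \<xi>' \<or> v = \<xi>s'"
  shows "exp (- x) / I powr (dof X \<alpha> / 2 - 1) \<le> tail X \<alpha> a ((\<xi>, I), (\<xi>s, Is), (\<xi>', I'), (\<xi>s', Is'))"
proof -
  have "exp (- x) \<le> exp (- a * (norm \<xi>s)\<^sup>2 + - a * Is + - a * (norm v)\<^sup>2)" using assms(2) by simp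
  also have "\<dots> = exp (- a * (norm \<xi>s)\<^sup>2) * exp (- a * Is) * exp (- a * (norm v)\<^sup>2)" by (simp only: exp_add)
  also have "\<dots> \<le> exp (- a * (norm \<xi>s)\<^sup>2) * exp (- a * Is) * (exp (- a * (norm \<xi>')\<^sup>2) + exp (- a * (norm \<xi>s')\<^sup>2))"
    using assms(3) by (intro mult_left_mono) auto
  finally show ?thesis by (simp add: divide_right_mono)
qed

text \<open>
  Gibbs factors enter the row kernels through square roots, and in one case half of the exponent is traded by
  energy conservation. A quarter of the energy is what remains to dominate the exponents in \<open>tail\<close>.
\<close>

lemma energy_ge:
  assumes "\<delta> \<in> species X" "8 * a \<le> mass X \<delta>" "4 * a \<le> 1" "0 \<le> I"
  shows "4 * (a * (norm \<xi>)\<^sup>2 + a * I) \<le> particle_energy X \<delta> (\<xi>, I)"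
proof -
  have "4 * a * (norm \<xi>)\<^sup>2 \<le> mass X \<delta> / 2 * (norm \<xi>)\<^sup>2" using assms by (intro mult_right_mono) auto
  moreover have "4 * a * I \<le> 1 * I" using assms by (intro mult_right_mono) auto
  ultimately show ?thesis by (simp add: particle_energy_def distrib_left)
qed

text \<open>
  With the square roots of the four Gibbs factors, \<open>joint_gibbs\<close> is their product, and the Schur weight
  replaces the root that belongs to the partner state by the one that belongs to \<open>z\<close>.
\<close>

lemma row_kernel_formula:
  assumes p: "partner \<alpha> \<beta> \<tau> \<beta>' T" and I: "0 < snd z"
  shows "row_kernel X \<alpha> \<beta> \<tau> T (z, zs, z', zs') =
    (if T = reverse_event then sqrt (gibbs X \<beta> zs) * sqrt (gibbs X \<beta> zs')
     else if T = swap_event then sqrt (gibbs X \<alpha> z') * sqrt (gibbs X \<beta> zs')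
     else sqrt (gibbs X \<beta> zs) * sqrt (gibbs X \<alpha> z')) / snd z powr (dof X \<alpha> / 2 - 1)"
proof -
  define s1 s2 s3 s4 where s: "s1 = sqrt (gibbs X \<alpha> z)" "s2 = sqrt (gibbs X \<beta> zs)" "s3 = sqrt (gibbs X \<alpha> z')" "s4 = sqrt (gibbs X \<beta> zs')"
  have pos: "0 < s1" "0 < s2" "0 < s3" "0 < s4" using gibbs_pos sp by (simp_all add: s)
  have g: "gibbs X \<alpha> z = s1\<^sup>2" using gibbs_pos[OF sp(1), of z] by (simp add: s less_imp_le)
  have Ip: "0 < snd z powr (dof X \<alpha> / 2 - 1)" using I by simp
  show ?thesis
  proof (cases "T = reverse_event")
    case True
    then have "row_kernel X \<alpha> \<beta> \<tau> T (z, zs, z', zs') = s1 * s2 * s3 * s4 / (snd z powr (dof X \<alpha> / 2 - 1) * s1\<^sup>2) * (s1 / s3)"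
      using p by (auto simp: partner_def row_kernel_def joint_gibbs_def maxw_def real_sqrt_mult real_sqrt_divide
          s[symmetric] g[symmetric] event_maps_distinct)
    then show ?thesis using True pos Ip by (simp add: s[symmetric] power2_eq_square)
  next
    case nr: False
    show ?thesis
    proof (cases "T = swap_event")
      case True
      then have "\<tau> = \<beta>" using p nr by (auto simp: partner_def)
      then have "row_kernel X \<alpha> \<beta> \<tau> T (z, zs, z', zs') = s1 * s2 * s3 * s4 / (snd z powr (dof X \<alpha> / 2 - 1) * s1\<^sup>2) * (s1 / s2)"
        using True by (simp add: row_kernel_def joint_gibbs_def maxw_def real_sqrt_mult real_sqrt_divide s[symmetric] g[symmetric])
      then show ?thesis using True nr pos Ip by (simp add: s[symmetric] power2_eq_square)
    next
      case False
      then have "\<tau> = \<beta>" "T = cross_event" using p nr by (auto simp: partner_def)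
      then have "row_kernel X \<alpha> \<beta> \<tau> T (z, zs, z', zs') = s1 * s2 * s3 * s4 / (snd z powr (dof X \<alpha> / 2 - 1) * s1\<^sup>2) * (s1 / s4)"
        by (simp add: row_kernel_def joint_gibbs_def maxw_def real_sqrt_mult real_sqrt_divide s[symmetric] g[symmetric])
      then show ?thesis using False nr pos Ip by (simp add: s[symmetric] power2_eq_square)
    qed
  qed
qed

lemma nonzero_event_energies:
  assumes a: "0 < a" "4 * a \<le> 1" "8 * a \<le> mass X \<alpha>" "8 * a \<le> mass X \<beta>"
    and nz: "event_weight X \<alpha> \<beta> ((\<xi>, I), c) \<noteq> 0"
  obtains \<xi>s Is v I' vs Is' where "coll_event X \<alpha> \<beta> ((\<xi>, I), c) = ((\<xi>, I), (\<xi>s, Is), (v, I'), (vs, Is'))" and "0 < I"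
    and "particle_energy X \<alpha> (v, I') + particle_energy X \<beta> (vs, Is') = particle_energy X \<alpha> (\<xi>, I) + particle_energy X \<beta> (\<xi>s, Is)"
    and "0 \<le> particle_energy X \<alpha> (\<xi>, I)" and "0 \<le> a * (norm \<xi>s)\<^sup>2 + a * Is"
    and "4 * (a * (norm \<xi>s)\<^sup>2 + a * Is) \<le> particle_energy X \<beta> (\<xi>s, Is)"
    and "0 \<le> a * (norm v)\<^sup>2" and "4 * (a * (norm v)\<^sup>2) \<le> particle_energy X \<alpha> (v, I')"
    and "0 \<le> a * (norm vs)\<^sup>2" and "4 * (a * (norm vs)\<^sup>2) \<le> particle_energy X \<beta> (vs, Is')"
proof -
  obtain \<xi>s Is I' Is' \<omega> where cc: "c = (\<xi>s, Is, I', Is', \<omega>)" by (cases c)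
  obtain d where \<omega>: "norm \<omega> = 1" and d: "collision_args X \<alpha> \<beta> (norm (\<xi> - \<xi>s)) d I Is I' Is'"
    using event_weight_nonzero nz unfolding cc by blast
  have pos: "0 < I" "0 < Is" "0 < I'" "0 < Is'"
    using d internal_energy_pos by (auto simp: collision_args_def)
  define v where "v = post_vel X \<alpha> \<beta> \<xi> \<xi>s I Is I' Is' \<omega>"
  define vs where "vs = post_vel_s X \<alpha> \<beta> \<xi> \<xi>s I Is I' Is' \<omega>"
  have ge: "4 * (a * (norm \<xi>)\<^sup>2 + a * I) \<le> particle_energy X \<alpha> (\<xi>, I)"
    "4 * (a * (norm \<xi>s)\<^sup>2 + a * Is) \<le> particle_energy X \<beta> (\<xi>s, Is)"
    "4 * (a * (norm v)\<^sup>2 + a * I') \<le> particle_energy X \<alpha> (v, I')"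
    "4 * (a * (norm vs)\<^sup>2 + a * Is') \<le> particle_energy X \<beta> (vs, Is')"
    using energy_ge a sp pos by (simp_all add: less_imp_le)
  have nn: "0 \<le> a * (norm \<xi>)\<^sup>2" "0 \<le> a * I" "0 \<le> a * (norm \<xi>s)\<^sup>2" "0 \<le> a * Is"
    "0 \<le> a * (norm v)\<^sup>2" "0 \<le> a * I'" "0 \<le> a * (norm vs)\<^sup>2" "0 \<le> a * Is'"
    using a pos by auto
  show ?thesis
  proof (rule that)
    show "coll_event X \<alpha> \<beta> ((\<xi>, I), c) = ((\<xi>, I), (\<xi>s, Is), (v, I'), (vs, Is'))"
      by (simp add: cc v_def vs_def)
    show "particle_energy X \<alpha> (v, I') + particle_energy X \<beta> (vs, Is') = particle_energy X \<alpha> (\<xi>, I) + particle_energy X \<beta> (\<xi>s, Is)"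
      unfolding v_def vs_def by (rule energy_conservation[OF sp \<omega> d])
  qed (use ge nn pos in argo)+
qed

lemma tail_rate:
  obtains a where "0 < a" "4 * a \<le> 1" "8 * a \<le> mass X \<alpha>" "8 * a \<le> mass X \<beta>"
proof
  show "0 < min (1/8) (min (mass X \<alpha> / 8) (mass X \<beta> / 8))"
    using mass_pos[OF sp(1)] mass_pos[OF sp(2)] by simp
qed auto

text \<open>
  If \<open>z\<^sub>*\<close> is one of the two states in the row kernel, the Gibbs factors decay in \<open>z\<^sub>*\<close> and in a velocity after the
  collision, as \<open>tail\<close> does. For the partner \<open>z\<^sub>*\<close> the row kernel contains \<open>z'\<close> and \<open>z'\<^sub>*\<close>, and half of their
  energy is traded for that of \<open>z\<^sub>*\<close> by energy conservation.
\<close>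

lemma row_kernel_bound:
  assumes p: "partner \<alpha> \<beta> \<tau> \<beta>' T"
  shows "\<exists>B\<ge>0. \<forall>z. internal_energy X \<alpha> (snd z) \<longrightarrow>
    (\<integral>\<^sup>+c. ennreal (row_kernel X \<alpha> \<beta> \<tau> T (coll_event X \<alpha> \<beta> (z, c))) * ennreal (event_weight X \<alpha> \<beta> (z, c)) \<partial>coll_measure X \<alpha> \<beta>) \<le> ennreal B"
proof -
  obtain a where a: "0 < a" "4 * a \<le> 1" "8 * a \<le> mass X \<alpha>" "8 * a \<le> mass X \<beta>" by (rule tail_rate)
  define k1 where "k1 = sqrt (gibbs_const X \<alpha>)"
  define k2 where "k2 = sqrt (gibbs_const X \<beta>)"
  have k: "0 < k1" "0 < k2" using gibbs_const_pos sp by (simp_all add: k1_def k2_def)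
  define K where "K = max (k2 * k2) (k1 * k2)"
  have K: "0 \<le> K" "k2 * k2 \<le> K" "k1 * k2 \<le> K" using k by (simp_all add: K_def le_max_iff_disj)
  obtain B where B: "B \<ge> 0" "\<And>z k K. internal_energy X \<alpha> (snd z) \<Longrightarrow> 0 \<le> K \<Longrightarrow>
    (\<And>c. event_weight X \<alpha> \<beta> (z, c) \<noteq> 0 \<Longrightarrow> k c \<le> K * tail X \<alpha> a (coll_event X \<alpha> \<beta> (z, c))) \<Longrightarrow>
    (\<integral>\<^sup>+c. ennreal (k c) * ennreal (event_weight X \<alpha> \<beta> (z, c)) \<partial>coll_measure X \<alpha> \<beta>) \<le> ennreal (K * B)"
    using tail_dominated_bound[OF a(1)] by blast
  have main: "row_kernel X \<alpha> \<beta> \<tau> T (coll_event X \<alpha> \<beta> ((\<xi>, I), c)) \<le> K * tail X \<alpha> a (coll_event X \<alpha> \<beta> ((\<xi>, I), c))"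
    if nz: "event_weight X \<alpha> \<beta> ((\<xi>, I), c) \<noteq> 0" for \<xi> I c
  proof (rule nonzero_event_energies[OF a nz])
    fix \<xi>s Is v I' vs Is'
    define E Es E' Es' where E: "E = particle_energy X \<alpha> (\<xi>, I)" "Es = particle_energy X \<beta> (\<xi>s, Is)"
      "E' = particle_energy X \<alpha> (v, I')" "Es' = particle_energy X \<beta> (vs, Is')"
    assume ev: "coll_event X \<alpha> \<beta> ((\<xi>, I), c) = ((\<xi>, I), (\<xi>s, Is), (v, I'), (vs, Is'))" and I: "0 < I"
      and "particle_energy X \<alpha> (v, I') + particle_energy X \<beta> (vs, Is') = particle_energy X \<alpha> (\<xi>, I) + particle_energy X \<beta> (\<xi>s, Is)"
      and "0 \<le> particle_energy X \<alpha> (\<xi>, I)" and "0 \<le> a * (norm \<xi>s)\<^sup>2 + a * Is"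
      and "4 * (a * (norm \<xi>s)\<^sup>2 + a * Is) \<le> particle_energy X \<beta> (\<xi>s, Is)"
      and "0 \<le> a * (norm v)\<^sup>2" and "4 * (a * (norm v)\<^sup>2) \<le> particle_energy X \<alpha> (v, I')"
      and "0 \<le> a * (norm vs)\<^sup>2" and "4 * (a * (norm vs)\<^sup>2) \<le> particle_energy X \<beta> (vs, Is')"
    note en = this(3-10)[folded E]
    have sq: "sqrt (gibbs X \<alpha> (v, I')) = k1 * exp (- (E' / 2))" "sqrt (gibbs X \<beta> (\<xi>s, Is)) = k2 * exp (- (Es / 2))"
      "sqrt (gibbs X \<beta> (vs, Is')) = k2 * exp (- (Es' / 2))"
      unfolding E k1_def k2_def using sqrt_gibbs sp by simp_all
    have e2: "exp (- (x + y)) = exp (- x) * exp (- y)" for x y :: real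
      by (simp add: exp_add[symmetric])
    let ?Z = "((\<xi>, I), (\<xi>s, Is), (v, I'), (vs, Is'))" and ?Ip = "I powr (dof X \<alpha> / 2 - 1)"
    note formula = row_kernel_formula[OF p, of "(\<xi>, I)" "(\<xi>s, Is)" "(v, I')" "(vs, Is')"]
    have scale: "kk * (exp (- x) / ?Ip) \<le> K * tail X \<alpha> a ?Z"
      if "0 \<le> kk" "kk \<le> K" "a * (norm \<xi>s)\<^sup>2 + a * Is + a * (norm w)\<^sup>2 \<le> x" "w = v \<or> w = vs" for kk x w
      using exp_le_tail[OF I that(3,4)] that(1,2) by (intro mult_mono) auto
    consider "T = reverse_event" | "T \<noteq> reverse_event" "T = swap_event" | "T \<noteq> reverse_event" "T \<noteq> swap_event" by blast
    then have "row_kernel X \<alpha> \<beta> \<tau> T ?Z \<le> K * tail X \<alpha> a ?Z"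
    proof cases
      case 1
      have "row_kernel X \<alpha> \<beta> \<tau> T ?Z = k2 * k2 * (exp (- (Es / 2 + Es' / 2)) / ?Ip)"
        unfolding e2 using 1 I formula by (simp add: sq)
      then show ?thesis using scale[of "k2 * k2" vs "Es / 2 + Es' / 2"] k K en by simp
    next
      case 2
      have "row_kernel X \<alpha> \<beta> \<tau> T ?Z = k1 * k2 * (exp (- (E' / 2 + Es' / 2)) / ?Ip)"
        unfolding e2 using 2 I formula by (simp add: sq)
      moreover have "a * (norm \<xi>s)\<^sup>2 + a * Is + a * (norm v)\<^sup>2 \<le> E' / 2 + Es' / 2" using en by argo
      ultimately show ?thesis using scale[of "k1 * k2" v "E' / 2 + Es' / 2"] k K by simp
    next
      case 3
      have "row_kernel X \<alpha> \<beta> \<tau> T ?Z = k1 * k2 * (exp (- (Es / 2 + E' / 2)) / ?Ip)"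
        unfolding e2 using 3 I formula by (simp add: sq)
      then show ?thesis using scale[of "k1 * k2" v "Es / 2 + E' / 2"] k K en by simp
    qed
    then show ?thesis unfolding ev .
  qed
  have "(\<integral>\<^sup>+c. ennreal (row_kernel X \<alpha> \<beta> \<tau> T (coll_event X \<alpha> \<beta> (z, c))) * ennreal (event_weight X \<alpha> \<beta> (z, c)) \<partial>coll_measure X \<alpha> \<beta>) \<le> ennreal (K * B)"
    if "internal_energy X \<alpha> (snd z)" for z
    using that main[of "fst z" "snd z"] by (intro B(2) K(1)) simp_all
  then show ?thesis using B(1) K(1) by (intro exI[of _ "K * B"]) auto
qed

text \<open>
  Energy conservation gives \<open>gibbs z\<^sub>* = exp (E / 2) exp (- E\<^sub>* / 2) exp (- (E' + E'\<^sub>*) / 2)\<close> up to a constant, so the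
  integrand is dominated by \<open>tail\<close>, with a factor that depends on the energy \<open>E\<close> of the fixed state.
\<close>

lemma collision_frequency_finite:
  assumes z: "internal_energy X \<alpha> I"
  shows "(\<integral>\<^sup>+c. ennreal (gibbs X \<beta> (fst (snd (coll_event X \<alpha> \<beta> ((\<xi>, I), c)))) / I powr (dof X \<alpha> / 2 - 1))
    * ennreal (event_weight X \<alpha> \<beta> ((\<xi>, I), c)) \<partial>coll_measure X \<alpha> \<beta>) < \<infinity>"
proof -
  obtain a where a: "0 < a" "4 * a \<le> 1" "8 * a \<le> mass X \<alpha>" "8 * a \<le> mass X \<beta>" by (rule tail_rate)
  define K where "K = gibbs_const X \<beta> * exp (particle_energy X \<alpha> (\<xi>, I) / 2)"
  have K0: "0 \<le> K" using gibbs_const_pos[OF sp(2)] by (simp add: K_def)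
  obtain B where B: "B \<ge> 0" "\<And>z k K. internal_energy X \<alpha> (snd z) \<Longrightarrow> 0 \<le> K \<Longrightarrow>
    (\<And>c. event_weight X \<alpha> \<beta> (z, c) \<noteq> 0 \<Longrightarrow> k c \<le> K * tail X \<alpha> a (coll_event X \<alpha> \<beta> (z, c))) \<Longrightarrow>
    (\<integral>\<^sup>+c. ennreal (k c) * ennreal (event_weight X \<alpha> \<beta> (z, c)) \<partial>coll_measure X \<alpha> \<beta>) \<le> ennreal (K * B)"
    using tail_dominated_bound[OF a(1)] by blast
  have "gibbs X \<beta> (fst (snd (coll_event X \<alpha> \<beta> ((\<xi>, I), c)))) / I powr (dof X \<alpha> / 2 - 1) \<le> K * tail X \<alpha> a (coll_event X \<alpha> \<beta> ((\<xi>, I), c))"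
    if nz: "event_weight X \<alpha> \<beta> ((\<xi>, I), c) \<noteq> 0" for c
  proof (rule nonzero_event_energies[OF a nz])
    fix \<xi>s Is v I' vs Is'
    let ?E = "particle_energy X \<alpha> (\<xi>, I)" and ?Es = "particle_energy X \<beta> (\<xi>s, Is)"
      and ?E' = "particle_energy X \<alpha> (v, I')" and ?Es' = "particle_energy X \<beta> (vs, Is')"
    assume ev: "coll_event X \<alpha> \<beta> ((\<xi>, I), c) = ((\<xi>, I), (\<xi>s, Is), (v, I'), (vs, Is'))" and I: "0 < I"
      and cons: "?E' + ?Es' = ?E + ?Es" and nn: "0 \<le> a * (norm \<xi>s)\<^sup>2 + a * Is" "0 \<le> a * (norm v)\<^sup>2" "0 \<le> a * (norm vs)\<^sup>2"
      and ge: "4 * (a * (norm \<xi>s)\<^sup>2 + a * Is) \<le> ?Es" "4 * (a * (norm v)\<^sup>2) \<le> ?E'" "4 * (a * (norm vs)\<^sup>2) \<le> ?Es'"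
    have x: "a * (norm \<xi>s)\<^sup>2 + a * Is + a * (norm v)\<^sup>2 \<le> ?E / 2 + ?Es" using ge nn cons by argo
    have "gibbs X \<beta> (\<xi>s, Is) = K * exp (- (?E / 2 + ?Es))"
      by (simp add: gibbs_def K_def exp_add[symmetric] exp_minus[symmetric])
    then have "gibbs X \<beta> (\<xi>s, Is) / I powr (dof X \<alpha> / 2 - 1) = K * (exp (- (?E / 2 + ?Es)) / I powr (dof X \<alpha> / 2 - 1))"
      by (simp only: times_divide_eq_right)
    also have "\<dots> \<le> K * tail X \<alpha> a ((\<xi>, I), (\<xi>s, Is), (v, I'), (vs, Is'))"
      using exp_le_tail[OF I x] K0 by (intro mult_left_mono) auto
    finally show ?thesis unfolding ev fst_conv snd_conv .
  qed
  then have "(\<integral>\<^sup>+c. ennreal (gibbs X \<beta> (fst (snd (coll_event X \<alpha> \<beta> ((\<xi>, I), c)))) / I powr (dof X \<alpha> / 2 - 1))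
    * ennreal (event_weight X \<alpha> \<beta> ((\<xi>, I), c)) \<partial>coll_measure X \<alpha> \<beta>) \<le> ennreal (K * B)"
    using z by (intro B(2) K0) auto
  also have "\<dots> < \<infinity>" by simp
  finally show ?thesis .
qed

end

end

section \<open>The parts of the operator \<open>K\<close>\<close>

lemma maxwellian_measurable [measurable (raw)]:
  assumes [measurable]: "\<xi> \<in> borel_measurable M" "I \<in> borel_measurable M"
  shows "(\<lambda>x. maxwellian X \<alpha> (\<xi> x) (I x)) \<in> borel_measurable M"
  unfolding maxwellian_def by (cases "monatomic X \<alpha>") simp_all

lemma L2_phase_measurable: "f \<in> L2 (phase X \<alpha>) \<Longrightarrow> f \<in> borel_measurable borel"
  using L2D(1)[of f "phase X \<alpha>"] unfolding measurable_cong_sets[OF sets_phase refl] .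

lemma AE_phase: "AE z in phase X \<alpha>. internal_energy X \<alpha> (snd z)"
  unfolding phase_def
proof (rule phase.AE_pair_measure)
  show "{z \<in> space (lborel \<Otimes>\<^sub>M internal_measure X \<alpha>). internal_energy X \<alpha> (snd z)} \<in> sets (lborel \<Otimes>\<^sub>M internal_measure X \<alpha>)"
    by measurable
  show "AE x in lborel. AE y in internal_measure X \<alpha>. internal_energy X \<alpha> (snd (x, y))"
    using AE_internal_energy by simp
qed

lemma AE_coll:
  "AE (\<xi>s, Is, I', Is', \<omega>) in coll_measure X \<alpha> \<beta>.
     internal_energy X \<beta> Is \<and> internal_energy X \<alpha> I' \<and> internal_energy X \<beta> Is' \<and> norm \<omega> = 1"
proof -
  let ?ok = "\<lambda>Is I' Is' \<omega>. internal_energy X \<beta> Is \<and> internal_energy X \<alpha> I' \<and> internal_energy X \<beta> Is' \<and> norm (\<omega> :: real^3) = 1"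
  let ?f = "\<lambda>(\<xi>s :: real^3, Is, I', Is', \<omega>). if ?ok Is I' Is' \<omega> then 0 else 1 :: ennreal"
  have fm: "?f \<in> borel_measurable borel"
    unfolding case_prod_beta by measurable
  have "(\<integral>\<^sup>+c. ?f c \<partial>coll_measure X \<alpha> \<beta>) = (\<integral>\<^sup>+(\<xi>s :: real^3). \<integral>\<^sup>+Is. \<integral>\<^sup>+I'. \<integral>\<^sup>+Is'. \<integral>\<^sup>+\<omega>. (if ?ok Is I' Is' \<omega> then 0 else 1)
     \<partial>sphere_measure \<partial>internal_measure X \<beta> \<partial>internal_measure X \<alpha> \<partial>internal_measure X \<beta> \<partial>lborel)"
    unfolding nn_integral_coll_measure[OF fm] prod.case ..
  also have "\<dots> = (\<integral>\<^sup>+(\<xi>s :: real^3). \<integral>\<^sup>+Is. \<integral>\<^sup>+I'. \<integral>\<^sup>+Is'. \<integral>\<^sup>+(\<omega> :: real^3). 0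
     \<partial>sphere_measure \<partial>internal_measure X \<beta> \<partial>internal_measure X \<alpha> \<partial>internal_measure X \<beta> \<partial>lborel)"
  proof (rule nn_integral_cong, rule nn_integral_cong_AE, use AE_internal_energy in eventually_elim,
      rule nn_integral_cong_AE, use AE_internal_energy in eventually_elim,
      rule nn_integral_cong_AE, use AE_internal_energy in eventually_elim,
      rule nn_integral_cong_AE, use AE_sphere_norm in eventually_elim)
  qed auto
  finally have "(\<integral>\<^sup>+c. ?f c \<partial>coll_measure X \<alpha> \<beta>) = 0" by simp
  moreover have "?f \<in> borel_measurable (coll_measure X \<alpha> \<beta>)"
    unfolding measurable_cong_sets[OF sets_coll_measure refl] by (rule fm)
  ultimately have "AE c in coll_measure X \<alpha> \<beta>. ?f c = 0" by (simp add: nn_integral_0_iff_AE)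
  then show ?thesis by eventually_elim (auto split: if_splits)
qed

text \<open>
  The part of \<open>K\<close> that evaluates \<open>h\<close> at the partner state selected by \<open>T\<close>.
\<close>

definition gain_term :: "mixture \<Rightarrow> nat \<Rightarrow> nat \<Rightarrow> nat \<Rightarrow> (collision \<Rightarrow> collision) \<Rightarrow> ((real^3) \<times> real \<Rightarrow> real)
    \<Rightarrow> (real^3) \<times> real \<Rightarrow> real" where
  "gain_term X \<alpha> \<beta> \<tau> T h z = (LINT c|coll_measure X \<alpha> \<beta>. h (fst (T (coll_event X \<alpha> \<beta> (z, c)))) *
     (sym_kernel X \<alpha> \<beta> \<tau> T (coll_event X \<alpha> \<beta> (z, c)) * event_weight X \<alpha> \<beta> (z, c)))"

context gas_mixture
begin

context
  fixes \<alpha> \<beta> assumes sp: "\<alpha> \<in> species X" "\<beta> \<in> species X"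
begin

lemma trans_weight_eq:
  assumes i: "internal_energy X \<alpha> I" "internal_energy X \<beta> Is" "internal_energy X \<alpha> I'" "internal_energy X \<beta> Is'"
    and \<omega>: "norm \<omega> = 1"
  shows "trans_weight X \<alpha> \<beta> \<xi> \<xi>s I Is I' Is' \<omega> = coll_weight X \<alpha> \<beta> \<xi> \<xi>s I Is I' Is' \<omega>"
proof -
  let ?r = "norm (\<xi> - \<xi>s)" and ?m = "red_mass X \<alpha> \<beta>"
  let ?r' = "post_speed X \<alpha> \<beta> ?r I Is I' Is'"
  let ?g' = "post_vel X \<alpha> \<beta> \<xi> \<xi>s I Is I' Is' \<omega> - post_vel_s X \<alpha> \<beta> \<xi> \<xi>s I Is I' Is' \<omega>"
  have g': "?g' = ?r' *\<^sub>R \<omega>"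
  proof -
    have "?g' = ((mass X \<alpha> / (mass X \<alpha> + mass X \<beta>) + mass X \<beta> / (mass X \<alpha> + mass X \<beta>)) * ?r') *\<^sub>R \<omega>"
      by (simp add: post_vel_def post_vel_s_def algebra_simps)
    then show ?thesis unfolding mass_fractions[OF sp] by simp
  qed
  show ?thesis
  proof (cases "0 < ?r \<and> 2 * energy_gap I Is I' Is' < ?m * ?r\<^sup>2")
    case False
    then show ?thesis using \<omega> by (auto simp: trans_weight_def Let_def coll_weight_def scat_def collision_args_def)
  next
    case True
    then have "2 * energy_gap I Is I' Is' / ?m < ?r\<^sup>2" using red_mass_pos[OF sp] by (simp add: field_simps)
    then have r': "0 < ?r'" using True by (intro post_speed_facts(2)[OF sp]) auto
    have c: "cos_angle (\<xi> - \<xi>s) ?g' = (\<xi> - \<xi>s) \<bullet> \<omega> / ?r"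
      unfolding g' cos_angle_def using r' \<omega> by simp
    have "\<bar>(\<xi> - \<xi>s) \<bullet> \<omega>\<bar> \<le> ?r" using Cauchy_Schwarz_ineq2[of "\<xi> - \<xi>s" \<omega>] \<omega> by simp
    then have "- 1 \<le> (\<xi> - \<xi>s) \<bullet> \<omega> / ?r" "(\<xi> - \<xi>s) \<bullet> \<omega> / ?r \<le> 1" using True by (auto simp: field_simps abs_le_iff)
    then have "collision_args X \<alpha> \<beta> ?r ((\<xi> - \<xi>s) \<bullet> \<omega> / ?r) I Is I' Is'"
      using True i by (simp add: collision_args_def)
    then show ?thesis using True \<omega> by (simp add: trans_weight_def Let_def c coll_weight_def scat_def)
  qed
qed

text \<open>
  The weights \<open>I powr (\<delta> / 2 - 1)\<close> in the Maxwellians cancel against the denominator in \<open>K_fun\<close>, except for the one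
  that completes \<open>gibbs z\<close> to the Maxwellian of \<open>z\<close>. This exhibits the symmetric kernels.
\<close>

lemma K_integrand_split:
  assumes I: "internal_energy X \<alpha> I"
  shows "AE c in coll_measure X \<alpha> \<beta>. coll_integrand X \<alpha> \<beta> \<xi> I (K_fun X \<alpha> \<beta> h I) c =
    (let Z = coll_event X \<alpha> \<beta> ((\<xi>, I), c); w = event_weight X \<alpha> \<beta> ((\<xi>, I), c); T = cross_event in
      h \<alpha> (fst (reverse_event Z)) * (sym_kernel X \<alpha> \<beta> \<alpha> reverse_event Z * w)
      + h \<beta> (fst (T Z)) * (sym_kernel X \<alpha> \<beta> \<beta> T Z * w)
      - h \<beta> (fst (swap_event Z)) * (sym_kernel X \<alpha> \<beta> \<beta> swap_event Z * w))"
  using AE_coll[where X = X and \<alpha> = \<alpha> and \<beta> = \<beta>]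
proof eventually_elim
  fix c :: "(real^3) \<times> real \<times> real \<times> real \<times> (real^3)"
  assume ok: "case c of (\<xi>s, Is, I', Is', \<omega>) \<Rightarrow>
     internal_energy X \<beta> Is \<and> internal_energy X \<alpha> I' \<and> internal_energy X \<beta> Is' \<and> norm \<omega> = 1"
  obtain \<xi>s Is I' Is' \<omega> where c: "c = (\<xi>s, Is, I', Is', \<omega>)" by (cases c)
  have i: "internal_energy X \<beta> Is" "internal_energy X \<alpha> I'" "internal_energy X \<beta> Is'" "norm \<omega> = 1"
    using ok by (simp_all add: c)
  have pos: "0 < I" "0 < Is" "0 < I'" "0 < Is'" using I i internal_energy_pos by auto
  define v where "v = post_vel X \<alpha> \<beta> \<xi> \<xi>s I Is I' Is' \<omega>"
  define vs where "vs = post_vel_s X \<alpha> \<beta> \<xi> \<xi>s I Is I' Is' \<omega>"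
  define w where "w = event_weight X \<alpha> \<beta> ((\<xi>, I), c)"
  have tw: "trans_weight X \<alpha> \<beta> \<xi> \<xi>s I Is I' Is' \<omega> = w"
    unfolding w_def c event_weight.simps by (rule trans_weight_eq[OF I i])
  have ev: "coll_event X \<alpha> \<beta> ((\<xi>, I), c) = ((\<xi>, I), (\<xi>s, Is), (v, I'), (vs, Is'))"
    by (simp add: c v_def vs_def)
  define s1 s2 s3 s4 where s: "s1 = sqrt (gibbs X \<alpha> (\<xi>, I))" "s2 = sqrt (gibbs X \<beta> (\<xi>s, Is))"
    "s3 = sqrt (gibbs X \<alpha> (v, I'))" "s4 = sqrt (gibbs X \<beta> (vs, Is'))"
  have spos: "0 < s1" "0 < s2" "0 < s3" "0 < s4" using gibbs_pos sp by (simp_all add: s)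
  let ?p = "dof X \<alpha> / 2 - 1" and ?q = "dof X \<beta> / 2 - 1"
  define A A' B B' where A: "A = sqrt (I powr ?p)" "A' = sqrt (I' powr ?p)" "B = sqrt (Is powr ?q)" "B' = sqrt (Is' powr ?q)"
  have Apos: "0 < A" "0 < A'" "0 < B" "0 < B'" using pos by (simp_all add: A)
  have half: "(x * y) powr (d / 4 - 1 / 2) = sqrt (x powr (d / 2 - 1)) * sqrt (y powr (d / 2 - 1))"
    if "0 < x" "0 < y" for x y d :: real
  proof -
    have "d / 4 - 1 / 2 = (d / 2 - 1) * (1 / 2)" by simp
    then have "z powr (d / 4 - 1 / 2) = sqrt (z powr (d / 2 - 1))" if "0 < z" for z :: real
      using that by (simp only: powr_powr[symmetric] powr_half_sqrt powr_ge_zero)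
    then show ?thesis using that by (simp add: powr_mult)
  qed
  have pw: "(I * I') powr (dof X \<alpha> / 4 - 1/2) = A * A'" "(Is * Is') powr (dof X \<beta> / 4 - 1/2) = B * B'"
    using pos by (simp_all add: half A)
  have M: "sqrt (maxwellian X \<beta> \<xi>s Is) = B * s2" "sqrt (maxwellian X \<alpha> v I') = A' * s3" "sqrt (maxwellian X \<beta> vs Is') = B' * s4"
    using I i by (simp_all add: maxwellian_gibbs real_sqrt_mult A s)
  have mw: "sqrt (maxw X \<alpha> (\<xi>, I)) = A * s1" "sqrt (maxw X \<beta> (\<xi>s, Is)) = B * s2"
    "sqrt (maxw X \<alpha> (v, I')) = A' * s3" "sqrt (maxw X \<beta> (vs, Is')) = B' * s4"
    by (simp_all add: maxw_def real_sqrt_mult A s)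
  have J: "joint_gibbs X \<alpha> \<beta> ((\<xi>, I), (\<xi>s, Is), (v, I'), (vs, Is')) = s1 * s2 * s3 * s4"
    by (simp add: joint_gibbs_def real_sqrt_mult s)
  have sq3: "sqrt (maxwellian X \<beta> \<xi>s Is * maxwellian X \<alpha> v I' * maxwellian X \<beta> vs Is') = (B * s2) * (A' * s3) * (B' * s4)"
    by (simp only: real_sqrt_mult M)
  have "coll_integrand X \<alpha> \<beta> \<xi> I (K_fun X \<alpha> \<beta> h I) c
    = (h \<alpha> (v, I') / (A' * s3) + h \<beta> (vs, Is') / (B' * s4) - h \<beta> (\<xi>s, Is) / (B * s2))
      * ((B * s2) * (A' * s3) * (B' * s4)) / (A * A' * (B * B')) * w"
    unfolding coll_integrand_def c prod.case tw K_fun_def v_def[symmetric] vs_def[symmetric] pw M sq3 ..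
  also have "\<dots> = h \<alpha> (v, I') * (s1 * s2 * s3 * s4 / (A * s1 * (A' * s3)) * w)
      + h \<beta> (vs, Is') * (s1 * s2 * s3 * s4 / (A * s1 * (B' * s4)) * w)
      - h \<beta> (\<xi>s, Is) * (s1 * s2 * s3 * s4 / (A * s1 * (B * s2)) * w)"
    using spos Apos by (simp add: field_simps)
  finally show "coll_integrand X \<alpha> \<beta> \<xi> I (K_fun X \<alpha> \<beta> h I) c =
    (let Z = coll_event X \<alpha> \<beta> ((\<xi>, I), c); w = event_weight X \<alpha> \<beta> ((\<xi>, I), c); T = cross_event in
      h \<alpha> (fst (reverse_event Z)) * (sym_kernel X \<alpha> \<beta> \<alpha> reverse_event Z * w)
      + h \<beta> (fst (T Z)) * (sym_kernel X \<alpha> \<beta> \<beta> T Z * w)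
      - h \<beta> (fst (swap_event Z)) * (sym_kernel X \<alpha> \<beta> \<beta> swap_event Z * w))"
    by (simp only: Let_def ev w_def[symmetric] sym_kernel_def J reverse_event_apply swap_event_apply comp_apply fst_conv mw)
qed

lemma trans_weight_measurable [measurable (raw)]:
  assumes [measurable]: "\<xi> \<in> borel_measurable M" "\<xi>s \<in> borel_measurable M" "I \<in> borel_measurable M"
    "Is \<in> borel_measurable M" "I' \<in> borel_measurable M" "Is' \<in> borel_measurable M" "\<omega> \<in> borel_measurable M"
  shows "(\<lambda>x. trans_weight X \<alpha> \<beta> (\<xi> x) (\<xi>s x) (I x) (Is x) (I' x) (Is' x) (\<omega> x)) \<in> borel_measurable M"
proof -
  note [measurable (raw)] = xsec_measurable'[OF sp]
  show ?thesis unfolding trans_weight_def Let_def energy_gap_def cos_angle_def by measurable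
qed

lemma nu_integral_measurable:
  "(\<lambda>z. coll_integral X \<alpha> \<beta> (fst z) (snd z) (nu_fun X \<alpha> \<beta> (snd z))) \<in> borel_measurable borel"
proof -
  note [measurable (raw)] = trans_weight_measurable
  show ?thesis
    unfolding coll_integral_def coll_integrand_def nu_fun_def case_prod_beta by measurable
qed

lemma K_integral_measurable:
  assumes h: "h \<alpha> \<in> borel_measurable borel" "h \<beta> \<in> borel_measurable borel"
  shows "(\<lambda>z. coll_integral X \<alpha> \<beta> (fst z) (snd z) (K_fun X \<alpha> \<beta> h (snd z))) \<in> borel_measurable borel"
proof -
  note [measurable (raw)] = trans_weight_measurable measurable_compose[OF _ h(1)] measurable_compose[OF _ h(2)]
  show ?thesis
    unfolding coll_integral_def coll_integrand_def K_fun_def case_prod_beta by measurable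
qed

lemma sym_kernel_measurable:
  assumes p: "partner \<alpha> \<beta> \<tau> \<beta>' T"
  shows "sym_kernel X \<alpha> \<beta> \<tau> T \<in> borel_measurable borel" "row_kernel X \<alpha> \<beta> \<tau> T \<in> borel_measurable borel"
proof -
  note [measurable] = partner_measurable[OF p]
  show "sym_kernel X \<alpha> \<beta> \<tau> T \<in> borel_measurable borel" "row_kernel X \<alpha> \<beta> \<tau> T \<in> borel_measurable borel"
    unfolding sym_kernel_def[abs_def] row_kernel_def[abs_def] by measurable
qed

end

end

context bounded_mixture
begin

lemma nu_integrable:
  assumes sp: "\<alpha> \<in> species X" "\<beta> \<in> species X" and I: "internal_energy X \<alpha> I"
  shows "coll_integrable X \<alpha> \<beta> \<xi> I (nu_fun X \<alpha> \<beta> I)"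
  unfolding coll_integrable_def
proof (rule integrableI_bounded)
  note [measurable (raw)] = trans_weight_measurable[OF sp]
  show "coll_integrand X \<alpha> \<beta> \<xi> I (nu_fun X \<alpha> \<beta> I) \<in> borel_measurable (coll_measure X \<alpha> \<beta>)"
    unfolding coll_integrand_def nu_fun_def case_prod_beta by measurable
  have "(\<integral>\<^sup>+c. ennreal (norm (coll_integrand X \<alpha> \<beta> \<xi> I (nu_fun X \<alpha> \<beta> I) c)) \<partial>coll_measure X \<alpha> \<beta>)
    = (\<integral>\<^sup>+c. ennreal (gibbs X \<beta> (fst (snd (coll_event X \<alpha> \<beta> ((\<xi>, I), c)))) / I powr (dof X \<alpha> / 2 - 1))
      * ennreal (event_weight X \<alpha> \<beta> ((\<xi>, I), c)) \<partial>coll_measure X \<alpha> \<beta>)"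
  proof (rule nn_integral_cong_AE, use AE_coll[where X = X and \<alpha> = \<alpha> and \<beta> = \<beta>] in eventually_elim)
    fix c :: "(real^3) \<times> real \<times> real \<times> real \<times> (real^3)"
    assume ok: "case c of (\<xi>s, Is, I', Is', \<omega>) \<Rightarrow>
       internal_energy X \<beta> Is \<and> internal_energy X \<alpha> I' \<and> internal_energy X \<beta> Is' \<and> norm \<omega> = 1"
    obtain \<xi>s Is I' Is' \<omega> where c: "c = (\<xi>s, Is, I', Is', \<omega>)" by (cases c)
    have i: "internal_energy X \<beta> Is" "internal_energy X \<alpha> I'" "internal_energy X \<beta> Is'" "norm \<omega> = 1"
      using ok by (simp_all add: c)
    have pos: "0 < I" "0 < Is" using I i internal_energy_pos by auto
    have w: "0 \<le> coll_weight X \<alpha> \<beta> \<xi> \<xi>s I Is I' Is' \<omega>"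
      using event_weight_nonneg[OF sp, of "((\<xi>, I), c)"] by (simp add: c)
    have g: "0 < gibbs X \<beta> (\<xi>s, Is)" by (rule gibbs_pos[OF sp(2)])
    have "coll_integrand X \<alpha> \<beta> \<xi> I (nu_fun X \<alpha> \<beta> I) c
       = gibbs X \<beta> (\<xi>s, Is) / I powr (dof X \<alpha> / 2 - 1) * coll_weight X \<alpha> \<beta> \<xi> \<xi>s I Is I' Is' \<omega>"
      using pos by (simp add: c coll_integrand_def nu_fun_def maxwellian_gibbs[OF i(1)] trans_weight_eq[OF sp I i])
    then show "ennreal (norm (coll_integrand X \<alpha> \<beta> \<xi> I (nu_fun X \<alpha> \<beta> I) c))
      = ennreal (gibbs X \<beta> (fst (snd (coll_event X \<alpha> \<beta> ((\<xi>, I), c)))) / I powr (dof X \<alpha> / 2 - 1))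
        * ennreal (event_weight X \<alpha> \<beta> ((\<xi>, I), c))"
      using w g by (subst ennreal_mult[symmetric]) (simp_all add: c)
  qed
  also have "\<dots> < \<infinity>" by (rule collision_frequency_finite[OF sp I])
  finally show "(\<integral>\<^sup>+c. ennreal (norm (coll_integrand X \<alpha> \<beta> \<xi> I (nu_fun X \<alpha> \<beta> I) c)) \<partial>coll_measure X \<alpha> \<beta>) < \<infinity>" .
qed

context
  fixes \<alpha> \<beta> \<tau> \<beta>' T
  assumes p: "partner \<alpha> \<beta> \<tau> \<beta>' T" and sp: "\<alpha> \<in> species X" "\<beta> \<in> species X"
begin

lemma sp': "\<tau> \<in> species X" "\<beta>' \<in> species X"
  using partner_species[OF p sp] by auto

lemma row_kernel_nonneg: "0 \<le> row_kernel X \<alpha> \<beta> \<tau> T Z"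
  using gibbs_pos[OF sp(1)] gibbs_pos[OF sp(2)] gibbs_pos[OF sp'(1)]
  by (cases Z rule: prod_cases4) (auto simp: row_kernel_def joint_gibbs_def maxw_def less_imp_le)

lemma sym_kernel_nonneg: "0 \<le> sym_kernel X \<alpha> \<beta> \<tau> T Z"
  using gibbs_pos[OF sp(1)] gibbs_pos[OF sp(2)] gibbs_pos[OF sp'(1)]
  by (cases Z rule: prod_cases4) (auto simp: sym_kernel_def joint_gibbs_def maxw_def less_imp_le)

lemma sym_kernel_square:
  "(sym_kernel X \<alpha> \<beta> \<tau> T Z)\<^sup>2 = row_kernel X \<alpha> \<beta> \<tau> T Z * row_kernel X \<tau> \<beta>' \<alpha> T (T Z)"
proof -
  let ?g = "gibbs X \<alpha> (fst Z)" and ?g' = "gibbs X \<tau> (fst (T Z))"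
  let ?m = "maxw X \<alpha> (fst Z)" and ?m' = "maxw X \<tau> (fst (T Z))" and ?J = "joint_gibbs X \<alpha> \<beta> Z"
  have g: "0 < ?g" "0 < ?g'" using gibbs_pos sp sp' by auto
  have m: "0 \<le> ?m" "0 \<le> ?m'" using g by (auto simp: maxw_def less_imp_le)
  have "sqrt (?g / ?g') * sqrt (?g' / ?g) = 1" using g by (simp add: real_sqrt_mult[symmetric])
  then have "?J / ?m * sqrt (?g / ?g') * (?J / ?m' * sqrt (?g' / ?g)) = ?J / ?m * (?J / ?m')"
    by (simp add: mult_ac)
  moreover have "(sym_kernel X \<alpha> \<beta> \<tau> T Z)\<^sup>2 = ?J / ?m * (?J / ?m')"
    using m by (simp add: sym_kernel_def power_divide power_mult_distrib power2_eq_square[of ?J])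
  ultimately show ?thesis
    unfolding row_kernel_def[of X \<alpha>] row_kernel_def[of X \<tau>] joint_gibbs_partner[OF p] partner_involution[OF p] by simp
qed

text \<open>
  The involution \<open>T\<close> preserves the collision measure up to the exchange of species, and turns the transposed
  row kernel into a row kernel. The column bound is thus the row bound for the species \<open>\<tau>\<close> and \<open>\<beta>'\<close>.
\<close>

lemma gain_column_bound:
  "\<exists>B. \<forall>\<phi>\<in>borel_measurable (phase X \<tau>). (\<integral>\<^sup>+x. \<phi> (fst (T (coll_event X \<alpha> \<beta> x))) *
     ennreal (row_kernel X \<tau> \<beta>' \<alpha> T (T (coll_event X \<alpha> \<beta> x)) * event_weight X \<alpha> \<beta> x) \<partial>(phase X \<alpha> \<Otimes>\<^sub>M coll_measure X \<alpha> \<beta>))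
    \<le> ennreal B * (\<integral>\<^sup>+z. \<phi> z \<partial>phase X \<tau>)"
proof -
  obtain B where B: "\<And>z. internal_energy X \<tau> (snd z) \<Longrightarrow>
    (\<integral>\<^sup>+c. ennreal (row_kernel X \<tau> \<beta>' \<alpha> T (coll_event X \<tau> \<beta>' (z, c))) * ennreal (event_weight X \<tau> \<beta>' (z, c)) \<partial>coll_measure X \<tau> \<beta>') \<le> ennreal B"
    using row_kernel_bound[OF sp' partner_sym[OF p]] by blast
  note [measurable] = partner_measurable[OF p] event_weight_measurable[OF sp] event_weight_measurable[OF sp']
    sym_kernel_measurable(2)[OF sp' partner_sym[OF p]]
  have T': "T \<in> measurable (collision_law X \<alpha> \<beta>) borel" by measurable
  show ?thesis
  proof (rule exI[of _ B], rule ballI)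
    fix \<phi> :: "(real^3) \<times> real \<Rightarrow> ennreal" assume "\<phi> \<in> borel_measurable (phase X \<tau>)"
    then have \<phi>[measurable]: "\<phi> \<in> borel_measurable borel" unfolding measurable_cong_sets[OF sets_phase refl] .
    define F where "F Z = \<phi> (fst Z) * ennreal (row_kernel X \<tau> \<beta>' \<alpha> T Z)" for Z
    have Fm[measurable]: "F \<in> borel_measurable borel" unfolding F_def[abs_def] by measurable
    have "(\<integral>\<^sup>+x. \<phi> (fst (T (coll_event X \<alpha> \<beta> x))) *
       ennreal (row_kernel X \<tau> \<beta>' \<alpha> T (T (coll_event X \<alpha> \<beta> x)) * event_weight X \<alpha> \<beta> x) \<partial>(phase X \<alpha> \<Otimes>\<^sub>M coll_measure X \<alpha> \<beta>))
      = (\<integral>\<^sup>+x. F (T (coll_event X \<alpha> \<beta> x)) * ennreal (event_weight X \<alpha> \<beta> x) \<partial>(phase X \<alpha> \<Otimes>\<^sub>M coll_measure X \<alpha> \<beta>))"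
      unfolding F_def by (subst ennreal_mult'') (simp_all add: event_weight_nonneg[OF sp] mult.assoc)
    also have "\<dots> = (\<integral>\<^sup>+z. \<integral>\<^sup>+c. F (T (coll_event X \<alpha> \<beta> (z, c))) * ennreal (event_weight X \<alpha> \<beta> (z, c)) \<partial>coll_measure X \<alpha> \<beta> \<partial>phase X \<alpha>)"
      by (rule coll.nn_integral_fst[symmetric]) measurable
    also have "\<dots> = (\<integral>\<^sup>+Z. F (T Z) \<partial>collision_law X \<alpha> \<beta>)"
      by (rule nn_integral_collision_law[OF sp, symmetric]) measurable
    also have "\<dots> = (\<integral>\<^sup>+Z. F Z \<partial>distr (collision_law X \<alpha> \<beta>) borel T)"
      by (rule nn_integral_distr[symmetric, OF T']) measurable
    also have "\<dots> = (\<integral>\<^sup>+Z. F Z \<partial>collision_law X \<tau> \<beta>')" unfolding collision_law_partner[OF p sp] ..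
    also have "\<dots> = (\<integral>\<^sup>+z. \<integral>\<^sup>+c. F (coll_event X \<tau> \<beta>' (z, c)) * ennreal (event_weight X \<tau> \<beta>' (z, c)) \<partial>coll_measure X \<tau> \<beta>' \<partial>phase X \<tau>)"
      by (rule nn_integral_collision_law[OF sp' Fm])
    also have "\<dots> \<le> (\<integral>\<^sup>+z. ennreal B * \<phi> z \<partial>phase X \<tau>)"
    proof (rule nn_integral_mono_AE, use AE_phase[of X \<tau>] in eventually_elim)
      fix z :: "(real^3) \<times> real" assume z: "internal_energy X \<tau> (snd z)"
      have "fst (coll_event X \<tau> \<beta>' (z, c)) = z" for c by (cases z; cases c) simp
      then have "(\<integral>\<^sup>+c. F (coll_event X \<tau> \<beta>' (z, c)) * ennreal (event_weight X \<tau> \<beta>' (z, c)) \<partial>coll_measure X \<tau> \<beta>')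
        = (\<integral>\<^sup>+c. \<phi> z * (ennreal (row_kernel X \<tau> \<beta>' \<alpha> T (coll_event X \<tau> \<beta>' (z, c))) * ennreal (event_weight X \<tau> \<beta>' (z, c))) \<partial>coll_measure X \<tau> \<beta>')"
        by (simp add: F_def mult.assoc)
      also have "\<dots> = \<phi> z * (\<integral>\<^sup>+c. ennreal (row_kernel X \<tau> \<beta>' \<alpha> T (coll_event X \<tau> \<beta>' (z, c))) * ennreal (event_weight X \<tau> \<beta>' (z, c)) \<partial>coll_measure X \<tau> \<beta>')"
        by (rule nn_integral_cmult) measurable
      also have "\<dots> \<le> \<phi> z * ennreal B" by (intro mult_left_mono B z) simp
      finally show "(\<integral>\<^sup>+c. F (coll_event X \<tau> \<beta>' (z, c)) * ennreal (event_weight X \<tau> \<beta>' (z, c)) \<partial>coll_measure X \<tau> \<beta>') \<le> ennreal B * \<phi> z"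
        by (simp add: mult.commute)
    qed
    also have "\<dots> = ennreal B * (\<integral>\<^sup>+z. \<phi> z \<partial>phase X \<tau>)" by (rule nn_integral_cmult) measurable
    finally show "(\<integral>\<^sup>+x. \<phi> (fst (T (coll_event X \<alpha> \<beta> x))) *
       ennreal (row_kernel X \<tau> \<beta>' \<alpha> T (T (coll_event X \<alpha> \<beta> x)) * event_weight X \<alpha> \<beta> x) \<partial>(phase X \<alpha> \<Otimes>\<^sub>M coll_measure X \<alpha> \<beta>))
      \<le> ennreal B * (\<integral>\<^sup>+z. \<phi> z \<partial>phase X \<tau>)" .
  qed
qed

lemma gain_term_bounded:
  assumes h: "h \<in> L2 (phase X \<tau>)"
  shows "AE z in phase X \<alpha>. integrable (coll_measure X \<alpha> \<beta>) (\<lambda>c. h (fst (T (coll_event X \<alpha> \<beta> (z, c)))) *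
      (sym_kernel X \<alpha> \<beta> \<tau> T (coll_event X \<alpha> \<beta> (z, c)) * event_weight X \<alpha> \<beta> (z, c)))" (is ?thesis1)
    and "gain_term X \<alpha> \<beta> \<tau> T h \<in> L2 (phase X \<alpha>)" (is ?thesis2)
    and "f \<in> L2 (phase X \<alpha>) \<Longrightarrow>
      integrable (phase X \<alpha> \<Otimes>\<^sub>M coll_measure X \<alpha> \<beta>) (\<lambda>x. f (fst x) * (h (fst (T (coll_event X \<alpha> \<beta> x))) *
        (sym_kernel X \<alpha> \<beta> \<tau> T (coll_event X \<alpha> \<beta> x) * event_weight X \<alpha> \<beta> x)))"
proof -
  obtain B where B: "\<And>z. internal_energy X \<alpha> (snd z) \<Longrightarrow>
    (\<integral>\<^sup>+c. ennreal (row_kernel X \<alpha> \<beta> \<tau> T (coll_event X \<alpha> \<beta> (z, c))) * ennreal (event_weight X \<alpha> \<beta> (z, c)) \<partial>coll_measure X \<alpha> \<beta>) \<le> ennreal B"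
    using row_kernel_bound[OF sp p] by blast
  obtain B' where B': "\<And>\<phi>. \<phi> \<in> borel_measurable (phase X \<tau>) \<Longrightarrow> (\<integral>\<^sup>+x. \<phi> (fst (T (coll_event X \<alpha> \<beta> x))) *
     ennreal (row_kernel X \<tau> \<beta>' \<alpha> T (T (coll_event X \<alpha> \<beta> x)) * event_weight X \<alpha> \<beta> x) \<partial>(phase X \<alpha> \<Otimes>\<^sub>M coll_measure X \<alpha> \<beta>))
    \<le> ennreal B' * (\<integral>\<^sup>+z. \<phi> z \<partial>phase X \<tau>)"
    using gain_column_bound by blast
  note [measurable] = partner_measurable[OF p] event_weight_measurable[OF sp]
    sym_kernel_measurable[OF sp p] sym_kernel_measurable(2)[OF sp' partner_sym[OF p]]
  define D where "D x = sym_kernel X \<alpha> \<beta> \<tau> T (coll_event X \<alpha> \<beta> x) * event_weight X \<alpha> \<beta> x" for x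
  define P where "P x = row_kernel X \<alpha> \<beta> \<tau> T (coll_event X \<alpha> \<beta> x) * event_weight X \<alpha> \<beta> x" for x
  define Q where "Q x = row_kernel X \<tau> \<beta>' \<alpha> T (T (coll_event X \<alpha> \<beta> x)) * event_weight X \<alpha> \<beta> x" for x
  define \<pi> where "\<pi> x = fst (T (coll_event X \<alpha> \<beta> x))" for x
  have row_nn': "0 \<le> row_kernel X \<tau> \<beta>' \<alpha> T Z" for Z
    using gibbs_pos[OF sp(1)] gibbs_pos[OF sp(2)] gibbs_pos[OF sp'(1)] gibbs_pos[OF sp'(2)]
    by (cases Z rule: prod_cases4) (auto simp: row_kernel_def joint_gibbs_def maxw_def less_imp_le)
  have Dm: "D \<in> borel_measurable (phase X \<alpha> \<Otimes>\<^sub>M coll_measure X \<alpha> \<beta>)"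
    and Pm: "P \<in> borel_measurable (phase X \<alpha> \<Otimes>\<^sub>M coll_measure X \<alpha> \<beta>)"
    and Qm: "Q \<in> borel_measurable (phase X \<alpha> \<Otimes>\<^sub>M coll_measure X \<alpha> \<beta>)"
    unfolding D_def[abs_def] P_def[abs_def] Q_def[abs_def] by measurable
  have "\<pi> \<in> measurable (phase X \<alpha> \<Otimes>\<^sub>M coll_measure X \<alpha> \<beta>) borel"
    unfolding \<pi>_def[abs_def] by measurable
  then have \<pi>m: "\<pi> \<in> measurable (phase X \<alpha> \<Otimes>\<^sub>M coll_measure X \<alpha> \<beta>) (phase X \<tau>)"
    unfolding measurable_cong_sets[OF refl sets_phase] .
  have nn: "0 \<le> D x" "0 \<le> P x" "0 \<le> Q x" for x
    unfolding D_def P_def Q_def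
    by (intro mult_nonneg_nonneg sym_kernel_nonneg row_kernel_nonneg row_nn' event_weight_nonneg[OF sp])+
  have DPQ: "(D x)\<^sup>2 = P x * Q x" for x
    unfolding D_def P_def Q_def power_mult_distrib sym_kernel_square by (simp add: power2_eq_square)
  have row: "AE z in phase X \<alpha>. (\<integral>\<^sup>+c. ennreal (P (z, c)) \<partial>coll_measure X \<alpha> \<beta>) \<le> ennreal B"
    using AE_phase[of X \<alpha>]
  proof eventually_elim
    fix z :: "(real^3) \<times> real" assume "internal_energy X \<alpha> (snd z)"
    from B[OF this] show "(\<integral>\<^sup>+c. ennreal (P (z, c)) \<partial>coll_measure X \<alpha> \<beta>) \<le> ennreal B"
      unfolding P_def by (subst ennreal_mult) (simp_all add: row_kernel_nonneg event_weight_nonneg[OF sp])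
  qed
  note schur = phase.sigma_finite_measure_axioms coll.sigma_finite_measure_axioms Dm Pm Qm nn DPQ \<pi>m row
    B'[folded \<pi>_def Q_def] h
  show ?thesis1 using schur_integrable[OF schur] unfolding \<pi>_def D_def .
  show ?thesis2 using schur_L2[OF schur] unfolding \<pi>_def D_def gain_term_def[abs_def] .
  show "integrable (phase X \<alpha> \<Otimes>\<^sub>M coll_measure X \<alpha> \<beta>) (\<lambda>x. f (fst x) * (h (fst (T (coll_event X \<alpha> \<beta> x))) *
        (sym_kernel X \<alpha> \<beta> \<tau> T (coll_event X \<alpha> \<beta> x) * event_weight X \<alpha> \<beta> x)))"
    if "f \<in> L2 (phase X \<alpha>)"
    using schur_pairing[OF schur that] unfolding \<pi>_def D_def .
qed

lemma gain_pairing: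
  assumes f: "f \<in> L2 (phase X \<alpha>)" and h: "h \<in> L2 (phase X \<tau>)"
  shows "(LINT z|phase X \<alpha>. f z * gain_term X \<alpha> \<beta> \<tau> T h z)
    = (LINT Z|collision_law X \<alpha> \<beta>. f (fst Z) * h (fst (T Z)) * sym_kernel X \<alpha> \<beta> \<tau> T Z)"
proof -
  interpret PC: pair_sigma_finite "phase X \<alpha>" "coll_measure X \<alpha> \<beta>" ..
  note [measurable] = partner_measurable[OF p] event_weight_measurable[OF sp] sym_kernel_measurable[OF sp p]
  have fm[measurable]: "f \<in> borel_measurable borel" by (rule L2_phase_measurable[OF f])
  have hm[measurable]: "h \<in> borel_measurable borel" by (rule L2_phase_measurable[OF h])
  let ?G = "\<lambda>x. f (fst x) * (h (fst (T (coll_event X \<alpha> \<beta> x))) * (sym_kernel X \<alpha> \<beta> \<tau> T (coll_event X \<alpha> \<beta> x) * event_weight X \<alpha> \<beta> x))"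
  have int: "integrable (phase X \<alpha> \<Otimes>\<^sub>M coll_measure X \<alpha> \<beta>) ?G" by (rule gain_term_bounded(3)[OF h f])
  have "(LINT z|phase X \<alpha>. f z * gain_term X \<alpha> \<beta> \<tau> T h z)
    = (LINT z|phase X \<alpha>. (LINT c|coll_measure X \<alpha> \<beta>. ?G (z, c)))"
    unfolding gain_term_def by (simp only: fst_conv integral_mult_right_zero)
  also have "\<dots> = (LINT x|(phase X \<alpha> \<Otimes>\<^sub>M coll_measure X \<alpha> \<beta>). ?G x)"
    by (rule PC.integral_fst'[OF int])
  also have "\<dots> = (LINT x|(phase X \<alpha> \<Otimes>\<^sub>M coll_measure X \<alpha> \<beta>). event_weight X \<alpha> \<beta> x *\<^sub>R
     (f (fst (coll_event X \<alpha> \<beta> x)) * h (fst (T (coll_event X \<alpha> \<beta> x))) * sym_kernel X \<alpha> \<beta> \<tau> T (coll_event X \<alpha> \<beta> x)))"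
  proof (rule Bochner_Integration.integral_cong[OF refl])
    fix x
    have "fst (coll_event X \<alpha> \<beta> x) = fst x" by (subst (1 2) event_split[of x]) (simp only: coll_event.simps fst_conv)
    then show "?G x = event_weight X \<alpha> \<beta> x *\<^sub>R
     (f (fst (coll_event X \<alpha> \<beta> x)) * h (fst (T (coll_event X \<alpha> \<beta> x))) * sym_kernel X \<alpha> \<beta> \<tau> T (coll_event X \<alpha> \<beta> x))"
      by (simp add: mult_ac)
  qed
  also have "\<dots> = (LINT x|density (phase X \<alpha> \<Otimes>\<^sub>M coll_measure X \<alpha> \<beta>) (\<lambda>x. ennreal (event_weight X \<alpha> \<beta> x)).
     f (fst (coll_event X \<alpha> \<beta> x)) * h (fst (T (coll_event X \<alpha> \<beta> x))) * sym_kernel X \<alpha> \<beta> \<tau> T (coll_event X \<alpha> \<beta> x))"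
    by (rule integral_density[symmetric]) (measurable, simp add: event_weight_nonneg[OF sp])
  also have "\<dots> = (LINT Z|collision_law X \<alpha> \<beta>. f (fst Z) * h (fst (T Z)) * sym_kernel X \<alpha> \<beta> \<tau> T Z)"
    unfolding collision_law_def by (rule integral_distr[symmetric]) measurable
  finally show ?thesis .
qed

end

text \<open>
  The pairing is an integral over all collisions of a density that is invariant under \<open>T\<close>, and \<open>T\<close> exchanges the
  states at which \<open>f\<close> and \<open>h\<close> are evaluated.
\<close>

lemma gain_symmetric:
  assumes p: "partner \<alpha> \<beta> \<tau> \<beta>' T" and sp: "\<alpha> \<in> species X" "\<beta> \<in> species X"
    and f: "f \<in> L2 (phase X \<alpha>)" and h: "h \<in> L2 (phase X \<tau>)"
  shows "(LINT z|phase X \<alpha>. f z * gain_term X \<alpha> \<beta> \<tau> T h z) = (LINT z|phase X \<tau>. h z * gain_term X \<tau> \<beta>' \<alpha> T f z)"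
proof -
  note sp' = sp'[OF p sp]
  note [measurable] = partner_measurable[OF p] sym_kernel_measurable(1)[OF sp' partner_sym[OF p]]
  have fm[measurable]: "f \<in> borel_measurable borel" by (rule L2_phase_measurable[OF f])
  have hm[measurable]: "h \<in> borel_measurable borel" by (rule L2_phase_measurable[OF h])
  have "(LINT z|phase X \<tau>. h z * gain_term X \<tau> \<beta>' \<alpha> T f z)
    = (LINT Z|collision_law X \<tau> \<beta>'. h (fst Z) * f (fst (T Z)) * sym_kernel X \<tau> \<beta>' \<alpha> T Z)"
    by (rule gain_pairing[OF partner_sym[OF p] sp' h f])
  also have "\<dots> = (LINT Z|distr (collision_law X \<alpha> \<beta>) borel T. h (fst Z) * f (fst (T Z)) * sym_kernel X \<tau> \<beta>' \<alpha> T Z)"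
    unfolding collision_law_partner[OF p sp] ..
  also have "\<dots> = (LINT Z|collision_law X \<alpha> \<beta>. h (fst (T Z)) * f (fst (T (T Z))) * sym_kernel X \<tau> \<beta>' \<alpha> T (T Z))"
    by (rule integral_distr) measurable
  also have "\<dots> = (LINT Z|collision_law X \<alpha> \<beta>. f (fst Z) * h (fst (T Z)) * sym_kernel X \<alpha> \<beta> \<tau> T Z)"
    unfolding partner_involution[OF p] sym_kernel_partner[OF p] by (simp only: mult.commute[of "f _"])
  also have "\<dots> = (LINT z|phase X \<alpha>. f z * gain_term X \<alpha> \<beta> \<tau> T h z)"
    by (rule gain_pairing[OF p sp f h, symmetric])
  finally show ?thesis ..
qed

end

section \<open>Self-adjointness\<close>

lemma h_space_iff: "f \<in> h_space X \<longleftrightarrow> (\<forall>\<alpha>\<in>species X. f \<alpha> \<in> L2 (phase X \<alpha>))"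
  by (simp add: h_space_def L2_def)

lemma h_spaceD: "f \<in> h_space X \<Longrightarrow> \<alpha> \<in> species X \<Longrightarrow> f \<alpha> \<in> L2 (phase X \<alpha>)"
  by (simp add: h_space_iff)

lemma finite_species [simp]: "finite (species X)"
  by (simp add: species_def)

lemma L2_mult_integrable:
  assumes f: "f \<in> L2 M" and g: "g \<in> L2 M"
  shows "integrable M (\<lambda>z. f z * g z)"
proof (rule Bochner_Integration.integrable_bound)
  note [measurable] = L2D(1)[OF f] L2D(1)[OF g]
  show "integrable M (\<lambda>z. (f z)\<^sup>2 + (g z)\<^sup>2)" using L2D(2)[OF f] L2D(2)[OF g] by simp
  have "\<bar>x * y\<bar> \<le> x\<^sup>2 + y\<^sup>2" for x y :: real
  proof -
    have "0 \<le> (\<bar>x\<bar> - \<bar>y\<bar>)\<^sup>2" by simp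
    then have "2 * \<bar>x * y\<bar> \<le> x\<^sup>2 + y\<^sup>2" by (simp add: power2_eq_square algebra_simps abs_mult)
    then show ?thesis using abs_ge_zero[of "x * y"] by linarith
  qed
  then show "AE z in M. norm (f z * g z) \<le> norm ((f z)\<^sup>2 + (g z)\<^sup>2)" by simp
  show "(\<lambda>z. f z * g z) \<in> borel_measurable M" by measurable
qed

lemma h_space_mult_integrable:
  "f \<in> h_space X \<Longrightarrow> g \<in> h_space X \<Longrightarrow> \<alpha> \<in> species X \<Longrightarrow> integrable (phase X \<alpha>) (\<lambda>z. f \<alpha> z * g \<alpha> z)"
  by (rule L2_mult_integrable[OF h_spaceD h_spaceD])

lemma L2_lincomb:
  assumes f: "f \<in> L2 M" and g: "g \<in> L2 M"
  shows "(\<lambda>z. a * f z + b * g z) \<in> L2 M"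
proof -
  note [measurable] = L2D(1)[OF f] L2D(1)[OF g]
  have "integrable M (\<lambda>z. a\<^sup>2 * (f z)\<^sup>2 + 2 * a * b * (f z * g z) + b\<^sup>2 * (g z)\<^sup>2)"
    using L2D(2)[OF f] L2D(2)[OF g] L2_mult_integrable[OF f g] by simp
  then have "integrable M (\<lambda>z. (a * f z + b * g z)\<^sup>2)" by (simp add: power2_sum power_mult_distrib algebra_simps)
  then show ?thesis by (simp add: L2_def)
qed

lemma L2_add: "f \<in> L2 M \<Longrightarrow> g \<in> L2 M \<Longrightarrow> (\<lambda>z. f z + g z) \<in> L2 M"
  and L2_diff: "f \<in> L2 M \<Longrightarrow> g \<in> L2 M \<Longrightarrow> (\<lambda>z. f z - g z) \<in> L2 M"
  using L2_lincomb[of f M g 1 1] L2_lincomb[of f M g 1 "- 1"] by simp_all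

lemma L2_sum:
  assumes "finite A" "\<And>i. i \<in> A \<Longrightarrow> F i \<in> L2 M"
  shows "(\<lambda>z. \<Sum>i\<in>A. F i z) \<in> L2 M"
  using assms
proof (induction A rule: finite_induct)
  case empty
  then show ?case by (simp add: L2_def)
next
  case (insert i A)
  then have "(\<lambda>z. F i z + (\<Sum>i\<in>A. F i z)) \<in> L2 M" by (intro L2_add) auto
  with insert.hyps show ?case by simp
qed

lemma h_space_lincomb:
  "f \<in> h_space X \<Longrightarrow> g \<in> h_space X \<Longrightarrow> (\<lambda>\<alpha> z. a * f \<alpha> z + b * g \<alpha> z) \<in> h_space X"
  unfolding h_space_iff by (auto intro: L2_lincomb)

lemma h_space_diff:
  "f \<in> h_space X \<Longrightarrow> g \<in> h_space X \<Longrightarrow> (\<lambda>\<alpha> z. f \<alpha> z - g \<alpha> z) \<in> h_space X"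
  using h_space_lincomb[of f X g 1 "-1"] by simp

lemma h_space_add:
  "f \<in> h_space X \<Longrightarrow> g \<in> h_space X \<Longrightarrow> (\<lambda>\<alpha> z. f \<alpha> z + g \<alpha> z) \<in> h_space X"
  using h_space_lincomb[of f X g 1 1] by simp

lemma h_space_zero: "(\<lambda>\<alpha> z. 0) \<in> h_space X"
  by (simp add: h_space_def)

lemma h_space_bounded_mult:
  assumes f: "f \<in> h_space X"
    and b: "\<And>\<alpha>. \<alpha> \<in> species X \<Longrightarrow> b \<alpha> \<in> borel_measurable (phase X \<alpha>)" "\<And>\<alpha> z. \<bar>b \<alpha> z\<bar> \<le> c"
  shows "(\<lambda>\<alpha> z. b \<alpha> z * f \<alpha> z) \<in> h_space X"
  unfolding h_space_def
proof (intro CollectI ballI conjI)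
  fix \<alpha> assume \<alpha>: "\<alpha> \<in> species X"
  note [measurable] = L2D(1)[OF h_spaceD[OF f \<alpha>]] b(1)[OF \<alpha>]
  show "(\<lambda>z. b \<alpha> z * f \<alpha> z) \<in> borel_measurable (phase X \<alpha>)" by measurable
  show "integrable (phase X \<alpha>) (\<lambda>z. (b \<alpha> z * f \<alpha> z)\<^sup>2)"
  proof (rule Bochner_Integration.integrable_bound)
    show "integrable (phase X \<alpha>) (\<lambda>z. c\<^sup>2 * (f \<alpha> z)\<^sup>2)" using L2D(2)[OF h_spaceD[OF f \<alpha>]] by simp
    have "(b \<alpha> z * f \<alpha> z)\<^sup>2 \<le> c\<^sup>2 * (f \<alpha> z)\<^sup>2" for z
      unfolding power_mult_distrib using b(2)[of \<alpha> z]
      by (intro mult_right_mono) (auto simp: abs_le_square_iff[symmetric])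
    then show "AE z in phase X \<alpha>. norm ((b \<alpha> z * f \<alpha> z)\<^sup>2) \<le> norm (c\<^sup>2 * (f \<alpha> z)\<^sup>2)" by simp
  qed measurable
qed

lemma h_space_cong:
  assumes "f \<in> h_space X" "h_eq X f g" "\<And>\<alpha>. \<alpha> \<in> species X \<Longrightarrow> g \<alpha> \<in> borel_measurable (phase X \<alpha>)"
  shows "g \<in> h_space X"
  unfolding h_space_def
proof (intro CollectI ballI conjI)
  fix \<alpha> assume \<alpha>: "\<alpha> \<in> species X"
  note [measurable] = L2D(1)[OF h_spaceD[OF assms(1) \<alpha>]] assms(3)[OF \<alpha>]
  show "g \<alpha> \<in> borel_measurable (phase X \<alpha>)" by measurable
  have "AE z in phase X \<alpha>. (f \<alpha> z)\<^sup>2 = (g \<alpha> z)\<^sup>2"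
  proof -
    have "AE z in phase X \<alpha>. f \<alpha> z = g \<alpha> z" using assms(2) \<alpha> by (simp add: h_eq_def)
    then show ?thesis by eventually_elim simp
  qed
  then show "integrable (phase X \<alpha>) (\<lambda>z. (g \<alpha> z)\<^sup>2)"
    by (rule integrable_cong_AE_imp[OF L2D(2)[OF h_spaceD[OF assms(1) \<alpha>]], rotated]) measurable
qed

lemma h_inner_sym: "h_inner X f g = h_inner X g f"
  by (simp add: h_inner_def mult.commute)

lemma h_inner_lincomb:
  assumes "f \<in> h_space X" "g \<in> h_space X" "h \<in> h_space X"
  shows "h_inner X (\<lambda>\<alpha> z. a * f \<alpha> z + b * g \<alpha> z) h = a * h_inner X f h + b * h_inner X g h"
proof -
  have "(LINT z|phase X \<alpha>. (a * f \<alpha> z + b * g \<alpha> z) * h \<alpha> z)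
    = a * (LINT z|phase X \<alpha>. f \<alpha> z * h \<alpha> z) + b * (LINT z|phase X \<alpha>. g \<alpha> z * h \<alpha> z)" if "\<alpha> \<in> species X" for \<alpha>
    using h_space_mult_integrable[OF assms(1,3) that] h_space_mult_integrable[OF assms(2,3) that]
    by (simp add: distrib_right mult.assoc)
  then show ?thesis by (simp add: h_inner_def sum.distrib sum_distrib_left)
qed

lemma h_inner_diff:
  assumes "f \<in> h_space X" "g \<in> h_space X" "h \<in> h_space X"
  shows "h_inner X (\<lambda>\<alpha> z. f \<alpha> z - g \<alpha> z) h = h_inner X f h - h_inner X g h"
  using h_inner_lincomb[OF assms, of 1 "-1"] by simp

lemma h_inner_diff_right:
  assumes "f \<in> h_space X" "g \<in> h_space X" "h \<in> h_space X"
  shows "h_inner X h (\<lambda>\<alpha> z. f \<alpha> z - g \<alpha> z) = h_inner X h f - h_inner X h g"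
  using h_inner_diff[OF assms] by (simp add: h_inner_sym[of X h])

lemma h_inner_add_right:
  assumes "f \<in> h_space X" "g \<in> h_space X" "h \<in> h_space X"
  shows "h_inner X h (\<lambda>\<alpha> z. f \<alpha> z + g \<alpha> z) = h_inner X h f + h_inner X h g"
  using h_inner_lincomb[OF assms, of 1 1] by (simp add: h_inner_sym[of X h])

lemma h_inner_cong:
  assumes "h_eq X f f'" "f \<in> h_space X" "f' \<in> h_space X" "g \<in> h_space X"
  shows "h_inner X f g = h_inner X f' g"
  unfolding h_inner_def
proof (rule sum.cong[OF refl])
  fix \<alpha> assume \<alpha>: "\<alpha> \<in> species X"
  note [measurable] = L2D(1)[OF h_spaceD[OF assms(2) \<alpha>]] L2D(1)[OF h_spaceD[OF assms(3) \<alpha>]] L2D(1)[OF h_spaceD[OF assms(4) \<alpha>]]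
  show "(LINT z|phase X \<alpha>. f \<alpha> z * g \<alpha> z) = (LINT z|phase X \<alpha>. f' \<alpha> z * g \<alpha> z)"
    using assms(1) \<alpha> by (intro integral_cong_AE) (auto simp: h_eq_def)
qed

lemma h_inner_nonneg: "0 \<le> h_inner X f f"
  by (auto simp: h_inner_def intro!: sum_nonneg)

lemma h_inner_zero_imp_AE_zero:
  assumes f: "f \<in> h_space X" and 0: "h_inner X f f = 0" and \<alpha>: "\<alpha> \<in> species X"
  shows "AE z in phase X \<alpha>. f \<alpha> z = 0"
proof -
  have "(LINT z|phase X \<alpha>. f \<alpha> z * f \<alpha> z) = 0"
    using 0 \<alpha> unfolding h_inner_def by (subst (asm) sum_nonneg_eq_0_iff) auto
  then have "AE z in phase X \<alpha>. f \<alpha> z * f \<alpha> z = 0"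
    using integral_nonneg_eq_0_iff_AE[OF h_space_mult_integrable[OF f f \<alpha>]] by simp
  then show ?thesis by simp
qed

lemma h_inner_Cauchy_Schwarz:
  assumes f: "f \<in> h_space X" and g: "g \<in> h_space X"
  shows "\<bar>h_inner X f g\<bar> \<le> sqrt (h_inner X f f) * sqrt (h_inner X g g)"
proof (cases "h_inner X g g = 0")
  case True
  then have "h_eq X g (\<lambda>\<alpha> z. 0)" using h_inner_zero_imp_AE_zero[OF g] by (simp add: h_eq_def)
  then have "h_inner X g f = h_inner X (\<lambda>\<alpha> z. 0) f" by (rule h_inner_cong[OF _ g h_space_zero f])
  then have "h_inner X f g = 0" unfolding h_inner_sym[of X f] by (simp add: h_inner_def)
  then show ?thesis using h_inner_nonneg[of X f] h_inner_nonneg[of X g] by simp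
next
  case False
  define a b c where abc: "a = h_inner X f f" "b = h_inner X f g" "c = h_inner X g g"
  have c: "0 < c" using False h_inner_nonneg[of X g] by (simp add: abc)
  let ?w = "\<lambda>\<alpha> z. 1 * f \<alpha> z + (- b / c) * g \<alpha> z"
  have w: "?w \<in> h_space X" by (rule h_space_lincomb[OF f g])
  have "0 \<le> h_inner X ?w ?w" by (rule h_inner_nonneg)
  also have "h_inner X ?w ?w = 1 * h_inner X f ?w + (- b / c) * h_inner X g ?w"
    by (rule h_inner_lincomb[OF f g w])
  also have "h_inner X f ?w = 1 * a + (- b / c) * b"
    unfolding h_inner_sym[of X f] by (subst h_inner_lincomb[OF f g f]) (simp add: abc h_inner_sym[of X g f])
  also have "h_inner X g ?w = 1 * b + (- b / c) * c"
    unfolding h_inner_sym[of X g] by (subst h_inner_lincomb[OF f g g]) (simp add: abc)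
  finally have "b\<^sup>2 \<le> a * c" using c by (simp add: field_simps power2_eq_square)
  then have "sqrt (b\<^sup>2) \<le> sqrt (a * c)" by (rule real_sqrt_le_mono)
  then show ?thesis by (simp add: abc real_sqrt_mult)
qed

lemma h_inner_tendsto:
  assumes u: "\<And>n. u n \<in> h_space X" and f: "f \<in> h_space X" and h: "h \<in> h_space X"
    and lim: "(\<lambda>n::nat. h_dist X (u n) f) \<longlonglongrightarrow> 0"
  shows "(\<lambda>n. h_inner X h (u n)) \<longlonglongrightarrow> h_inner X h f"
proof -
  have lim0: "(\<lambda>n. sqrt (h_inner X h h) * h_dist X (u n) f) \<longlonglongrightarrow> 0"
    using tendsto_mult[OF tendsto_const lim] by simp
  have bound: "norm (h_inner X h (u n) - h_inner X h f) \<le> sqrt (h_inner X h h) * h_dist X (u n) f" for n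
    using h_inner_Cauchy_Schwarz[OF h h_space_diff[OF u f], of n]
    by (simp add: h_dist_def h_inner_diff_right[OF u f h])
  have "(\<lambda>n. h_inner X h (u n) - h_inner X h f) \<longlonglongrightarrow> 0"
    by (rule Lim_null_comparison[OF always_eventually[OF allI[OF bound]] lim0])
  then show ?thesis by (simp add: LIM_zero_iff)
qed

text \<open>
  The spectral cut-off of the multiplication operator, whose values lie in its domain.
\<close>

definition truncate :: "vfun \<Rightarrow> nat \<Rightarrow> vfun \<Rightarrow> vfun" where
  "truncate m n f = (\<lambda>\<alpha> z. (if \<bar>m \<alpha> z\<bar> \<le> real n then 1 else 0) * f \<alpha> z)"

text \<open>
  A multiplication operator with maximal domain minus an everywhere defined symmetric operator. Symmetry
  on the whole space makes \<open>K\<close> linear and compatible with equality almost everywhere.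
\<close>

locale multiplication_perturbation =
  fixes X :: mixture and m :: vfun and K :: "vfun \<Rightarrow> vfun"
  assumes m_measurable: "\<And>\<alpha>. \<alpha> \<in> species X \<Longrightarrow> m \<alpha> \<in> borel_measurable (phase X \<alpha>)"
    and K_space: "\<And>h. h \<in> h_space X \<Longrightarrow> K h \<in> h_space X"
    and K_symmetric: "\<And>h f. h \<in> h_space X \<Longrightarrow> f \<in> h_space X \<Longrightarrow> h_inner X (K h) f = h_inner X h (K f)"
begin

definition dom :: "vfun set" where
  "dom = {h \<in> h_space X. (\<lambda>\<alpha> z. m \<alpha> z * h \<alpha> z) \<in> h_space X}"

definition op :: "vfun \<Rightarrow> vfun" where
  "op h = (\<lambda>\<alpha> z. m \<alpha> z * h \<alpha> z - K h \<alpha> z)"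

lemma dom_space: "h \<in> dom \<Longrightarrow> h \<in> h_space X"
  by (simp add: dom_def)

lemma dom_mult: "h \<in> dom \<Longrightarrow> (\<lambda>\<alpha> z. m \<alpha> z * h \<alpha> z) \<in> h_space X"
  by (simp add: dom_def)

lemma op_space: "h \<in> dom \<Longrightarrow> op h \<in> h_space X"
  unfolding op_def by (intro h_space_diff dom_mult K_space dom_space)

lemma op_inner: "h \<in> dom \<Longrightarrow> f \<in> h_space X \<Longrightarrow>
    h_inner X (op h) f = h_inner X (\<lambda>\<alpha> z. m \<alpha> z * h \<alpha> z) f - h_inner X h (K f)"
  unfolding op_def by (subst h_inner_diff) (auto intro: dom_mult K_space dom_space simp: K_symmetric dom_space)

lemma op_symmetric:
  assumes "h \<in> dom" "f \<in> dom"
  shows "h_inner X (op h) f = h_inner X h (op f)"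
proof -
  have "h_inner X (\<lambda>\<alpha> z. m \<alpha> z * h \<alpha> z) f = h_inner X h (\<lambda>\<alpha> z. m \<alpha> z * f \<alpha> z)"
    by (simp add: h_inner_def mult_ac)
  then show ?thesis
    using assms by (simp add: op_inner dom_space) (simp add: op_def h_inner_diff_right dom_mult K_space dom_space)
qed

lemma truncate_space: "f \<in> h_space X \<Longrightarrow> truncate m n f \<in> h_space X"
  unfolding truncate_def
proof (rule h_space_bounded_mult[where c = 1])
  fix \<alpha> assume "\<alpha> \<in> species X"
  note [measurable] = m_measurable[OF this]
  show "(\<lambda>z. if \<bar>m \<alpha> z\<bar> \<le> real n then 1 else 0 :: real) \<in> borel_measurable (phase X \<alpha>)" by measurable
qed auto

lemma truncate_dom:
  assumes "f \<in> h_space X"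
  shows "truncate m n f \<in> dom"
proof -
  have "(\<lambda>\<alpha> z. (m \<alpha> z * (if \<bar>m \<alpha> z\<bar> \<le> real n then 1 else 0)) * f \<alpha> z) \<in> h_space X"
  proof (rule h_space_bounded_mult[OF assms, where c = "real n"])
    fix \<alpha> assume "\<alpha> \<in> species X"
    note [measurable] = m_measurable[OF this]
    show "(\<lambda>z. m \<alpha> z * (if \<bar>m \<alpha> z\<bar> \<le> real n then 1 else 0)) \<in> borel_measurable (phase X \<alpha>)" by measurable
  qed auto
  then show ?thesis using truncate_space[OF assms] by (simp add: dom_def truncate_def mult.assoc)
qed

lemma truncate_tendsto:
  assumes f: "f \<in> h_space X"
  shows "(\<lambda>n. h_dist X (truncate m n f) f) \<longlonglongrightarrow> 0"
proof -
  let ?d = "\<lambda>n \<alpha> z. truncate m n f \<alpha> z - f \<alpha> z"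
  have "(\<lambda>n. LINT z|phase X \<alpha>. ?d n \<alpha> z * ?d n \<alpha> z) \<longlonglongrightarrow> (LINT z|phase X \<alpha>. 0)" if \<alpha>: "\<alpha> \<in> species X" for \<alpha>
  proof (rule integral_dominated_convergence[where w = "\<lambda>z. (f \<alpha> z)\<^sup>2"])
    note [measurable] = L2D(1)[OF h_spaceD[OF f \<alpha>]] L2D(1)[OF h_spaceD[OF truncate_space[OF f] \<alpha>]]
    show "(\<lambda>z. ?d n \<alpha> z * ?d n \<alpha> z) \<in> borel_measurable (phase X \<alpha>)" for n by measurable
    show "integrable (phase X \<alpha>) (\<lambda>z. (f \<alpha> z)\<^sup>2)" by (rule L2D(2)[OF h_spaceD[OF f \<alpha>]])
    show "AE z in phase X \<alpha>. norm (?d n \<alpha> z * ?d n \<alpha> z) \<le> (f \<alpha> z)\<^sup>2" for n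
      by (auto simp: truncate_def power2_eq_square)
    show "AE z in phase X \<alpha>. (\<lambda>n. ?d n \<alpha> z * ?d n \<alpha> z) \<longlonglongrightarrow> 0"
    proof (rule AE_I2)
      fix z
      obtain N where "\<bar>m \<alpha> z\<bar> \<le> real N" using real_arch_simple by blast
      then have "\<forall>\<^sub>F n in sequentially. ?d n \<alpha> z * ?d n \<alpha> z = 0"
        by (intro eventually_sequentiallyI[of N]) (auto simp: truncate_def)
      then show "(\<lambda>n. ?d n \<alpha> z * ?d n \<alpha> z) \<longlonglongrightarrow> 0" by (rule tendsto_eventually)
    qed
  qed simp
  then have "(\<lambda>n. h_inner X (?d n) (?d n)) \<longlonglongrightarrow> (\<Sum>\<alpha>\<in>species X. 0)"
    unfolding h_inner_def by (intro tendsto_sum) simp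
  from tendsto_real_sqrt[OF this] show ?thesis by (simp add: h_dist_def)
qed

lemma dom_dense: "densely_defined X dom"
  unfolding densely_defined_def
proof (intro ballI allI impI)
  fix f and e :: real assume f: "f \<in> h_space X" and e: "0 < e"
  obtain n where "h_dist X (truncate m n f) f < e"
    using order_tendstoD(2)[OF truncate_tendsto[OF f] e] by (auto simp: eventually_sequentially)
  then show "\<exists>h\<in>dom. h_dist X h f < e" using truncate_dom[OF f] by blast
qed

lemma orthogonal_dom_zero:
  assumes u: "u \<in> h_space X" and orth: "\<And>h. h \<in> dom \<Longrightarrow> h_inner X u h = 0" and \<alpha>: "\<alpha> \<in> species X"
  shows "AE z in phase X \<alpha>. u \<alpha> z = 0"
proof (rule h_inner_zero_imp_AE_zero[OF u _ \<alpha>])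
  have "(\<lambda>n. h_inner X u (truncate m n u)) \<longlonglongrightarrow> h_inner X u u"
    by (rule h_inner_tendsto[OF truncate_space[OF u] u u truncate_tendsto[OF u]])
  then show "h_inner X u u = 0" using orth[OF truncate_dom[OF u]] by (simp add: LIMSEQ_const_iff)
qed

text \<open>
  The domain is dense, so an element is determined by its inner products with the domain. Through this lemma
  the symmetry of \<open>op\<close> implies that it is well defined and linear.
\<close>

lemma h_eqI_inner:
  assumes "u \<in> h_space X" "v \<in> h_space X" "\<And>h. h \<in> dom \<Longrightarrow> h_inner X u h = h_inner X v h"
  shows "h_eq X u v"
  unfolding h_eq_def
proof
  fix \<alpha> assume \<alpha>: "\<alpha> \<in> species X"
  have "AE z in phase X \<alpha>. u \<alpha> z - v \<alpha> z = 0"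
  proof (rule orthogonal_dom_zero[OF h_space_diff[OF assms(1,2)] _ \<alpha>])
    fix h assume h: "h \<in> dom"
    show "h_inner X (\<lambda>\<alpha> z. u \<alpha> z - v \<alpha> z) h = 0"
      unfolding h_inner_diff[OF assms(1,2) dom_space[OF h]] assms(3)[OF h] by simp
  qed
  then show "AE z in phase X \<alpha>. u \<alpha> z = v \<alpha> z" by simp
qed

lemma dom_lincomb:
  assumes "f \<in> dom" "g \<in> dom"
  shows "(\<lambda>\<alpha> z. a * f \<alpha> z + b * g \<alpha> z) \<in> dom"
proof -
  have "(\<lambda>\<alpha> z. a * (m \<alpha> z * f \<alpha> z) + b * (m \<alpha> z * g \<alpha> z)) \<in> h_space X"
    by (rule h_space_lincomb[OF dom_mult[OF assms(1)] dom_mult[OF assms(2)]])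
  moreover have "(\<lambda>\<alpha> z. a * (m \<alpha> z * f \<alpha> z) + b * (m \<alpha> z * g \<alpha> z)) = (\<lambda>\<alpha> z. m \<alpha> z * (a * f \<alpha> z + b * g \<alpha> z))"
    by (simp add: fun_eq_iff distrib_left)
  ultimately show ?thesis using h_space_lincomb[OF dom_space[OF assms(1)] dom_space[OF assms(2)], of a b]
    unfolding dom_def by simp
qed

lemma op_linear: "linear_operator X dom op"
  unfolding linear_operator_def
proof (intro conjI ballI allI impI)
  show "dom \<subseteq> h_space X" "op ` dom \<subseteq> h_space X" using dom_space op_space by auto
  show "(\<lambda>\<alpha> z. 0) \<in> dom" by (simp add: dom_def h_space_zero)
next
  fix f g assume f: "f \<in> dom" and g: "g \<in> h_space X" and eq: "h_eq X f g"
  show gd: "g \<in> dom"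
    unfolding dom_def
  proof (intro CollectI conjI g h_space_cong[OF dom_mult[OF f]])
    show "h_eq X (\<lambda>\<alpha> z. m \<alpha> z * f \<alpha> z) (\<lambda>\<alpha> z. m \<alpha> z * g \<alpha> z)" using eq by (auto simp: h_eq_def)
    fix \<alpha> assume \<alpha>: "\<alpha> \<in> species X"
    note [measurable] = m_measurable[OF \<alpha>] L2D(1)[OF h_spaceD[OF g \<alpha>]]
    show "(\<lambda>z. m \<alpha> z * g \<alpha> z) \<in> borel_measurable (phase X \<alpha>)" by measurable
  qed
  show "h_eq X (op f) (op g)"
  proof (rule h_eqI_inner[OF op_space[OF f] op_space[OF gd]])
    fix h assume h: "h \<in> dom"
    show "h_inner X (op f) h = h_inner X (op g) h"
      unfolding op_symmetric[OF f h] op_symmetric[OF gd h]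
      by (rule h_inner_cong[OF eq dom_space[OF f] g op_space[OF h]])
  qed
next
  fix f g a b assume f: "f \<in> dom" and g: "g \<in> dom"
  show l: "(\<lambda>\<alpha> z. a * f \<alpha> z + b * g \<alpha> z) \<in> dom" by (rule dom_lincomb[OF f g])
  show "h_eq X (op (\<lambda>\<alpha> z. a * f \<alpha> z + b * g \<alpha> z)) (\<lambda>\<alpha> z. a * op f \<alpha> z + b * op g \<alpha> z)"
  proof (rule h_eqI_inner[OF op_space[OF l] h_space_lincomb[OF op_space[OF f] op_space[OF g]]])
    fix h assume h: "h \<in> dom"
    show "h_inner X (op (\<lambda>\<alpha> z. a * f \<alpha> z + b * g \<alpha> z)) h = h_inner X (\<lambda>\<alpha> z. a * op f \<alpha> z + b * op g \<alpha> z) h"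
      unfolding op_symmetric[OF l h] h_inner_lincomb[OF op_space[OF f] op_space[OF g] dom_space[OF h]]
        op_symmetric[OF f h] op_symmetric[OF g h]
      by (rule h_inner_lincomb[OF dom_space[OF f] dom_space[OF g] op_space[OF h]])
  qed
qed

text \<open>
  If \<open>(f, g)\<close> lies in the graph of the adjoint, then \<open>k = g + K f\<close> satisfies \<open>(m h, f) = (h, k)\<close> for all \<open>h\<close> in the
  domain. Testing with cut-offs of \<open>w = m f - k\<close>, which belong to the domain, gives \<open>m f = k\<close>, so \<open>f\<close> is in the
  domain and \<open>op f = g\<close>.
\<close>

lemma op_self_adjoint: "self_adjoint_operator X dom op"
  unfolding self_adjoint_operator_def
proof (rule set_eqI, clarify)
  fix f g
  show "(f, g) \<in> adjoint_graph X dom op \<longleftrightarrow> (f, g) \<in> op_graph X dom op"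
  proof
    assume "(f, g) \<in> op_graph X dom op"
    then have f: "f \<in> dom" and g: "g \<in> h_space X" and eq: "h_eq X (op f) g" by (auto simp: op_graph_def)
    have "h_inner X (op h) f = h_inner X h g" if h: "h \<in> dom" for h
      unfolding op_symmetric[OF h f] h_inner_sym[of X h] by (rule h_inner_cong[OF eq op_space[OF f] g dom_space[OF h]])
    then show "(f, g) \<in> adjoint_graph X dom op" using f g by (simp add: adjoint_graph_def dom_space)
  next
    assume "(f, g) \<in> adjoint_graph X dom op"
    then have f: "f \<in> h_space X" and g: "g \<in> h_space X" and adj: "\<And>h. h \<in> dom \<Longrightarrow> h_inner X (op h) f = h_inner X h g"
      by (auto simp: adjoint_graph_def)
    define k where "k = (\<lambda>\<alpha> z. g \<alpha> z + K f \<alpha> z)"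
    have k: "k \<in> h_space X" unfolding k_def by (intro h_space_add g K_space f)
    have mult: "h_inner X (\<lambda>\<alpha> z. m \<alpha> z * h \<alpha> z) f = h_inner X h k" if h: "h \<in> dom" for h
      using adj[OF h] op_inner[OF h f] h_inner_add_right[OF g K_space[OF f] dom_space[OF h]] by (simp add: k_def)
    define w where "w = (\<lambda>\<alpha> z. m \<alpha> z * f \<alpha> z - k \<alpha> z)"
    have wn: "truncate m n w \<in> dom" and wn0: "h_inner X (truncate m n w) (truncate m n w) = 0" for n
    proof -
      have eq: "truncate m n w = (\<lambda>\<alpha> z. m \<alpha> z * truncate m n f \<alpha> z - truncate m n k \<alpha> z)"
        by (auto simp: truncate_def w_def fun_eq_iff)
      have wsp: "truncate m n w \<in> h_space X"
        unfolding eq by (intro h_space_diff dom_mult truncate_dom truncate_space f k)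
      have "truncate m n (truncate m n w) \<in> dom" by (rule truncate_dom[OF wsp])
      also have "truncate m n (truncate m n w) = truncate m n w" by (auto simp: truncate_def fun_eq_iff)
      finally show d: "truncate m n w \<in> dom" .
      have "h_inner X (truncate m n w) (truncate m n w)
         = (\<Sum>\<alpha>\<in>species X. LINT z|phase X \<alpha>. (m \<alpha> z * truncate m n w \<alpha> z) * f \<alpha> z - truncate m n w \<alpha> z * k \<alpha> z)"
        unfolding h_inner_def
        by (intro sum.cong refl Bochner_Integration.integral_cong) (auto simp: truncate_def w_def algebra_simps)
      also have "\<dots> = h_inner X (\<lambda>\<alpha> z. m \<alpha> z * truncate m n w \<alpha> z) f - h_inner X (truncate m n w) k"
        unfolding h_inner_def sum_subtractf[symmetric]
        by (intro sum.cong refl Bochner_Integration.integral_diff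
            h_space_mult_integrable[OF wsp k] h_space_mult_integrable[OF dom_mult[OF d] f])
      also have "\<dots> = 0" using mult[OF d] by simp
      finally show "h_inner X (truncate m n w) (truncate m n w) = 0" .
    qed
    have eqk: "h_eq X k (\<lambda>\<alpha> z. m \<alpha> z * f \<alpha> z)"
      unfolding h_eq_def
    proof
      fix \<alpha> assume \<alpha>: "\<alpha> \<in> species X"
      have "AE z in phase X \<alpha>. \<forall>n. truncate m n w \<alpha> z = 0"
        unfolding AE_all_countable using h_inner_zero_imp_AE_zero[OF dom_space[OF wn] wn0 \<alpha>] by blast
      then show "AE z in phase X \<alpha>. k \<alpha> z = m \<alpha> z * f \<alpha> z"
      proof eventually_elim
        fix z assume z: "\<forall>n. truncate m n w \<alpha> z = 0"
        obtain N where "\<bar>m \<alpha> z\<bar> \<le> real N" using real_arch_simple by blast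
        then show "k \<alpha> z = m \<alpha> z * f \<alpha> z" using z[rule_format, of N] by (simp add: truncate_def w_def)
      qed
    qed
    have "(\<lambda>\<alpha> z. m \<alpha> z * f \<alpha> z) \<in> h_space X"
    proof (rule h_space_cong[OF k eqk])
      fix \<alpha> assume \<alpha>: "\<alpha> \<in> species X"
      note [measurable] = m_measurable[OF \<alpha>] L2D(1)[OF h_spaceD[OF f \<alpha>]]
      show "(\<lambda>z. m \<alpha> z * f \<alpha> z) \<in> borel_measurable (phase X \<alpha>)" by measurable
    qed
    then have "f \<in> dom" using f by (simp add: dom_def)
    moreover have "h_eq X (op f) g"
      using eqk unfolding h_eq_def op_def k_def by (auto elim!: eventually_mono)
    ultimately show "(f, g) \<in> op_graph X dom op" using g by (simp add: op_graph_def)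
  qed
qed

text \<open>
  The graph of an adjoint is closed, by continuity of the inner product.
\<close>

lemma op_closed: "closed_operator X dom op"
  unfolding closed_operator_def
proof (intro allI impI, elim conjE)
  fix u f g
  assume u: "\<forall>n. u n \<in> dom" and f: "f \<in> h_space X" and g: "g \<in> h_space X"
    and lim: "(\<lambda>n::nat. h_dist X (u n) f) \<longlonglongrightarrow> 0" "(\<lambda>n. h_dist X (op (u n)) g) \<longlonglongrightarrow> 0"
  have "h_inner X (op h) f = h_inner X h g" if h: "h \<in> dom" for h
  proof (rule LIMSEQ_unique)
    show "(\<lambda>n. h_inner X (op h) (u n)) \<longlonglongrightarrow> h_inner X (op h) f"
      by (rule h_inner_tendsto[OF dom_space[OF u[rule_format]] f op_space[OF h] lim(1)])
    have "(\<lambda>n. h_inner X h (op (u n))) \<longlonglongrightarrow> h_inner X h g"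
      by (rule h_inner_tendsto[OF op_space[OF u[rule_format]] g dom_space[OF h] lim(2)])
    then show "(\<lambda>n. h_inner X (op h) (u n)) \<longlonglongrightarrow> h_inner X h g"
      using u h by (simp add: op_symmetric)
  qed
  then have "(f, g) \<in> adjoint_graph X dom op" using f g by (simp add: adjoint_graph_def)
  then show "(f, g) \<in> op_graph X dom op" using op_self_adjoint by (simp add: self_adjoint_operator_def)
qed

end

context bounded_mixture
begin

lemma K_AE:
  assumes h: "h \<in> h_space X" and \<alpha>: "\<alpha> \<in> species X"
  shows "AE z in phase X \<alpha>. \<forall>\<beta>\<in>species X. coll_integrable X \<alpha> \<beta> (fst z) (snd z) (K_fun X \<alpha> \<beta> h (snd z)) \<and>
    coll_integral X \<alpha> \<beta> (fst z) (snd z) (K_fun X \<alpha> \<beta> h (snd z)) =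
      gain_term X \<alpha> \<beta> \<alpha> reverse_event (h \<alpha>) z + gain_term X \<alpha> \<beta> \<beta> (cross_event) (h \<beta>) z
      - gain_term X \<alpha> \<beta> \<beta> swap_event (h \<beta>) z"
proof (rule AE_finite_allI[OF finite_species])
  fix \<beta> assume \<beta>: "\<beta> \<in> species X"
  have p: "partner \<alpha> \<beta> \<alpha> \<beta> reverse_event" "partner \<alpha> \<beta> \<beta> \<alpha> (cross_event)" "partner \<alpha> \<beta> \<beta> \<alpha> swap_event"
    by (simp_all add: partner_def)
  note hm = h_spaceD[OF h \<alpha>] h_spaceD[OF h \<beta>]
  note hb = hm[THEN L2_phase_measurable]
  show "AE z in phase X \<alpha>. coll_integrable X \<alpha> \<beta> (fst z) (snd z) (K_fun X \<alpha> \<beta> h (snd z)) \<and>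
    coll_integral X \<alpha> \<beta> (fst z) (snd z) (K_fun X \<alpha> \<beta> h (snd z)) =
      gain_term X \<alpha> \<beta> \<alpha> reverse_event (h \<alpha>) z + gain_term X \<alpha> \<beta> \<beta> (cross_event) (h \<beta>) z
      - gain_term X \<alpha> \<beta> \<beta> swap_event (h \<beta>) z"
    using gain_term_bounded(1)[OF p(1) \<alpha> \<beta> hm(1)] gain_term_bounded(1)[OF p(2) \<alpha> \<beta> hm(2)]
      gain_term_bounded(1)[OF p(3) \<alpha> \<beta> hm(2)] AE_phase[of X \<alpha>]
  proof eventually_elim
    fix z :: "(real^3) \<times> real"
    let ?N = "coll_measure X \<alpha> \<beta>" and ?T = "cross_event"
    let ?k = "\<lambda>\<tau> T c. h \<tau> (fst (T (coll_event X \<alpha> \<beta> (z, c)))) * (sym_kernel X \<alpha> \<beta> \<tau> T (coll_event X \<alpha> \<beta> (z, c)) * event_weight X \<alpha> \<beta> (z, c))"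
    let ?i = "coll_integrand X \<alpha> \<beta> (fst z) (snd z) (K_fun X \<alpha> \<beta> h (snd z))"
    assume i: "integrable ?N (?k \<alpha> reverse_event)" "integrable ?N (?k \<beta> ?T)" "integrable ?N (?k \<beta> swap_event)"
      and z: "internal_energy X \<alpha> (snd z)"
    let ?s = "\<lambda>c. ?k \<alpha> reverse_event c + ?k \<beta> ?T c - ?k \<beta> swap_event c"
    have ae: "AE c in ?N. ?s c = ?i c"
      using K_integrand_split[OF \<alpha> \<beta> z, of "fst z" h] by eventually_elim (simp add: Let_def)
    have s: "integrable ?N ?s" using i by (intro Bochner_Integration.integrable_diff Bochner_Integration.integrable_add)
    note [measurable (raw)] = trans_weight_measurable[OF \<alpha> \<beta>] measurable_compose[OF _ hb(1)] measurable_compose[OF _ hb(2)]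
    have m: "?i \<in> borel_measurable ?N"
      unfolding coll_integrand_def K_fun_def case_prod_beta by measurable
    have "integrable ?N ?i" by (rule integrable_cong_AE_imp[OF s m]) (use ae in \<open>auto elim: eventually_mono\<close>)
    moreover have "integral\<^sup>L ?N ?i = integral\<^sup>L ?N ?s"
      by (rule integral_cong_AE[OF m borel_measurable_integrable[OF s]]) (use ae in \<open>auto elim: eventually_mono\<close>)
    moreover have "integral\<^sup>L ?N ?s = integral\<^sup>L ?N (?k \<alpha> reverse_event) + integral\<^sup>L ?N (?k \<beta> ?T) - integral\<^sup>L ?N (?k \<beta> swap_event)"
      using i by (simp only: Bochner_Integration.integral_diff Bochner_Integration.integral_add Bochner_Integration.integrable_add)
    ultimately show "coll_integrable X \<alpha> \<beta> (fst z) (snd z) (K_fun X \<alpha> \<beta> h (snd z)) \<and>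
      coll_integral X \<alpha> \<beta> (fst z) (snd z) (K_fun X \<alpha> \<beta> h (snd z)) =
        gain_term X \<alpha> \<beta> \<alpha> reverse_event (h \<alpha>) z + gain_term X \<alpha> \<beta> \<beta> ?T (h \<beta>) z
        - gain_term X \<alpha> \<beta> \<beta> swap_event (h \<beta>) z"
      unfolding coll_integrable_def coll_integral_def gain_term_def by (simp only: simp_thms)
  qed
qed

lemma op_converges: "h \<in> h_space X \<Longrightarrow> op_L_converges X h"
  unfolding op_L_converges_def
proof
  fix \<alpha> assume h: "h \<in> h_space X" and \<alpha>: "\<alpha> \<in> species X"
  show "AE (\<xi>, I) in phase X \<alpha>. \<forall>\<beta>\<in>species X.
     coll_integrable X \<alpha> \<beta> \<xi> I (nu_fun X \<alpha> \<beta> I) \<and> coll_integrable X \<alpha> \<beta> \<xi> I (K_fun X \<alpha> \<beta> h I)"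
    using K_AE[OF h \<alpha>] AE_phase[of X \<alpha>]
    by eventually_elim (auto simp: nu_integrable[OF \<alpha>] split: prod.splits)
qed

definition gain_sum :: "vfun \<Rightarrow> vfun" where
  "gain_sum h = (\<lambda>\<alpha> z. \<Sum>\<beta>\<in>species X. gain_term X \<alpha> \<beta> \<alpha> reverse_event (h \<alpha>) z
      + gain_term X \<alpha> \<beta> \<beta> (cross_event) (h \<beta>) z - gain_term X \<alpha> \<beta> \<beta> swap_event (h \<beta>) z)"

lemma op_K_gain_sum: "h \<in> h_space X \<Longrightarrow> h_eq X (gain_sum h) (op_K X h)"
  unfolding h_eq_def
proof
  fix \<alpha> assume h: "h \<in> h_space X" and \<alpha>: "\<alpha> \<in> species X"
  show "AE z in phase X \<alpha>. gain_sum h \<alpha> z = op_K X h \<alpha> z"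
    using K_AE[OF h \<alpha>] by eventually_elim (simp add: gain_sum_def op_K_def case_prod_beta)
qed

lemma gain_terms_L2:
  assumes h: "h \<in> h_space X" and \<alpha>: "\<alpha> \<in> species X" and \<beta>: "\<beta> \<in> species X"
  shows "gain_term X \<alpha> \<beta> \<alpha> reverse_event (h \<alpha>) \<in> L2 (phase X \<alpha>)"
    "gain_term X \<alpha> \<beta> \<beta> cross_event (h \<beta>) \<in> L2 (phase X \<alpha>)"
    "gain_term X \<alpha> \<beta> \<beta> swap_event (h \<beta>) \<in> L2 (phase X \<alpha>)"
proof -
  have p: "partner \<alpha> \<beta> \<alpha> \<beta> reverse_event" "partner \<alpha> \<beta> \<beta> \<alpha> cross_event" "partner \<alpha> \<beta> \<beta> \<alpha> swap_event"
    by (simp_all add: partner_def)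
  note hm = h_spaceD[OF h \<alpha>] h_spaceD[OF h \<beta>]
  show "gain_term X \<alpha> \<beta> \<alpha> reverse_event (h \<alpha>) \<in> L2 (phase X \<alpha>)"
    "gain_term X \<alpha> \<beta> \<beta> cross_event (h \<beta>) \<in> L2 (phase X \<alpha>)"
    "gain_term X \<alpha> \<beta> \<beta> swap_event (h \<beta>) \<in> L2 (phase X \<alpha>)"
    by (fact gain_term_bounded(2)[OF p(1) \<alpha> \<beta> hm(1)] gain_term_bounded(2)[OF p(2) \<alpha> \<beta> hm(2)]
      gain_term_bounded(2)[OF p(3) \<alpha> \<beta> hm(2)])+
qed

lemma gain_sum_space: "h \<in> h_space X \<Longrightarrow> gain_sum h \<in> h_space X"
  by (subst h_space_iff, unfold gain_sum_def)
    (intro ballI L2_sum L2_diff L2_add gain_terms_L2 finite_species)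

lemma gain_sum_inner:
  assumes h: "h \<in> h_space X" and f: "f \<in> h_space X"
  shows "h_inner X f (gain_sum h) = (\<Sum>\<alpha>\<in>species X. \<Sum>\<beta>\<in>species X.
      (LINT z|phase X \<alpha>. f \<alpha> z * gain_term X \<alpha> \<beta> \<alpha> reverse_event (h \<alpha>) z)
      + (LINT z|phase X \<alpha>. f \<alpha> z * gain_term X \<alpha> \<beta> \<beta> (cross_event) (h \<beta>) z)
      - (LINT z|phase X \<alpha>. f \<alpha> z * gain_term X \<alpha> \<beta> \<beta> swap_event (h \<beta>) z))"
  unfolding h_inner_def
proof (rule sum.cong[OF refl])
  fix \<alpha> assume \<alpha>: "\<alpha> \<in> species X"
  note fm = h_spaceD[OF f \<alpha>]
  let ?a = "\<lambda>\<beta>. gain_term X \<alpha> \<beta> \<alpha> reverse_event (h \<alpha>)" and ?b = "\<lambda>\<beta>. gain_term X \<alpha> \<beta> \<beta> (cross_event) (h \<beta>)"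
    and ?c = "\<lambda>\<beta>. gain_term X \<alpha> \<beta> \<beta> swap_event (h \<beta>)"
  have i: "integrable (phase X \<alpha>) (\<lambda>z. f \<alpha> z * ?a \<beta> z)" "integrable (phase X \<alpha>) (\<lambda>z. f \<alpha> z * ?b \<beta> z)"
    "integrable (phase X \<alpha>) (\<lambda>z. f \<alpha> z * ?c \<beta> z)" if "\<beta> \<in> species X" for \<beta>
    by (rule L2_mult_integrable[OF fm gain_terms_L2(1)[OF h \<alpha> that]]
        L2_mult_integrable[OF fm gain_terms_L2(2)[OF h \<alpha> that]] L2_mult_integrable[OF fm gain_terms_L2(3)[OF h \<alpha> that]])+
  have "(LINT z|phase X \<alpha>. f \<alpha> z * gain_sum h \<alpha> z)
     = (LINT z|phase X \<alpha>. (\<Sum>\<beta>\<in>species X. f \<alpha> z * ?a \<beta> z + f \<alpha> z * ?b \<beta> z - f \<alpha> z * ?c \<beta> z))"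
    by (simp only: gain_sum_def sum_distrib_left distrib_left right_diff_distrib)
  also have "\<dots> = (\<Sum>\<beta>\<in>species X. LINT z|phase X \<alpha>. f \<alpha> z * ?a \<beta> z + f \<alpha> z * ?b \<beta> z - f \<alpha> z * ?c \<beta> z)"
    by (rule Bochner_Integration.integral_sum) (intro Bochner_Integration.integrable_diff Bochner_Integration.integrable_add i)
  also have "\<dots> = (\<Sum>\<beta>\<in>species X. (LINT z|phase X \<alpha>. f \<alpha> z * ?a \<beta> z) + (LINT z|phase X \<alpha>. f \<alpha> z * ?b \<beta> z) - (LINT z|phase X \<alpha>. f \<alpha> z * ?c \<beta> z))"
    by (rule sum.cong[OF refl]) (simp only: Bochner_Integration.integral_diff Bochner_Integration.integral_add Bochner_Integration.integrable_add i)
  finally show "(LINT z|phase X \<alpha>. f \<alpha> z * gain_sum h \<alpha> z)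
     = (\<Sum>\<beta>\<in>species X. (LINT z|phase X \<alpha>. f \<alpha> z * ?a \<beta> z) + (LINT z|phase X \<alpha>. f \<alpha> z * ?b \<beta> z) - (LINT z|phase X \<alpha>. f \<alpha> z * ?c \<beta> z))" .
qed

text \<open>
  The part with partner \<open>z'\<close> is symmetric for every pair of species. In the other two parts the partner is of
  species \<open>\<beta>\<close>, and the symmetry relates the pair \<open>(\<alpha>, \<beta>)\<close> to \<open>(\<beta>, \<alpha>)\<close>; it is restored by summation.
\<close>

lemma gain_sum_symmetric:
  assumes h: "h \<in> h_space X" and f: "f \<in> h_space X"
  shows "h_inner X f (gain_sum h) = h_inner X h (gain_sum f)"
proof -
  let ?T = "cross_event" and ?S = "species X"
  define a where "a f h \<alpha> \<beta> = (LINT z|phase X \<alpha>. f \<alpha> z * gain_term X \<alpha> \<beta> \<alpha> reverse_event (h \<alpha>) z)" for f h :: vfun and \<alpha> \<beta>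
  define b where "b T f h \<alpha> \<beta> = (LINT z|phase X \<alpha>. f \<alpha> z * gain_term X \<alpha> \<beta> \<beta> T (h \<beta>) z)" for T and f h :: vfun and \<alpha> \<beta>
  have p: "partner \<alpha> \<beta> \<alpha> \<beta> reverse_event" "partner \<alpha> \<beta> \<beta> \<alpha> ?T" "partner \<alpha> \<beta> \<beta> \<alpha> swap_event" for \<alpha> \<beta>
    by (simp_all add: partner_def)
  have "a f h \<alpha> \<beta> = a h f \<alpha> \<beta>" if "\<alpha> \<in> ?S" "\<beta> \<in> ?S" for \<alpha> \<beta>
    unfolding a_def by (rule gain_symmetric[OF p(1) that h_spaceD[OF f that(1)] h_spaceD[OF h that(1)]])
  then have A: "(\<Sum>\<alpha>\<in>?S. \<Sum>\<beta>\<in>?S. a f h \<alpha> \<beta>) = (\<Sum>\<alpha>\<in>?S. \<Sum>\<beta>\<in>?S. a h f \<alpha> \<beta>)" by simp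
  have "b ?T f h \<alpha> \<beta> = b ?T h f \<beta> \<alpha>" "b swap_event f h \<alpha> \<beta> = b swap_event h f \<beta> \<alpha>" if "\<alpha> \<in> ?S" "\<beta> \<in> ?S" for \<alpha> \<beta>
    unfolding b_def by (rule gain_symmetric[OF p(2) that h_spaceD[OF f that(1)] h_spaceD[OF h that(2)]],
        rule gain_symmetric[OF p(3) that h_spaceD[OF f that(1)] h_spaceD[OF h that(2)]])
  then have B: "(\<Sum>\<alpha>\<in>?S. \<Sum>\<beta>\<in>?S. b ?T f h \<alpha> \<beta>) = (\<Sum>\<alpha>\<in>?S. \<Sum>\<beta>\<in>?S. b ?T h f \<beta> \<alpha>)"
    "(\<Sum>\<alpha>\<in>?S. \<Sum>\<beta>\<in>?S. b swap_event f h \<alpha> \<beta>) = (\<Sum>\<alpha>\<in>?S. \<Sum>\<beta>\<in>?S. b swap_event h f \<beta> \<alpha>)" by simp_all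
  have "h_inner X f (gain_sum h) = (\<Sum>\<alpha>\<in>?S. \<Sum>\<beta>\<in>?S. a f h \<alpha> \<beta>) + (\<Sum>\<alpha>\<in>?S. \<Sum>\<beta>\<in>?S. b ?T f h \<alpha> \<beta>) - (\<Sum>\<alpha>\<in>?S. \<Sum>\<beta>\<in>?S. b swap_event f h \<alpha> \<beta>)"
    unfolding gain_sum_inner[OF h f] a_def b_def by (simp only: sum.distrib sum_subtractf)
  also have "\<dots> = (\<Sum>\<alpha>\<in>?S. \<Sum>\<beta>\<in>?S. a h f \<alpha> \<beta>) + (\<Sum>\<alpha>\<in>?S. \<Sum>\<beta>\<in>?S. b ?T h f \<alpha> \<beta>) - (\<Sum>\<alpha>\<in>?S. \<Sum>\<beta>\<in>?S. b swap_event h f \<alpha> \<beta>)"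
    unfolding A B by (simp only: sum.swap[of "\<lambda>\<alpha> \<beta>. b _ h f \<beta> \<alpha>"])
  also have "\<dots> = h_inner X h (gain_sum f)"
    unfolding gain_sum_inner[OF f h] a_def b_def by (simp only: sum.distrib sum_subtractf)
  finally show ?thesis .
qed

lemma op_K_measurable:
  assumes h: "h \<in> h_space X" and \<alpha>: "\<alpha> \<in> species X"
  shows "op_K X h \<alpha> \<in> borel_measurable (phase X \<alpha>)"
proof -
  have hb: "h \<delta> \<in> borel_measurable borel" if "\<delta> \<in> species X" for \<delta>
    by (rule L2_phase_measurable[OF h_spaceD[OF h that]])
  have "op_K X h \<alpha> = (\<lambda>z. \<Sum>\<beta>\<in>species X. coll_integral X \<alpha> \<beta> (fst z) (snd z) (K_fun X \<alpha> \<beta> h (snd z)))"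
    by (auto simp: op_K_def)
  also have "\<dots> \<in> borel_measurable borel"
  proof (rule borel_measurable_sum)
    fix \<beta> assume \<beta>: "\<beta> \<in> species X"
    show "(\<lambda>z. coll_integral X \<alpha> \<beta> (fst z) (snd z) (K_fun X \<alpha> \<beta> h (snd z))) \<in> borel_measurable borel"
      by (rule K_integral_measurable[where h = h, OF \<alpha> \<beta> hb[OF \<alpha>] hb[OF \<beta>]])
  qed
  finally show ?thesis unfolding measurable_cong_sets[OF sets_phase refl] .
qed

lemma nu_measurable:
  assumes \<alpha>: "\<alpha> \<in> species X"
  shows "nu X \<alpha> \<in> borel_measurable (phase X \<alpha>)"
proof -
  have "nu X \<alpha> = (\<lambda>z. \<Sum>\<beta>\<in>species X. coll_integral X \<alpha> \<beta> (fst z) (snd z) (nu_fun X \<alpha> \<beta> (snd z)))"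
    by (auto simp: nu_def)
  also have "\<dots> \<in> borel_measurable borel"
    by (rule borel_measurable_sum) (rule nu_integral_measurable[OF \<alpha>])
  finally show ?thesis unfolding measurable_cong_sets[OF sets_phase refl] .
qed

lemma op_K_space: "h \<in> h_space X \<Longrightarrow> op_K X h \<in> h_space X"
  by (rule h_space_cong[OF gain_sum_space op_K_gain_sum op_K_measurable])

lemma op_K_symmetric:
  assumes h: "h \<in> h_space X" and f: "f \<in> h_space X"
  shows "h_inner X (op_K X h) f = h_inner X h (op_K X f)"
proof -
  have "h_inner X (gain_sum h) f = h_inner X (op_K X h) f"
    by (rule h_inner_cong[OF op_K_gain_sum[OF h] gain_sum_space[OF h] op_K_space[OF h] f])
  moreover have "h_inner X (gain_sum f) h = h_inner X (op_K X f) h"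
    by (rule h_inner_cong[OF op_K_gain_sum[OF f] gain_sum_space[OF f] op_K_space[OF f] h])
  ultimately show ?thesis
    using gain_sum_symmetric[OF h f] by (simp add: h_inner_sym[of X f] h_inner_sym[of X h])
qed

sublocale L: multiplication_perturbation X "nu X" "op_K X"
  by unfold_locales (rule nu_measurable op_K_space op_K_symmetric; assumption)+

lemma dom_L_eq: "dom_L X = L.dom"
  by (simp add: dom_L_def L.dom_def op_Lambda_def)

lemma op_L_eq: "op_L X = L.op"
  by (auto simp: op_L_def L.op_def op_Lambda_def fun_eq_iff)

end

theorem corollary1:
  fixes X :: mixture and \<gamma> C :: real
  assumes "gas_mixture X"
    and "0 < \<gamma>" and "\<gamma> < 1" and "0 < C"
    and "\<And>\<alpha> \<beta> r c I Is I' Is'.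
      \<alpha> \<in> species X \<Longrightarrow> \<beta> \<in> species X \<Longrightarrow> collision_args X \<alpha> \<beta> r c I Is I' Is' \<Longrightarrow>
      0 \<le> xsec X \<alpha> \<beta> r c I Is I' Is' \<and>
      xsec X \<alpha> \<beta> r c I Is I' Is' \<le>
        C * ((Psi X \<alpha> \<beta> r I Is I' Is' + Psi X \<alpha> \<beta> r I Is I' Is' powr (\<gamma> / 2)) / r\<^sup>2)
          * Upsilon X \<alpha> \<beta> r I Is I' Is'"
  shows "(\<forall>h\<in>dom_L X. op_L_converges X h) \<and>
    linear_operator X (dom_L X) (op_L X) \<and>
    closed_operator X (dom_L X) (op_L X) \<and>
    densely_defined X (dom_L X) \<and>
    self_adjoint_operator X (dom_L X) (op_L X)"
proof -
  interpret bounded_mixture X \<gamma> C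
    using assms by (intro bounded_mixture.intro bounded_mixture_axioms.intro) blast+
  show ?thesis
    unfolding dom_L_eq op_L_eq
    using op_converges L.dom_space L.op_linear L.op_closed L.dom_dense L.op_self_adjoint by blast
qed

end
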